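(* Let $d\geq 2$, $N\geq 1$, let $A,B\in\mathbb{C}^{N,N}$ be simultaneously diagonalizable (over $\mathbb{C}$), let every eigenvalue of $A$ have positive real part, and let $S\in\mathbb{R}^{d,d}$ be skew-symmetric. Let $1\leq p<\infty$ and let $\theta\in C(\mathbb{R}^d,\mathbb{R})$ be a radial weight function of exponential growth rate $\eta\geq 0$ satisfying $$\lim_{|\psi|\to0}\sup_{x\in\mathbb{R}^d}\left|\frac{\theta(x+\psi)-\theta(x)}{\theta(x)}\right|=0.$$ Let $T(0)=I$ and, for $t>0$, $[T(t)v](x)=\int_{\mathbb{R}^d}H(x,\xi,t)v(\xi)\,d\xi$ with $$H(x,\xi,t)=(4\pi tA)^{-\frac d2}\exp\left(-Bt-(4tA)^{-1}|e^{tS}x-\xi|^2\right).$$ Then $(T(t))_{t\geq0}$ is a $C_0$-semigroup (strongly continuous semigroup) on $L^p_\theta(\mathbb{R}^d,\mathbb{C}^N)$, i.e. $$\lim_{t\downarrow0}\|T(t)v-v\|_{L^p_\theta(\mathbb{R}^d,\mathbb{C}^N)}=0\qquad\text{for all }v\in L^p_\theta(\mathbb{R}^d,\mathbb{C}^N).$$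
   Context: A function $\theta\in C(\mathbb{R}^d,\mathbb{R})$ is a weight function of exponential growth rate $\eta\geq0$ if $\theta(x)>0$ for all $x$ and there is $C_\theta>0$ with $\theta(x+y)\leq C_\theta\theta(x)e^{\eta|y|}$ for all $x,y\in\mathbb{R}^d$. It is radial if there is $\phi:[0,\infty)\to\mathbb{R}$ with $\theta(x)=\phi(|x|)$ for all $x$. $L^p_\theta(\mathbb{R}^d,\mathbb{C}^N)=\{v\in L^1_{\mathrm{loc}}(\mathbb{R}^d,\mathbb{C}^N):\|\theta v\|_{L^p}<\infty\}$ with norm $\|v\|_{L^p_\theta}=\|\theta v\|_{L^p}$. Matrix powers: if $A=Y\,\mathrm{diag}(\lambda_k)\,Y^{-1}$ then $(4\pi tA)^{-d/2}=Y\,\mathrm{diag}\big((4\pi t\lambda_k)^{-d/2}\big)\,Y^{-1}$, with $z^{-d/2}=\exp(-\frac d2\mathrm{Log}\,z)$ and $\mathrm{Log}$ the principal logarithm. *)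

theory Defs
  imports "HOL-Analysis.Analysis"
begin

text \<open>
  On the type \<^typ>\<open>'a^'n^'n\<close> the operations \<open>*\<close> and \<open>^\<close> act componentwise, so powers and the
  exponential with respect to the matrix product \<open>**\<close> are introduced here.
\<close>

primrec mat_pow :: "'a::semiring_1^'n^'n \<Rightarrow> nat \<Rightarrow> 'a^'n^'n" where
  "mat_pow M 0 = mat 1"
| "mat_pow M (Suc k) = M ** mat_pow M k"

definition mat_exp :: "'a::real_normed_field^'n^'n \<Rightarrow> 'a^'n^'n" where
  "mat_exp M = (\<Sum>k. inverse (fact k) *\<^sub>R mat_pow M k)"

definition diag_mat :: "('n \<Rightarrow> 'a::zero) \<Rightarrow> 'a^'n^'n" where
  "diag_mat l = (\<chi> i j. if i = j then l i else 0)"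

definition simultaneously_diagonalizable :: "'a::semiring_1^'n^'n \<Rightarrow> 'a^'n^'n \<Rightarrow> bool" where
  "simultaneously_diagonalizable A B \<longleftrightarrow>
     (\<exists>(Y :: 'a^'n^'n) a b. invertible Y \<and> A = Y ** diag_mat a ** matrix_inv Y
                          \<and> B = Y ** diag_mat b ** matrix_inv Y)"

definition mat_eigenvalue :: "'a::semiring_1^'n^'n \<Rightarrow> 'a \<Rightarrow> bool" where
  "mat_eigenvalue A l \<longleftrightarrow> (\<exists>v. v \<noteq> 0 \<and> A *v v = l *s v)"

definition skew_symmetric :: "real^'d^'d \<Rightarrow> bool" where
  "skew_symmetric S \<longleftrightarrow> transpose S = - S"

text \<open>
  Functional calculus for diagonalizable matrices. The result does not depend on the chosen
  diagonalization, see \<open>mat_fun_diag\<close> below; the value is unspecified if \<open>A\<close> is not diagonalizable.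
\<close>

definition mat_fun :: "('a::field \<Rightarrow> 'a) \<Rightarrow> 'a^'n^'n \<Rightarrow> 'a^'n^'n" where
  "mat_fun f A = (THE X. \<exists>(Y :: 'a^'n^'n) l. invertible Y \<and> A = Y ** diag_mat l ** matrix_inv Y
                                \<and> X = Y ** diag_mat (\<lambda>k. f (l k)) ** matrix_inv Y)"

lemma diag_mat_mult_left: "(diag_mat l ** W) $ i $ j = l i * W $ i $ j"
  by (simp add: diag_mat_def matrix_matrix_mult_def if_distrib[where f = "\<lambda>x. x * _"] cong: if_cong)

lemma diag_mat_mult_right: "(W ** diag_mat l) $ i $ j = W $ i $ j * (l j :: 'a::semiring_1)"
  by (simp add: diag_mat_def matrix_matrix_mult_def if_distrib[where f = "\<lambda>x. _ * x"] cong: if_cong)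

lemma mat_fun_unique:
  fixes Y Z :: "'a::field^'n^'n"
  assumes Y: "invertible Y" and Z: "invertible Z"
    and eq: "Y ** diag_mat a ** matrix_inv Y = Z ** diag_mat b ** matrix_inv Z"
  shows "Y ** diag_mat (\<lambda>k. f (a k)) ** matrix_inv Y = Z ** diag_mat (\<lambda>k. f (b k)) ** matrix_inv Z"
proof -
  have invY: "matrix_inv Y ** Y = mat 1" "Y ** matrix_inv Y = mat 1"
    using someI_ex[OF Y[unfolded invertible_def]] unfolding matrix_inv_def by auto
  have invZ: "matrix_inv Z ** Z = mat 1" "Z ** matrix_inv Z = mat 1"
    using someI_ex[OF Z[unfolded invertible_def]] unfolding matrix_inv_def by auto
  define W where "W = matrix_inv Z ** Y"
  have ZW: "Z ** W = Y"
    unfolding W_def by (metis invZ(2) matrix_mul_assoc matrix_mul_lid)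
  have "W ** diag_mat a = matrix_inv Z ** (Y ** diag_mat a ** matrix_inv Y) ** Y"
    unfolding W_def by (metis invY(1) matrix_mul_assoc matrix_mul_rid)
  also have "\<dots> = diag_mat b ** W"
    unfolding eq W_def by (metis invZ(1) matrix_mul_assoc matrix_mul_lid)
  finally have comm: "W ** diag_mat a = diag_mat b ** W" .
  have *: "W $ i $ j * a j = b i * W $ i $ j" for i j
    using arg_cong[OF comm, of "\<lambda>M. M $ i $ j"]
    by (simp add: diag_mat_mult_left diag_mat_mult_right)
  then have "W $ i $ j * f (a j) = f (b i) * W $ i $ j" for i j
    using *[of i j] by (cases "W $ i $ j = 0") (auto simp: mult.commute)
  then have "W ** diag_mat (\<lambda>k. f (a k)) = diag_mat (\<lambda>k. f (b k)) ** W"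
    by (simp add: vec_eq_iff diag_mat_mult_left diag_mat_mult_right)
  then have "Z ** (W ** diag_mat (\<lambda>k. f (a k))) ** matrix_inv Y
      = Z ** (diag_mat (\<lambda>k. f (b k)) ** W) ** matrix_inv Y"
    by simp
  moreover have "W ** matrix_inv Y = matrix_inv Z"
    unfolding W_def by (metis invY(2) matrix_mul_assoc matrix_mul_rid)
  ultimately show ?thesis
    using ZW by (metis matrix_mul_assoc)
qed

lemma mat_fun_diag:
  fixes A Y :: "'a::field^'n^'n" and f :: "'a \<Rightarrow> 'a" and l :: "'n \<Rightarrow> 'a"
  assumes "invertible Y" "A = Y ** diag_mat l ** matrix_inv Y"
  shows "mat_fun f A = Y ** diag_mat (\<lambda>k. f (l k)) ** matrix_inv Y"
  unfolding mat_fun_def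
  by (rule the_equality) (use assms mat_fun_unique[of _ Y] in blast)+

text \<open>Principal powers, \<open>z\<^sup>r = exp (r Ln z)\<close> with \<^const>\<open>Ln\<close> the principal branch.\<close>

definition mat_powr :: "complex^'n^'n \<Rightarrow> real \<Rightarrow> complex^'n^'n" where
  "mat_powr A r = mat_fun (\<lambda>z. exp (complex_of_real r * Ln z)) A"

definition weight_function :: "real \<Rightarrow> (real^'d \<Rightarrow> real) \<Rightarrow> bool" where
  "weight_function \<eta> \<theta> \<longleftrightarrow> \<eta> \<ge> 0 \<and> continuous_on UNIV \<theta> \<and> (\<forall>x. \<theta> x > 0) \<and>
     (\<exists>C>0. \<forall>x y. \<theta> (x + y) \<le> C * \<theta> x * exp (\<eta> * norm y))"

definition radial :: "(real^'d \<Rightarrow> real) \<Rightarrow> bool" where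
  "radial \<theta> \<longleftrightarrow> (\<exists>\<phi>. \<forall>x. \<theta> x = \<phi> (norm x))"

definition locally_integrable :: "('a::euclidean_space \<Rightarrow> 'b::{banach, second_countable_topology}) \<Rightarrow> bool"
  where "locally_integrable v \<longleftrightarrow> (\<forall>K. compact K \<longrightarrow> set_integrable lebesgue K v)"

text \<open>
  The elements of the weighted \<open>L\<^sup>p\<close> space (for \<open>1 \<le> p < \<infinity>\<close>) are represented by functions; two
  functions represent the same element iff they agree almost everywhere.
\<close>

definition Lp_space :: "real \<Rightarrow> (real^'d \<Rightarrow> real) \<Rightarrow> (real^'d \<Rightarrow> complex^'n) set" where
  "Lp_space p \<theta> = {v. locally_integrable v \<and>
                      integrable lebesgue (\<lambda>x. norm (\<theta> x *\<^sub>R v x) powr p)}"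

definition Lp_norm :: "real \<Rightarrow> (real^'d \<Rightarrow> real) \<Rightarrow> (real^'d \<Rightarrow> complex^'n) \<Rightarrow> real" where
  "Lp_norm p \<theta> v = (LINT x|lebesgue. norm (\<theta> x *\<^sub>R v x) powr p) powr (1 / p)"

text \<open>
  Strongly continuous semigroups of bounded (complex) linear operators on the weighted \<open>L\<^sup>p\<close> space.
  Equality of elements is equality almost everywhere; the second clause says that \<open>T t\<close> is
  well-defined on equivalence classes.
\<close>

definition C0_semigroup_on_Lp ::
  "real \<Rightarrow> (real^'d \<Rightarrow> real) \<Rightarrow> (real \<Rightarrow> (real^'d \<Rightarrow> complex^'n) \<Rightarrow> (real^'d \<Rightarrow> complex^'n)) \<Rightarrow> bool"
  where
  "C0_semigroup_on_Lp p \<theta> T \<longleftrightarrow>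
     (\<forall>t\<ge>0. \<forall>v\<in>Lp_space p \<theta>. T t v \<in> Lp_space p \<theta>) \<and>
     (\<forall>t\<ge>0. \<forall>u\<in>Lp_space p \<theta>. \<forall>v\<in>Lp_space p \<theta>.
        (AE x in lebesgue. u x = v x) \<longrightarrow> (AE x in lebesgue. T t u x = T t v x)) \<and>
     (\<forall>t\<ge>0. \<forall>u\<in>Lp_space p \<theta>. \<forall>v\<in>Lp_space p \<theta>. \<forall>a b.
        AE x in lebesgue. T t (\<lambda>y. a *s u y + b *s v y) x = a *s T t u x + b *s T t v x) \<and>
     (\<forall>t\<ge>0. \<exists>C. \<forall>v\<in>Lp_space p \<theta>. Lp_norm p \<theta> (T t v) \<le> C * Lp_norm p \<theta> v) \<and>
     (\<forall>v\<in>Lp_space p \<theta>. AE x in lebesgue. T 0 v x = v x) \<and>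
     (\<forall>s\<ge>0. \<forall>t\<ge>0. \<forall>v\<in>Lp_space p \<theta>. AE x in lebesgue. T (s + t) v x = T s (T t v) x) \<and>
     (\<forall>v\<in>Lp_space p \<theta>. ((\<lambda>t. Lp_norm p \<theta> (\<lambda>x. T t v x - v x)) \<longlongrightarrow> 0) (at_right 0))"

definition heat_kernel ::
  "complex^'n^'n \<Rightarrow> complex^'n^'n \<Rightarrow> real^'d^'d \<Rightarrow> real^'d \<Rightarrow> real^'d \<Rightarrow> real \<Rightarrow> complex^'n^'n" where
  "heat_kernel A B S x \<xi> t =
     mat_powr ((4 * pi * t) *\<^sub>R A) (- (real CARD('d) / 2)) **
     mat_exp (- (t *\<^sub>R B) -
       (norm (mat_exp (t *\<^sub>R S) *v x - \<xi>))\<^sup>2 *\<^sub>R matrix_inv ((4 * t) *\<^sub>R A))"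

definition heat_op ::
  "complex^'n^'n \<Rightarrow> complex^'n^'n \<Rightarrow> real^'d^'d \<Rightarrow> real \<Rightarrow> (real^'d \<Rightarrow> complex^'n) \<Rightarrow> (real^'d \<Rightarrow> complex^'n)"
  where
  "heat_op A B S t v =
     (if t = 0 then v else (\<lambda>x. LINT \<xi>|lebesgue. heat_kernel A B S x \<xi> t *v v \<xi>))"

end

theory Submission
  imports Defs "HOL-Probability.Distributions" "HOL-Complex_Analysis.Conformal_Mappings"
begin

text \<open>
  In a common eigenbasis of \<open>A\<close> and \<open>B\<close> the heat kernel splits into scalar complex Gaussians, composed
  with the rotations \<open>e\<^sup>t\<^sup>S\<close>. Since the weight is radial and grows at most exponentially, while the kernel
  has a Gaussian majorant, a weighted Young inequality bounds \<open>T(t)\<close> on \<open>L\<^sup>p\<^sub>\<theta>\<close>, uniformly for \<open>t \<le> 1\<close>.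
  The semigroup law reduces, by Fubini and rotation invariance, to the convolution identity
  \<open>G\<^sub>a\<^sub>s * G\<^sub>a\<^sub>t = G\<^sub>a\<^sub>(\<^sub>s\<^sub>+\<^sub>t\<^sub>)\<close>, in which completing the square needs only a real shift, so that the
  complex Gaussian integral, obtained by analytic continuation from real parameters, suffices. Strong
  continuity follows from the uniform bounds and dominated convergence for continuous functions of
  compact support, which are dense.
\<close>

subsection \<open>The exponential of a skew-symmetric matrix\<close>

text \<open>The rotations are harmless for two reasons. The radial weight satisfies \<theta> x =
  \<theta> (R x), so the growth estimate applies to R x = \<xi> + (R x - \<xi>). Every scalar
  Gaussian is radial too, so in a convolution R \<xi> - \<zeta> may be replaced by \<xi> - z with R
  z = \<zeta>. The modulus of a complex kernel decays like a real Gaussian with rate proportional to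
  Re (1/a), which is positive because Re a is. In the eigenbasis the total mass of the kernel is exp
  (-t b) and not 1; only its limit as t tends to 0 enters the proof of continuity. Young's
  inequality comes from Jensen and Tonelli, and the triangle inequality in L^p is replaced by (a +
  b)^p <= 2^p (a^p + b^p). So the estimates concern integrals of p-th powers, and roots are taken
  only at the very end. The spaces and operators are defined with Lebesgue measure, whereas Fubini
  is applied to \<open>lborel\<close>; elements of the space are therefore replaced by Borel
  representatives first.\<close>

lemma mat_pow_component_le:
  fixes S :: "real^'d^'d"
  assumes "\<And>i j. \<bar>S $ i $ j\<bar> \<le> m"
  shows "\<bar>mat_pow S k $ i $ j\<bar> \<le> (real CARD('d) * m) ^ k"
proof (induction k arbitrary: i j)
  case 0
  show ?case by (simp add: mat_def)
next
  case (Suc k)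
  have "\<bar>mat_pow S (Suc k) $ i $ j\<bar> \<le> (\<Sum>l\<in>UNIV. \<bar>S $ i $ l * mat_pow S k $ l $ j\<bar>)"
    by (simp add: matrix_matrix_mult_def)
  also have "\<dots> \<le> (\<Sum>l\<in>(UNIV::'d set). m * (real CARD('d) * m) ^ k)"
    using assms Suc by (intro sum_mono) (auto simp: abs_mult intro!: mult_mono intro: order_trans[OF abs_ge_zero])
  also have "\<dots> = (real CARD('d) * m) ^ Suc k"
    by simp
  finally show ?case .
qed

lemma mat_pow_scaleR: "mat_pow (t *\<^sub>R S) k = t ^ k *\<^sub>R mat_pow (S :: real^'d^'d) k"
  by (induction k) (simp_all add: scalar_matrix_assoc matrix_scalar_ac mult.commute)

lemma mat_pow_commute: "mat_pow M k ** M = M ** mat_pow (M :: real^'d^'d) k"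
  by (induction k) (simp_all add: matrix_mul_assoc[symmetric])

lemma mat_pow_transpose: "transpose (mat_pow M k) = mat_pow (transpose (M :: real^'d^'d)) k"
  by (induction k) (simp_all add: matrix_transpose_mul transpose_mat mat_pow_commute)

text \<open>Each entry is treated as a power series in t, so that termwise differentiation of real
  power series applies to it. The constant \<open>m\<close> is a crude common bound for all entries
  of S.\<close>

lemma mat_exp_summable_component:
  fixes S :: "real^'d^'d"
  shows "summable (\<lambda>k. mat_pow S k $ i $ j / fact k * t ^ k)"
proof (rule summable_comparison_test')
  define m where "m = (\<Sum>i\<in>UNIV. \<Sum>j\<in>UNIV. \<bar>S $ i $ j\<bar>)"
  have m: "\<bar>S $ i $ j\<bar> \<le> m" for i j
  proof -
    have "\<bar>S $ i $ j\<bar> \<le> (\<Sum>j\<in>UNIV. \<bar>S $ i $ j\<bar>)" by (rule member_le_sum) auto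
    also have "\<dots> \<le> m" unfolding m_def by (rule member_le_sum) (auto intro: sum_nonneg)
    finally show ?thesis .
  qed
  show "summable (\<lambda>k. (real CARD('d) * m * \<bar>t\<bar>) ^ k / fact k)"
    using summable_exp_generic[of "real CARD('d) * m * \<bar>t\<bar>"] by (simp add: divide_inverse mult.commute)
  show "norm (mat_pow S k $ i $ j / fact k * t ^ k) \<le> (real CARD('d) * m * \<bar>t\<bar>) ^ k / fact k" for k
    using mult_right_mono[OF mat_pow_component_le[of S m k i j, OF m], of "\<bar>t\<bar> ^ k"]
    by (simp add: abs_mult power_abs power_mult_distrib divide_right_mono)
qed

lemma sums_vec_componentwise:
  fixes f :: "nat \<Rightarrow> 'a::real_normed_vector^'n"
  assumes "\<And>i. (\<lambda>k. f k $ i) sums (s $ i)"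
  shows "f sums s"
  using assms unfolding sums_def by (intro vec_tendstoI) simp

lemma mat_exp_component:
  fixes S :: "real^'d^'d"
  shows "mat_exp (t *\<^sub>R S) $ i $ j = (\<Sum>k. mat_pow S k $ i $ j / fact k * t ^ k)"
proof -
  have "(\<lambda>k. inverse (fact k) *\<^sub>R mat_pow (t *\<^sub>R S) k) sums
      (\<chi> i j. \<Sum>k. mat_pow S k $ i $ j / fact k * t ^ k)"
    by (intro sums_vec_componentwise)
       (use mat_exp_summable_component[of S _ _ t] in
         \<open>auto simp: mat_pow_scaleR field_simps dest!: summable_sums\<close>)
  then show ?thesis
    unfolding mat_exp_def by (subst sums_unique[symmetric]) auto
qed

lemma mat_exp_sums_component:
  fixes S :: "real^'d^'d"
  shows "(\<lambda>k. mat_pow S k $ i $ j / fact k * t ^ k) sums (mat_exp (t *\<^sub>R S) $ i $ j)"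
  unfolding mat_exp_component by (intro summable_sums mat_exp_summable_component)

lemma mat_exp_has_derivative_component:
  fixes S :: "real^'d^'d"
  shows "((\<lambda>t. mat_exp (t *\<^sub>R S) $ i $ j) has_real_derivative (S ** mat_exp (t *\<^sub>R S)) $ i $ j) (at t)"
proof -
  let ?c = "\<lambda>k. mat_pow S k $ i $ j / fact k"
  have "(\<lambda>k. diffs ?c k * t ^ k) = (\<lambda>k. \<Sum>l\<in>UNIV. S $ i $ l * (mat_pow S k $ l $ j / fact k * t ^ k))"
  proof
    fix k
    have "diffs ?c k = mat_pow S (Suc k) $ i $ j / fact k"
      by (simp add: diffs_def del: mat_pow.simps)
    then show "diffs ?c k * t ^ k = (\<Sum>l\<in>UNIV. S $ i $ l * (mat_pow S k $ l $ j / fact k * t ^ k))"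
      by (simp add: matrix_matrix_mult_def sum_distrib_right sum_divide_distrib mult.assoc)
  qed
  moreover have "(\<lambda>k. \<Sum>l\<in>UNIV. S $ i $ l * (mat_pow S k $ l $ j / fact k * t ^ k)) sums
      (\<Sum>l\<in>UNIV. S $ i $ l * mat_exp (t *\<^sub>R S) $ l $ j)"
    by (intro sums_sum sums_mult mat_exp_sums_component)
  ultimately have "(\<Sum>k. diffs ?c k * t ^ k) = (S ** mat_exp (t *\<^sub>R S)) $ i $ j"
    by (simp add: sums_iff matrix_matrix_mult_def)
  moreover have "((\<lambda>t. \<Sum>k. ?c k * t ^ k) has_real_derivative (\<Sum>k. diffs ?c k * t ^ k)) (at t)"
    by (rule termdiffs_strong_converges_everywhere) (rule mat_exp_summable_component)
  ultimately show ?thesis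
    by (simp add: mat_exp_component)
qed

lemma mat_exp_commute:
  fixes S :: "real^'d^'d"
  shows "mat_exp (t *\<^sub>R S) ** S = S ** mat_exp (t *\<^sub>R S)"
proof -
  have "(mat_exp (t *\<^sub>R S) ** S) $ i $ j = (S ** mat_exp (t *\<^sub>R S)) $ i $ j" for i j
  proof -
    have 1: "(\<lambda>k. \<Sum>l\<in>UNIV. (mat_pow S k $ i $ l / fact k * t ^ k) * S $ l $ j) sums
        (\<Sum>l\<in>UNIV. mat_exp (t *\<^sub>R S) $ i $ l * S $ l $ j)"
      by (intro sums_sum sums_mult2 mat_exp_sums_component)
    have 2: "(\<lambda>k. \<Sum>l\<in>UNIV. S $ i $ l * (mat_pow S k $ l $ j / fact k * t ^ k)) sums
        (\<Sum>l\<in>UNIV. S $ i $ l * mat_exp (t *\<^sub>R S) $ l $ j)"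
      by (intro sums_sum sums_mult mat_exp_sums_component)
    have "(\<Sum>l\<in>UNIV. (mat_pow S k $ i $ l / fact k * t ^ k) * S $ l $ j)
        = (\<Sum>l\<in>UNIV. S $ i $ l * (mat_pow S k $ l $ j / fact k * t ^ k))" for k
    proof -
      have "(\<Sum>l\<in>UNIV. (mat_pow S k $ i $ l / fact k * t ^ k) * S $ l $ j)
          = (mat_pow S k ** S) $ i $ j * (t ^ k / fact k)"
        by (simp add: matrix_matrix_mult_def sum_distrib_right sum_distrib_left sum_divide_distrib mult_ac)
      also have "\<dots> = (\<Sum>l\<in>UNIV. S $ i $ l * (mat_pow S k $ l $ j / fact k * t ^ k))"
        by (simp add: mat_pow_commute) (simp add: matrix_matrix_mult_def sum_distrib_right sum_distrib_left sum_divide_distrib mult_ac)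
      finally show ?thesis .
    qed
    then show ?thesis
      using sums_unique2[OF 1] 2 by (simp add: matrix_matrix_mult_def)
  qed
  then show ?thesis by (simp add: vec_eq_iff)
qed

lemma mat_exp_0: "mat_exp (0 *\<^sub>R S :: real^'d^'d) = mat 1"
proof -
  have "mat_exp (0 *\<^sub>R S) $ i $ j = mat 1 $ i $ j" for i j
    unfolding mat_exp_component by (subst powser_zero) simp
  then show ?thesis by (simp only: vec_eq_iff) simp
qed

text \<open>The map r |-> exp ((s + t - r) S) exp (r S) has derivative zero because S commutes with
  its exponential. Comparing its values at r = t and r = 0 gives the law without rearranging a
  double series.\<close>

lemma mat_exp_add:
  fixes S :: "real^'d^'d"
  shows "mat_exp ((s + t) *\<^sub>R S) = mat_exp (s *\<^sub>R S) ** mat_exp (t *\<^sub>R S)"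
proof -
  define E where "E t = mat_exp (t *\<^sub>R S)" for t
  have "(E s ** E t) $ i $ j = E (s + t) $ i $ j" for i j
  proof -
    define F where "F r = (\<Sum>l\<in>UNIV. E (s + t - r) $ i $ l * E r $ l $ j)" for r
    have "(F has_real_derivative 0) (at r)" for r
    proof -
      have D: "((\<lambda>r. E r $ i $ j) has_real_derivative (S ** E r) $ i $ j) (at r)" for r i j
        unfolding E_def by (rule mat_exp_has_derivative_component)
      have D': "((\<lambda>r. E (s + t - r) $ i $ j) has_real_derivative - (S ** E (s + t - r)) $ i $ j) (at r)"
        for i j
        by (rule DERIV_cong[OF DERIV_chain2[OF D]]) (auto intro!: derivative_eq_intros)
      have "(F has_real_derivative (\<Sum>l\<in>UNIV. - (S ** E (s + t - r)) $ i $ l * E r $ l $ j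
          + (S ** E r) $ l $ j * E (s + t - r) $ i $ l)) (at r)"
        unfolding F_def by (intro DERIV_sum DERIV_mult D D')
      also have "(\<Sum>l\<in>UNIV. - (S ** E (s + t - r)) $ i $ l * E r $ l $ j
          + (S ** E r) $ l $ j * E (s + t - r) $ i $ l)
          = - (S ** E (s + t - r) ** E r) $ i $ j + (E (s + t - r) ** (S ** E r)) $ i $ j"
        unfolding matrix_matrix_mult_def[of "_ ** _" "E r"] matrix_matrix_mult_def[of "E _" "S ** E r"]
        by (simp add: sum.distrib sum_negf sum_subtractf mult.commute)
      also have "\<dots> = 0"
        using mat_exp_commute[of "s + t - r" S] by (simp add: E_def matrix_mul_assoc)
      finally show ?thesis .
    qed
    then have "F t = F 0" by (intro DERIV_isconst_all) auto
    moreover have "E 0 = mat 1" unfolding E_def by (rule mat_exp_0)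
    ultimately show ?thesis
      using matrix_mul_rid[of "E (s + t)"] by (simp add: F_def matrix_matrix_mult_def vec_eq_iff)
  qed
  then show ?thesis by (simp add: vec_eq_iff E_def)
qed

text \<open>Skew symmetry makes the transpose of S^k equal to (-1)^k S^k, and the sign is absorbed
  into t^k.\<close>

lemma mat_exp_transpose:
  fixes S :: "real^'d^'d"
  assumes "skew_symmetric S"
  shows "transpose (mat_exp (t *\<^sub>R S)) = mat_exp ((- t) *\<^sub>R S)"
proof -
  have eq: "mat_pow S k $ j $ i = (- 1) ^ k * mat_pow S k $ i $ j" for k i j
  proof -
    have "mat_pow S k $ j $ i = transpose (mat_pow S k) $ i $ j"
      by (simp add: transpose_def)
    also have "\<dots> = mat_pow ((- 1) *\<^sub>R S) k $ i $ j"
      using assms by (simp add: mat_pow_transpose skew_symmetric_def)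
    finally show ?thesis
      by (simp only: mat_pow_scaleR vector_scaleR_component real_scaleR_def)
  qed
  have "mat_exp (t *\<^sub>R S) $ j $ i = mat_exp ((- t) *\<^sub>R S) $ i $ j" for i j
  proof -
    have "mat_pow S k $ j $ i / fact k * t ^ k = mat_pow S k $ i $ j / fact k * (- t) ^ k" for k
      by (subst eq) (simp add: power_minus[of t])
    then show ?thesis
      unfolding mat_exp_component by simp
  qed
  then have "transpose (mat_exp (t *\<^sub>R S)) $ i $ j = mat_exp ((- t) *\<^sub>R S) $ i $ j" for i j
    by (simp only: transpose_def vec_lambda_beta)
  then show ?thesis by (simp add: vec_eq_iff)
qed

lemma mat_exp_orthogonal:
  fixes S :: "real^'d^'d"
  assumes "skew_symmetric S"
  shows "orthogonal_transformation ((*v) (mat_exp (t *\<^sub>R S)))"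
proof -
  have "transpose (mat_exp (t *\<^sub>R S)) ** mat_exp (t *\<^sub>R S) = mat 1"
    using mat_exp_add[of "- t" t S] mat_exp_0[of S] assms
    by (simp add: mat_exp_transpose)
  then show ?thesis
    by (simp add: orthogonal_transformation_matrix orthogonal_matrix)
qed

lemma mat_exp_tendsto:
  fixes S :: "real^'d^'d"
  shows "((\<lambda>t. mat_exp (t *\<^sub>R S) *v x) \<longlongrightarrow> x) (at_right 0)"
proof -
  have "((\<lambda>t. mat_exp (t *\<^sub>R S) $ i $ j) \<longlongrightarrow> mat 1 $ i $ j) (at_right 0)" for i j
    using DERIV_isCont[OF mat_exp_has_derivative_component[of S i j 0]] mat_exp_0[of S]
    unfolding isCont_def by (simp add: filterlim_at_split)
  then have "((\<lambda>t. \<Sum>j\<in>UNIV. mat_exp (t *\<^sub>R S) $ i $ j * x $ j) \<longlongrightarrow> (\<Sum>j\<in>UNIV. mat 1 $ i $ j * x $ j))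
      (at_right 0)" for i
    by (intro tendsto_sum tendsto_mult tendsto_const)
  then have "((\<lambda>t. mat_exp (t *\<^sub>R S) *v x) \<longlongrightarrow> mat 1 *v x) (at_right 0)"
    by (intro vec_tendstoI) (simp add: matrix_vector_mult_def)
  then show ?thesis by simp
qed

subsection \<open>Rotation invariance of Lebesgue measure\<close>

lemma nn_integral_lborel_shift:
  fixes f :: "'a::euclidean_space \<Rightarrow> ennreal"
  assumes [measurable]: "f \<in> borel_measurable borel"
  shows "(\<integral>\<^sup>+x. f (c + x) \<partial>lborel) = (\<integral>\<^sup>+x. f x \<partial>lborel)"
  by (subst (2) lborel_distr_plus[of c, symmetric]) (simp add: nn_integral_distr)

lemma lborel_distr_uminus_euclidean:
  "distr lborel borel uminus = (lborel :: 'a::euclidean_space measure)"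
  by (subst lborel_affine[of "-1" "0::'a"]) (auto simp: density_1 one_ennreal_def[symmetric])

lemma nn_integral_lborel_reflect:
  fixes f :: "'a::euclidean_space \<Rightarrow> ennreal"
  assumes [measurable]: "f \<in> borel_measurable borel"
  shows "(\<integral>\<^sup>+x. f (c - x) \<partial>lborel) = (\<integral>\<^sup>+x. f x \<partial>lborel)"
proof -
  have "(\<integral>\<^sup>+x. f (c - x) \<partial>lborel) = (\<integral>\<^sup>+x. f (c + x) \<partial>distr lborel borel uminus)"
    by (subst nn_integral_distr) simp_all
  then show ?thesis
    by (simp add: lborel_distr_uminus_euclidean nn_integral_lborel_shift)
qed

lemma gaussian_integral_real:
  fixes \<alpha> :: real
  assumes "\<alpha> > 0"
  shows "has_bochner_integral lborel (\<lambda>x. exp (- \<alpha> * x\<^sup>2)) (sqrt (pi / \<alpha>))"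
proof -
  have "has_bochner_integral lborel (\<lambda>x. exp (- x\<^sup>2)) (2 *\<^sub>R (sqrt pi / 2))"
    by (rule has_bochner_integral_even_function[OF gaussian_moment_0]) simp
  from lborel_has_bochner_integral_real_affine_iff[THEN iffD1, OF _ this, of "sqrt \<alpha>" 0] assms
  show ?thesis
    by (simp add: power_mult_distrib real_sqrt_divide field_simps)
qed

lemma norm_power2_eq_sum_Basis: "(norm (x::'a::euclidean_space))\<^sup>2 = (\<Sum>b\<in>Basis. (x \<bullet> b)\<^sup>2)"
  by (subst euclidean_inner[of x x, folded power2_norm_eq_inner]) (simp add: power2_eq_square)

lemma gaussian_integral_euclidean:
  fixes \<alpha> :: real
  assumes "\<alpha> > 0"
  shows "has_bochner_integral lborel (\<lambda>x::'a::euclidean_space. exp (- \<alpha> * (norm x)\<^sup>2))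
           (sqrt (pi / \<alpha>) ^ DIM('a))"
proof (rule has_bochner_integral_nn_integral)
  have "(\<integral>\<^sup>+(x::'a). ennreal (exp (- \<alpha> * (norm x)\<^sup>2)) \<partial>lborel)
      = (\<integral>\<^sup>+(x::'a). (\<Prod>b\<in>Basis. ennreal (exp (- \<alpha> * (x \<bullet> b)\<^sup>2))) \<partial>lborel)"
    by (simp add: norm_power2_eq_sum_Basis sum_distrib_left exp_sum sum_negf[symmetric] prod_ennreal)
  also have "\<dots> = (\<Prod>b\<in>(Basis::'a set). (\<integral>\<^sup>+x. ennreal (exp (- \<alpha> * x\<^sup>2)) \<partial>lborel))"
    by (rule nn_integral_lborel_prod) auto
  also have "(\<integral>\<^sup>+x. ennreal (exp (- \<alpha> * x\<^sup>2)) \<partial>lborel) = ennreal (sqrt (pi / \<alpha>))"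
    using gaussian_integral_real[OF assms] by (simp add: nn_integral_eq_integral has_bochner_integral_iff)
  finally show "(\<integral>\<^sup>+(x::'a). ennreal (exp (- \<alpha> * (norm x)\<^sup>2)) \<partial>lborel) = ennreal (sqrt (pi / \<alpha>) ^ DIM('a))"
    using assms by (simp add: prod_ennreal ennreal_power)
qed (use assms in auto)

lemma borel_measurable_orthogonal:
  fixes R :: "'a::euclidean_space \<Rightarrow> 'a"
  assumes "orthogonal_transformation R"
  shows "R \<in> borel_measurable borel"
  by (intro borel_measurable_continuous_onI linear_continuous_on
      linear_conv_bounded_linear[THEN iffD1] orthogonal_transformation_linear assms)

text \<open>
  By Fubini and translation invariance, \<open>\<integral>f * \<integral>g \<circ> R = \<integral>(f \<circ> R\<inverse>) * \<integral>g\<close>; for a Gaussian \<open>f\<close> the two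
  factors involving \<open>f\<close> agree and can be cancelled.
\<close>

lemma nn_integral_lborel_orthogonal:
  fixes R :: "'a::euclidean_space \<Rightarrow> 'a"
  assumes R: "orthogonal_transformation R" and [measurable]: "g \<in> borel_measurable borel"
  shows "(\<integral>\<^sup>+x. g (R x) \<partial>lborel) = (\<integral>\<^sup>+x. g x \<partial>lborel)"
proof -
  interpret lborel_pair: pair_sigma_finite "lborel :: 'a measure" "lborel :: 'a measure" ..
  have lin: "linear R"
    using R orthogonal_transformation_linear by blast
  note [measurable] = borel_measurable_orthogonal[OF R]
  obtain R' where RR': "\<And>x. R (R' x) = x"
    using orthogonal_transformation_surj[OF R] by (metis surj_def)
  define f :: "'a \<Rightarrow> ennreal" where "f x = ennreal (exp (- 1 * (norm x)\<^sup>2))" for x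
  have [measurable]: "f \<in> borel_measurable borel"
    unfolding f_def by measurable
  define c :: ennreal where "c = (\<integral>\<^sup>+(x::'a). f x \<partial>lborel)"
  \<comment> \<open>In \<open>ennreal\<close> the factor \<open>c\<close> can be cancelled only if
    it is neither 0 nor infinite; the explicit Gaussian integral guarantees both.\<close>
  have "c = ennreal (sqrt pi ^ DIM('a))"
    unfolding c_def f_def using gaussian_integral_euclidean[of 1, where 'a = 'a]
    by (subst nn_integral_eq_integral) (simp_all add: has_bochner_integral_iff)
  then have c: "c \<noteq> 0" "c \<noteq> top"
    by auto
  have f_R: "f (x - R y) = f (R' x - y)" for x y
  proof -
    have "x - R y = R (R' x - y)"
      using linear_diff[OF lin] by (simp add: RR')
    then show ?thesis
      unfolding f_def by (simp add: orthogonal_transformation_norm[OF R])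
  qed
  have shift: "(\<integral>\<^sup>+y. g (R y) \<partial>lborel) = (\<integral>\<^sup>+y. g (x + R y) \<partial>lborel)" for x
    using nn_integral_lborel_shift[of "\<lambda>y. g (R y)" "R' x"] linear_add[OF lin] by (simp add: RR')
  have "c * (\<integral>\<^sup>+y. g (R y) \<partial>lborel) = (\<integral>\<^sup>+x. f x * (\<integral>\<^sup>+y. g (x + R y) \<partial>lborel) \<partial>lborel)"
    unfolding c_def shift[symmetric] by (simp add: nn_integral_multc)
  also have "\<dots> = (\<integral>\<^sup>+x. (\<integral>\<^sup>+y. f x * g (x + R y) \<partial>lborel) \<partial>lborel)"
    by (simp add: nn_integral_cmult)
  also have "\<dots> = (\<integral>\<^sup>+y. (\<integral>\<^sup>+x. f x * g (x + R y) \<partial>lborel) \<partial>lborel)"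
    by (rule lborel_pair.Fubini'[symmetric]) simp
  also have "\<dots> = (\<integral>\<^sup>+y. (\<integral>\<^sup>+x. f (x - R y) * g x \<partial>lborel) \<partial>lborel)"
  proof (rule nn_integral_cong)
    fix y
    show "(\<integral>\<^sup>+x. f x * g (x + R y) \<partial>lborel) = (\<integral>\<^sup>+x. f (x - R y) * g x \<partial>lborel)"
      using nn_integral_lborel_shift[of "\<lambda>x. f (x - R y) * g x" "R y"] by (simp add: add.commute)
  qed
  also have "\<dots> = (\<integral>\<^sup>+x. (\<integral>\<^sup>+y. f (x - R y) * g x \<partial>lborel) \<partial>lborel)"
    by (rule lborel_pair.Fubini') simp
  also have "\<dots> = (\<integral>\<^sup>+x. c * g x \<partial>lborel)"
    by (simp add: nn_integral_multc f_R nn_integral_lborel_reflect c_def)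
  also have "\<dots> = c * (\<integral>\<^sup>+x. g x \<partial>lborel)"
    by (simp add: nn_integral_cmult)
  finally show ?thesis
    using c by (simp add: ennreal_mult_cancel_left)
qed

subsection \<open>Complex Gaussian kernels\<close>

lemma not_pi_le_0: "\<not> pi \<le> 0"
  by (simp add: not_le)

lemma norm_exp_mult_of_real: "norm (exp (- (\<alpha> * complex_of_real r))) = exp (- (Re \<alpha> * r))"
  by (simp add: norm_exp_eq_Re)

lemma integrable_gaussian:
  assumes "\<alpha> > 0"
  shows "integrable lborel (\<lambda>x::'a::euclidean_space. exp (- (\<alpha> * (norm x)\<^sup>2)))"
  using gaussian_integral_euclidean[OF assms, where 'a = 'a] by (simp add: has_bochner_integral_iff)

lemma integrable_complex_gaussian:
  assumes "Re \<alpha> > 0"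
  shows "integrable lborel (\<lambda>x::'a::euclidean_space. exp (- (\<alpha> * complex_of_real ((norm x)\<^sup>2))))"
proof (rule Bochner_Integration.integrable_bound[OF integrable_gaussian[OF assms]])
  show "(\<lambda>x::'a. exp (- (\<alpha> * complex_of_real ((norm x)\<^sup>2)))) \<in> borel_measurable lborel"
    by measurable
qed (auto simp only: norm_exp_mult_of_real real_norm_def abs_exp_cancel)

text \<open>Leibniz's rule is applied on the cubes \<open>?C n\<close>, where the domain is compact;
  the resulting holomorphic functions converge locally uniformly to the integral over the whole
  space.\<close>

lemma holomorphic_gaussian_integral:
  "(\<lambda>\<alpha>. LINT x|lborel. exp (- (\<alpha> * complex_of_real ((norm (x::'a::euclidean_space))\<^sup>2))))
     holomorphic_on {\<alpha>. Re \<alpha> > 0}"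
proof (rule holomorphic_uniform_sequence)
  let ?e = "\<lambda>\<alpha> (x::'a). exp (- (\<alpha> * complex_of_real ((norm x)\<^sup>2)))"
  let ?C = "\<lambda>n::nat. cbox (- (real n *\<^sub>R One)) (real n *\<^sub>R One) :: 'a set"
  show "open {\<alpha>. Re \<alpha> > 0}"
    by (rule open_halfspace_Re_gt)
  show "(\<lambda>\<alpha>. integral (?C n) (?e \<alpha>)) holomorphic_on {\<alpha>. Re \<alpha> > 0}" for n
  proof (rule leibniz_rule_holomorphic)
    show "((\<lambda>\<alpha>. ?e \<alpha> x) has_field_derivative - complex_of_real ((norm x)\<^sup>2) * ?e \<alpha> x)
        (at \<alpha> within {\<alpha>. Re \<alpha> > 0})" for \<alpha> x
      by (auto intro!: derivative_eq_intros)
    show "?e \<alpha> integrable_on ?C n" for \<alpha>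
      by (intro integrable_continuous continuous_intros)
    show "continuous_on ({\<alpha>. Re \<alpha> > 0} \<times> ?C n)
        (\<lambda>(\<alpha>, x). - complex_of_real ((norm x)\<^sup>2) * ?e \<alpha> x)"
      unfolding case_prod_unfold by (intro continuous_intros)
    show "convex {\<alpha>. Re \<alpha> > 0}"
      by (rule convex_halfspace_Re_gt)
  qed
  fix z assume "z \<in> {\<alpha>. Re \<alpha> > 0}"
  then have z: "Re z > 0" by simp
  \<comment> \<open>On the closed disc of this radius about z the real part stays at least \<delta>.
    A single real Gaussian therefore dominates all the integrands, and \<open>tail n\<close> bounds
    the truncation error independently of \<alpha>.\<close>
  define \<delta> where "\<delta> = Re z / 2"
  have \<delta>: "\<delta> > 0" using z by (simp add: \<delta>_def)
  have Re_ge: "Re \<alpha> \<ge> \<delta>" if "\<alpha> \<in> cball z \<delta>" for \<alpha>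
    using that complex_Re_le_cmod[of "z - \<alpha>"] by (simp add: dist_norm \<delta>_def)
  define tail where "tail n = (LINT x|lborel. indicator (- ?C n) x * exp (- (\<delta> * (norm x)\<^sup>2)))" for n
  have "tail \<longlonglongrightarrow> (LINT x|(lborel :: 'a measure). 0)"
    unfolding tail_def
  proof (rule integral_dominated_convergence)
    show "integrable lborel (\<lambda>x::'a. exp (- (\<delta> * (norm x)\<^sup>2)))"
      by (rule integrable_gaussian[OF \<delta>])
    show "AE x in lborel. (\<lambda>n. indicator (- ?C n) x * exp (- (\<delta> * (norm x)\<^sup>2))) \<longlonglongrightarrow> 0"
    proof (intro always_eventually allI)
      fix x :: 'a
      obtain m where "norm x \<le> real m" using real_arch_simple by blast
      then have "x \<in> ?C n" if "n \<ge> m" for n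
        using that by (auto simp: mem_box intro!: order_trans[OF abs_le_D1[OF Basis_le_norm]]
            dest: Basis_le_norm[of _ x] abs_le_D2)
      then show "(\<lambda>n. indicator (- ?C n) x * exp (- (\<delta> * (norm x)\<^sup>2))) \<longlonglongrightarrow> 0"
        by (intro tendsto_eventually eventually_sequentiallyI[of m]) auto
    qed
  qed (auto split: split_indicator)
  then have tail: "tail \<longlonglongrightarrow> 0" by simp
  have bound: "dist (integral (?C n) (?e \<alpha>)) (LINT x|lborel. ?e \<alpha> x) \<le> tail n" if "\<alpha> \<in> cball z \<delta>" for \<alpha> n
  proof -
    have int: "integrable lborel (?e \<alpha>)"
      using Re_ge[OF that] \<delta> by (intro integrable_complex_gaussian) simp
    have "integral (?C n) (?e \<alpha>) = (LINT x:?C n|lborel. ?e \<alpha> x)"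
      by (intro set_borel_integral_eq_integral(2)[symmetric])
         (simp only: set_integrable_def, rule integrable_mult_indicator[OF _ int], simp)
    also have "\<dots> - (LINT x|lborel. ?e \<alpha> x) = (LINT x|lborel. - (indicator (- ?C n) x *\<^sub>R ?e \<alpha> x))"
    proof -
      have "integrable lborel (\<lambda>x. indicator (?C n) x *\<^sub>R ?e \<alpha> x)"
        by (rule integrable_mult_indicator[OF _ int]) simp
      from Bochner_Integration.integral_diff[OF this int, symmetric] show ?thesis
        unfolding set_lebesgue_integral_def
        by (rule trans) (intro Bochner_Integration.integral_cong refl, simp split: split_indicator)
    qed
    finally have "dist (integral (?C n) (?e \<alpha>)) (LINT x|lborel. ?e \<alpha> x)
        = norm (LINT x|lborel. - (indicator (- ?C n) x *\<^sub>R ?e \<alpha> x))"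
      by (simp add: dist_norm)
    also have "\<dots> \<le> tail n"
      unfolding tail_def
    proof (rule Bochner_Integration.integral_norm_bound_integral)
      show "integrable lborel (\<lambda>x. indicator (- ?C n) x * exp (- (\<delta> * (norm x)\<^sup>2)))"
        using integrable_mult_indicator[OF _ integrable_gaussian[OF \<delta>], of "- ?C n"] by simp
      show "norm (- (indicator (- ?C n) x *\<^sub>R ?e \<alpha> x)) \<le> indicator (- ?C n) x * exp (- (\<delta> * (norm x)\<^sup>2))" for x
        unfolding norm_minus_cancel norm_scaleR norm_exp_mult_of_real
        using Re_ge[OF that] by (auto split: split_indicator intro!: mult_right_mono)
    qed (intro Bochner_Integration.integrable_minus integrable_mult_indicator int, simp)
    finally show ?thesis .
  qed
  show "\<exists>d>0. cball z d \<subseteq> {\<alpha>. Re \<alpha> > 0} \<and>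
      uniform_limit (cball z d) (\<lambda>n \<alpha>. integral (?C n) (?e \<alpha>)) (\<lambda>\<alpha>. LINT x|lborel. ?e \<alpha> x) sequentially"
  proof (intro exI[of _ \<delta>] conjI)
    show "cball z \<delta> \<subseteq> {\<alpha>. Re \<alpha> > 0}"
      using Re_ge \<delta> by force
    show "uniform_limit (cball z \<delta>) (\<lambda>n \<alpha>. integral (?C n) (?e \<alpha>)) (\<lambda>\<alpha>. LINT x|lborel. ?e \<alpha> x) sequentially"
    proof (rule uniform_limitI)
      fix e :: real assume "e > 0"
      from order_tendstoD(2)[OF tail this]
      show "\<forall>\<^sub>F n in sequentially. \<forall>\<alpha>\<in>cball z \<delta>. dist (integral (?C n) (?e \<alpha>)) (LINT x|lborel. ?e \<alpha> x) < e"
        by eventually_elim (use bound le_less_trans in blast)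
    qed
  qed (fact \<delta>)
qed

text \<open>On the positive reals the principal power is the ordinary root; this is the set from
  which the identity theorem starts.\<close>

lemma exp_half_Ln_of_real:
  assumes "r > 0"
  shows "exp (- (of_nat n / 2 * Ln (complex_of_real r))) = of_real (sqrt (1 / r) ^ n)"
proof -
  have "sqrt (1 / r) ^ n = exp (real n * ln (sqrt (1 / r)))"
    using assms by (simp add: exp_of_nat_mult)
  also have "real n * ln (sqrt (1 / r)) = - (real n / 2 * ln r)"
    using assms by (simp add: ln_sqrt ln_div)
  finally show ?thesis
    using assms by (simp add: Ln_of_real exp_of_real[symmetric])
qed

text \<open>The right half-plane avoids the cut of \<open>Ln\<close>, so the right-hand side is
  holomorphic there. It agrees with the integral on the positive reals, which accumulate at 1. This
  is what singles out the principal branch in the prefactor.\<close>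

lemma complex_gaussian_integral:
  assumes "Re \<alpha> > 0"
  shows "(LINT x|lborel. exp (- (\<alpha> * complex_of_real ((norm (x::'a::euclidean_space))\<^sup>2))))
      = exp (- (of_nat DIM('a) / 2 * Ln (\<alpha> / of_real pi)))"
proof -
  let ?I = "\<lambda>\<alpha>. LINT x|lborel. exp (- (\<alpha> * complex_of_real ((norm (x::'a))\<^sup>2)))"
  let ?E = "\<lambda>\<alpha>. exp (- (of_nat DIM('a) / 2 * Ln (\<alpha> / of_real pi)))"
  have nonpos: "z / of_real pi \<notin> \<real>\<^sub>\<le>\<^sub>0" if "Re z > 0" for z
    using that by (auto simp: complex_nonpos_Reals_iff divide_le_0_iff not_pi_le_0)
  have "?I \<alpha> - ?E \<alpha> = 0"
  proof (rule analytic_continuation[where f = "\<lambda>\<alpha>. ?I \<alpha> - ?E \<alpha>"])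
    show "(\<lambda>\<alpha>. ?I \<alpha> - ?E \<alpha>) holomorphic_on {\<alpha>. Re \<alpha> > 0}"
      by (intro holomorphic_intros holomorphic_gaussian_integral) (use nonpos in auto)
    show "open {\<alpha>. Re \<alpha> > 0}" "connected {\<alpha>. Re \<alpha> > 0}"
      by (simp_all add: open_halfspace_Re_gt convex_halfspace_Re_gt convex_connected)
    show "complex_of_real ` {0<..} \<subseteq> {\<alpha>. Re \<alpha> > 0}" "1 \<in> {\<alpha>. Re \<alpha> > 0}" "\<alpha> \<in> {\<alpha>. Re \<alpha> > 0}"
      using assms by auto
    show "1 islimpt complex_of_real ` {0<..}"
      unfolding islimpt_approachable
    proof (intro allI impI)
      fix e :: real assume "e > 0"
      then show "\<exists>z\<in>complex_of_real ` {0<..}. z \<noteq> 1 \<and> dist z 1 < e"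
        by (intro bexI[of _ "complex_of_real (1 + e / 2)"] imageI) (auto simp: dist_norm norm_divide)
    qed
    show "?I z - ?E z = 0" if "z \<in> complex_of_real ` {0<..}" for z
    proof -
      obtain r where r: "z = complex_of_real r" "r > 0"
        using \<open>z \<in> complex_of_real ` {0<..}\<close> by blast
      have "?I z = of_real (LINT x|lborel. exp (- r * (norm (x::'a))\<^sup>2))"
        by (subst integral_complex_of_real[symmetric]) (simp add: r exp_of_real[symmetric])
      also have "\<dots> = of_real (sqrt (1 / (r / pi)) ^ DIM('a))"
        using gaussian_integral_euclidean[OF r(2), where 'a = 'a] by (simp add: has_bochner_integral_iff)
      also have "\<dots> = ?E z"
        using exp_half_Ln_of_real[of "r / pi" "DIM('a)"] r by simp
      finally show ?thesis by simp
    qed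
  qed
  then show ?thesis by simp
qed

text \<open>The value at \<open>y\<close> of the fundamental solution of \<open>u\<^sub>t = a \<Delta>u\<close> at time \<open>t\<close>.\<close>

definition gauss_kernel :: "complex \<Rightarrow> real \<Rightarrow> 'a::euclidean_space \<Rightarrow> complex" where
  "gauss_kernel a t y = exp (- (of_nat DIM('a) / 2 * Ln (of_real (4 * pi * t) * a)))
     * exp (- (1 / (of_real (4 * t) * a) * of_real ((norm y)\<^sup>2)))"

text \<open>Since Re (1/a) = Re a / |a|^2, the spectral hypothesis on a is exactly what yields
  Gaussian decay of the kernel.\<close>

lemma Re_inverse_scaled_pos:
  assumes "Re a > 0" "t > 0"
  shows "Re (1 / (of_real (4 * t) * a)) = Re (1 / a) / (4 * t)" "Re (1 / (of_real (4 * t) * a)) > 0"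
proof -
  have "1 / (of_real (4 * t) * a) = of_real (1 / (4 * t)) * (1 / a)"
    by simp
  then show *: "Re (1 / (of_real (4 * t) * a)) = Re (1 / a) / (4 * t)"
    by (simp only: Re_complex_of_real times_complex.sel Im_complex_of_real) simp
  have "Re (1 / a) > 0"
    using assms by (simp add: Re_divide complex_neq_0[symmetric] sum_power2_gt_zero_iff)
  then show "Re (1 / (of_real (4 * t) * a)) > 0"
    unfolding * using assms by simp
qed

lemma gauss_kernel_integrable:
  assumes "Re a > 0" "t > 0"
  shows "integrable lborel (gauss_kernel a t :: 'a::euclidean_space \<Rightarrow> complex)"
  unfolding gauss_kernel_def
  by (intro integrable_mult_right integrable_complex_gaussian Re_inverse_scaled_pos assms)

lemma gauss_kernel_integral:
  assumes "Re a > 0" "t > 0"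
  shows "(LINT y|lborel. gauss_kernel a t (y::'a::euclidean_space)) = 1"
proof -
  \<comment> \<open>Off the cut, \<open>Ln\<close> of the inverse is minus \<open>Ln\<close>. Hence
    the prefactor of the kernel is the reciprocal of the Gaussian integral, with no ambiguity of
    branch.\<close>
  have "of_real (4 * pi * t) * a \<notin> \<real>\<^sub>\<le>\<^sub>0"
    using assms by (auto simp: complex_nonpos_Reals_iff mult_le_0_iff not_pi_le_0)
  then have "Ln (1 / (of_real (4 * t) * a) / of_real pi) = - Ln (of_real (4 * pi * t) * a)"
    by (subst Ln_inverse[symmetric]) (simp_all add: field_simps)
  then show ?thesis
    unfolding gauss_kernel_def
    by (simp only: integral_mult_right_zero complex_gaussian_integral[OF Re_inverse_scaled_pos(2)[OF assms]])
       (simp flip: exp_add)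
qed

text \<open>The exponent d/2 is real, so the modulus of the principal power depends only on the
  modulus of its base; the argument of a survives only in the decay rate Re (1/a).\<close>

lemma gauss_kernel_norm:
  assumes "Re a > 0" "t > 0"
  shows "norm (gauss_kernel a t (y::'a::euclidean_space))
      = sqrt (1 / (4 * pi * t * norm a)) ^ DIM('a) * exp (- (Re (1 / a) / (4 * t) * (norm y)\<^sup>2))"
proof -
  have a: "a \<noteq> 0" using assms by auto
  have "norm (exp (- (of_nat DIM('a) / 2 * Ln (of_real (4 * pi * t) * a))))
      = exp (- (real DIM('a) / 2 * ln (4 * pi * t * norm a)))"
    using assms a by (simp add: norm_exp_eq_Re Re_Ln norm_mult)
  also have "complex_of_real \<dots> = of_real (sqrt (1 / (4 * pi * t * norm a)) ^ DIM('a))"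
  proof -
    define r where "r = 4 * pi * t * norm a"
    have r: "r > 0" using assms a by (simp add: r_def)
    have "complex_of_real (exp (- (real DIM('a) / 2 * ln r))) = exp (- (of_nat DIM('a) / 2 * Ln (of_real r)))"
      using r by (simp add: Ln_of_real flip: exp_of_real)
    then show ?thesis
      using exp_half_Ln_of_real[OF r, of "DIM('a)"] unfolding r_def by simp
  qed
  finally have "norm (exp (- (of_nat DIM('a) / 2 * Ln (of_real (4 * pi * t) * a))))
      = sqrt (1 / (4 * pi * t * norm a)) ^ DIM('a)"
    by (simp only: of_real_eq_iff)
  then show ?thesis
    unfolding gauss_kernel_def norm_mult norm_exp_mult_of_real Re_inverse_scaled_pos(1)[OF assms] by simp
qed

lemma gauss_kernel_cong_norm:
  fixes x y :: "'a::euclidean_space"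
  shows "norm x = norm y \<Longrightarrow> gauss_kernel a t x = gauss_kernel a t y"
  by (simp add: gauss_kernel_def)

lemma continuous_gauss_kernel: "continuous_on UNIV (gauss_kernel a t)"
  unfolding gauss_kernel_def by (intro continuous_intros)

section \<open>The convolution identity for complex Gaussians\<close>

lemma integral_lborel_shift:
  fixes f :: "'a::euclidean_space \<Rightarrow> 'b::{banach, second_countable_topology}"
  assumes [measurable]: "f \<in> borel_measurable borel"
  shows "(LINT x|lborel. f (c + x)) = (LINT x|lborel. f x)"
  by (subst (2) lborel_distr_plus[of c, symmetric]) (simp add: integral_distr)

text \<open>
  Completing the square produces the real shift \<open>(t / (s + t)) x\<close> because both kernels share the
  complex factor \<open>a\<close>; thus no contour has to be moved.
\<close>

lemma complete_square:
  fixes x y :: "'a::real_inner"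
  assumes "s > 0" "t > 0"
  shows "(norm (x - y))\<^sup>2 / s + (norm y)\<^sup>2 / t
      = (norm x)\<^sup>2 / (s + t) + (s + t) / (s * t) * (norm (- (t / (s + t)) *\<^sub>R x + y))\<^sup>2"
proof -
  have st: "s + t \<noteq> 0" "s \<noteq> 0" "t \<noteq> 0" using assms by auto
  show ?thesis
    unfolding power2_norm_eq_inner using st
    by (simp add: inner_simps inner_commute[of y x] divide_simps) algebra
qed

lemma gauss_kernel_convolution:
  fixes x :: "'a::euclidean_space"
  assumes a: "Re a > 0" and st: "s > 0" "t > 0"
  shows "(LINT y|lborel. gauss_kernel a s (x - y) * gauss_kernel a t y) = gauss_kernel a (s + t) x"
proof -
  \<comment> \<open>Completing the square writes the product of the kernels at times s and t as the
    kernel at time s + t in x, times a kernel at time \<sigma> in the shifted variable. The latter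
    has integral 1.\<close>
  define \<sigma> where "\<sigma> = s * t / (s + t)"
  define c where "c r = exp (- (of_nat DIM('a) / 2 * Ln (of_real (4 * pi * r) * a)))" for r
  have \<sigma>: "\<sigma> > 0" using st by (simp add: \<sigma>_def)
  have a0: "a \<noteq> 0" using a by auto
  \<comment> \<open>\<open>Ln\<close> is not additive in general, but it is for a positive factor.
    Isolating the real logarithms reduces the identity of the prefactors to s t = (s + t) \<sigma>,
    without multiples of 2 pi i.\<close>
  have Ln_split: "Ln (of_real (4 * pi * r) * a) = of_real (ln (4 * pi * r)) + Ln a" if "r > 0" for r
    using Ln_times_of_real[of "4 * pi * r" a] Ln_of_real[of "4 * pi * r"] that a0
    by (simp del: of_real_mult)
  have "ln (4 * pi * s) + ln (4 * pi * t) = ln (4 * pi * (s + t)) + ln (4 * pi * \<sigma>)"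
  proof -
    have "ln s + ln t = ln (s + t) + ln \<sigma>"
      using st \<sigma> by (simp add: \<sigma>_def ln_div ln_mult)
    then show ?thesis
      using st \<sigma> by (simp add: ln_mult)
  qed
  then have ln_eq: "complex_of_real (ln (4 * pi * s)) + of_real (ln (4 * pi * t))
      = of_real (ln (4 * pi * (s + t))) + of_real (ln (4 * pi * \<sigma>))"
    by (simp only: of_real_add[symmetric])
  have c_mult2: "c r * c r' = exp (- (of_nat DIM('a) / 2 *
      ((of_real (ln (4 * pi * r)) + of_real (ln (4 * pi * r'))) + 2 * Ln a)))" if "r > 0" "r' > 0" for r r'
    unfolding c_def exp_add[symmetric] Ln_split[OF that(1)] Ln_split[OF that(2)]
    by (rule arg_cong[where f = exp]) (simp add: algebra_simps)
  have c_mult: "c s * c t = c (s + t) * c \<sigma>"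
    using st \<sigma> by (simp only: c_mult2 ln_eq add_pos_pos)
  have "gauss_kernel a s (x - y) * gauss_kernel a t y
      = gauss_kernel a (s + t) x * gauss_kernel a \<sigma> (- (t / (s + t)) *\<^sub>R x + y)" for y
  proof -
    let ?q = "complex_of_real" and ?w = "- (t / (s + t)) *\<^sub>R x + y"
    have scale: "1 / (?q (4 * r) * a) * ?q z = 1 / (4 * a) * ?q (z / r)" for r z
      by simp
    have "(norm (x - y))\<^sup>2 / s + (norm y)\<^sup>2 / t = (norm x)\<^sup>2 / (s + t) + (norm ?w)\<^sup>2 / \<sigma>"
      by (simp add: complete_square[OF st] \<sigma>_def)
    then have "?q ((norm (x - y))\<^sup>2 / s) + ?q ((norm y)\<^sup>2 / t)
        = ?q ((norm x)\<^sup>2 / (s + t)) + ?q ((norm ?w)\<^sup>2 / \<sigma>)"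
      by (simp only: of_real_add[symmetric])
    then have "1 / (?q (4 * s) * a) * ?q ((norm (x - y))\<^sup>2) + 1 / (?q (4 * t) * a) * ?q ((norm y)\<^sup>2)
        = 1 / (?q (4 * (s + t)) * a) * ?q ((norm x)\<^sup>2) + 1 / (?q (4 * \<sigma>) * a) * ?q ((norm ?w)\<^sup>2)"
      unfolding scale distrib_left[symmetric] by (rule arg_cong)
    then have e: "exp (- (1 / (?q (4 * s) * a) * ?q ((norm (x - y))\<^sup>2)))
          * exp (- (1 / (?q (4 * t) * a) * ?q ((norm y)\<^sup>2)))
        = exp (- (1 / (?q (4 * (s + t)) * a) * ?q ((norm x)\<^sup>2)))
          * exp (- (1 / (?q (4 * \<sigma>) * a) * ?q ((norm ?w)\<^sup>2)))"
      by (simp only: exp_add[symmetric] minus_add_distrib[symmetric])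
    show ?thesis
      unfolding gauss_kernel_def c_def[symmetric]
      using arg_cong2[OF c_mult e, of "(*)"] by (simp only: mult_ac)
  qed
  then have "(LINT y|lborel. gauss_kernel a s (x - y) * gauss_kernel a t y)
      = gauss_kernel a (s + t) x * (LINT y|lborel. gauss_kernel a \<sigma> (- (t / (s + t)) *\<^sub>R x + y))"
    by simp
  also have "\<dots> = gauss_kernel a (s + t) x"
    using gauss_kernel_integral[OF a \<sigma>, where 'a = 'a]
    by (subst integral_lborel_shift)
       (auto intro: borel_measurable_continuous_onI continuous_gauss_kernel)
  finally show ?thesis .
qed

subsection \<open>A weighted Young inequality\<close>

lemma powr_above_tangent:
  fixes a \<mu> p :: real
  assumes "p \<ge> 1" "a \<ge> 0" "\<mu> > 0"
  shows "\<mu> powr p + p * \<mu> powr (p - 1) * (a - \<mu>) \<le> a powr p"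
proof (cases "a = 0")
  case True
  \<comment> \<open>Convexity and the derivative are used on the open half-line, so the endpoint is
    computed by hand; there the tangent has the value (1 - p) \<mu>^p.\<close>
  have "\<mu> powr (p - 1) * \<mu> = \<mu> powr p"
    using assms by (simp add: powr_diff)
  then have "\<mu> powr p + p * \<mu> powr (p - 1) * (a - \<mu>) = (1 - p) * \<mu> powr p"
    using True by (simp add: algebra_simps)
  also have "\<dots> \<le> 0"
    using assms by (intro mult_nonpos_nonneg) auto
  finally show ?thesis
    using True by simp
next
  case False
  have "a powr p - \<mu> powr p \<ge> (p * \<mu> powr (p - 1)) * (a - \<mu>)"
  proof (rule convex_on_imp_above_tangent[where A = "{0<..}"])
    show "((\<lambda>x. x powr p) has_real_derivative p * \<mu> powr (p - 1)) (at \<mu> within {0<..})"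
      using assms by (auto intro!: derivative_eq_intros)
  qed (use assms False in \<open>auto simp: powr_convex interior_open\<close>)
  then show ?thesis by simp
qed

text \<open>Jensen's inequality for the measure with density k, not normalised to mass 1: this
  accounts for the factor with exponent p - 1. Integrability of k f follows from f <= 1 +
  f^p.\<close>

lemma jensen_powr:
  fixes f k :: "'a \<Rightarrow> real"
  assumes p: "p \<ge> 1" and nonneg: "\<And>y. k y \<ge> 0" "\<And>y. f y \<ge> 0"
    and k: "integrable M k" and f [measurable]: "f \<in> borel_measurable M"
    and kf: "integrable M (\<lambda>y. k y * f y powr p)"
  shows "integrable M (\<lambda>y. k y * f y)"
    and "(LINT y|M. k y * f y) powr p \<le> (LINT y|M. k y) powr (p - 1) * (LINT y|M. k y * f y powr p)"
proof -
  have [measurable]: "k \<in> borel_measurable M" using k by simp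
  show int: "integrable M (\<lambda>y. k y * f y)"
  proof (rule Bochner_Integration.integrable_bound[OF Bochner_Integration.integrable_add[OF k kf]])
    have "f y \<le> 1 + f y powr p" for y
      using nonneg(2)[of y] p powr_mono[of 1 p "f y"] by (smt (verit) powr_ge_zero powr_one)
    from mult_left_mono[OF this nonneg(1)] have "k y * f y \<le> k y + k y * f y powr p" for y
      by (simp add: distrib_left)
    then show "AE y in M. norm (k y * f y) \<le> norm (k y + k y * f y powr p)"
      using nonneg by (simp add: abs_mult)
  qed measurable
  define K m I where "K = (LINT y|M. k y)" "m = (LINT y|M. k y * f y)" "I = (LINT y|M. k y * f y powr p)"
  have K: "K \<ge> 0" and m: "m \<ge> 0" and I: "I \<ge> 0"
    unfolding K_m_I_def using nonneg by (auto intro!: integral_nonneg_AE)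
  consider "m = 0" | "m > 0" "K = 0" | "m > 0" "K > 0"
    using K m by linarith
  then have "m powr p \<le> K powr (p - 1) * I"
  proof cases
    case 1
    then show ?thesis using I by simp
  next
    case 2
    \<comment> \<open>A nonnegative kernel of mass zero vanishes almost everywhere, which
      contradicts m > 0.\<close>
    then have "AE y in M. k y = 0"
      using integral_nonneg_eq_0_iff_AE[OF k] nonneg by (simp add: K_m_I_def)
    then have "m = (LINT y|M. 0)"
      unfolding K_m_I_def by (intro integral_cong_AE) auto
    with 2 show ?thesis by simp
  next
    case 3
    \<comment> \<open>The k-weighted mean of f. At this point of tangency the linear term of the
      supporting line integrates to zero.\<close>
    define \<mu> where "\<mu> = m / K"
    have \<mu>: "\<mu> > 0" using 3 by (simp add: \<mu>_def)
    have "\<mu> powr p * K = \<mu> powr p * K + p * \<mu> powr (p - 1) * (m - \<mu> * K)"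
      using 3 by (simp add: \<mu>_def)
    also have "\<dots> = (LINT y|M. \<mu> powr p * k y + p * \<mu> powr (p - 1) * (k y * f y - \<mu> * k y))"
      using k int by (simp add: K_m_I_def)
    also have "\<dots> \<le> I"
      unfolding K_m_I_def
    proof (rule integral_mono)
      fix y
      show "\<mu> powr p * k y + p * \<mu> powr (p - 1) * (k y * f y - \<mu> * k y) \<le> k y * f y powr p"
        using mult_left_mono[OF powr_above_tangent[OF p nonneg(2) \<mu>] nonneg(1), of y y]
        by (simp add: algebra_simps)
    qed (use k int kf in auto)
    finally have "\<mu> powr p * K \<le> I" .
    then have "K powr (p - 1) * (\<mu> powr p * K) \<le> K powr (p - 1) * I"
      by (intro mult_left_mono) auto
    also have "K powr (p - 1) * (\<mu> powr p * K) = m powr p"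
      using 3 by (simp add: \<mu>_def powr_diff powr_divide)
    finally show ?thesis .
  qed
  then show "(LINT y|M. k y * f y) powr p \<le> (LINT y|M. k y) powr (p - 1) * (LINT y|M. k y * f y powr p)"
    by (simp add: K_m_I_def)
qed

text \<open>Integrating in x first, rotation and translation invariance make the inner integral
  independent of \<xi>, so the product splits.\<close>

lemma nn_integral_tonelli_convolution:
  fixes R :: "'a::euclidean_space \<Rightarrow> 'a" and w g :: "'a \<Rightarrow> ennreal"
  assumes R: "orthogonal_transformation R"
    and [measurable]: "w \<in> borel_measurable borel" "g \<in> borel_measurable borel"
  shows "(\<integral>\<^sup>+z. w (R (fst z) - snd z) * g (snd z) \<partial>(lborel \<Otimes>\<^sub>M lborel)) = (\<integral>\<^sup>+x. w x \<partial>lborel) * (\<integral>\<^sup>+x. g x \<partial>lborel)"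
proof -
  note [measurable] = borel_measurable_orthogonal[OF R]
  have "(\<integral>\<^sup>+x. w (R x - \<xi>) \<partial>lborel) = (\<integral>\<^sup>+x. w x \<partial>lborel)" for \<xi>
    using nn_integral_lborel_orthogonal[OF R, of "\<lambda>x. w (x - \<xi>)"] nn_integral_lborel_shift[of w "- \<xi>"]
    by simp
  then show ?thesis
    by (subst lborel_pair.nn_integral_snd[symmetric]) (simp_all add: nn_integral_multc nn_integral_cmult)
qed

text \<open>Radiality is stated without a profile function, in the form in which it is used:
  \<theta> does not change under norm-preserving maps.\<close>

locale radial_weight =
  fixes \<theta> :: "'a::euclidean_space \<Rightarrow> real" and \<eta> C p :: real
  assumes continuous: "continuous_on UNIV \<theta>"
    and pos: "\<And>x. \<theta> x > 0"
    and growth: "\<And>x y. \<theta> (x + y) \<le> C * \<theta> x * exp (\<eta> * norm y)"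
    and radial: "\<And>x y. norm x = norm y \<Longrightarrow> \<theta> x = \<theta> y"
    and \<eta>: "\<eta> \<ge> 0" and C: "C > 0" and p: "p \<ge> 1"
begin

lemma weight_measurable [measurable]: "\<theta> \<in> borel_measurable borel"
  by (rule borel_measurable_continuous_onI[OF continuous])

text \<open>By radiality and growth, \<theta> x <= C \<theta> \<xi> exp (\<eta> |R x - \<xi>|): the
  weight passes from the output point to the input point at the cost of an exponential factor on the
  kernel. Jensen with density k (R x - \<xi>) raises this to the power p, which explains the
  exponent \<eta> p and the constant \<open>C powr p\<close>. Tonelli then integrates in x.\<close>

lemma weighted_young:
  fixes k f :: "'a \<Rightarrow> real"
  assumes R: "orthogonal_transformation R"
    and [measurable]: "k \<in> borel_measurable borel" "f \<in> borel_measurable borel"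
    and nonneg: "\<And>y. k y \<ge> 0" "\<And>y. f y \<ge> 0"
    and w: "integrable lborel (\<lambda>y. k y * exp (\<eta> * p * norm y))"
    and f: "integrable lborel (\<lambda>x. (\<theta> x * f x) powr p)"
  shows "AE x in lborel. integrable lborel (\<lambda>\<xi>. k (R x - \<xi>) * f \<xi>)"
    and "integrable lborel (\<lambda>x. (\<theta> x * (LINT \<xi>|lborel. k (R x - \<xi>) * f \<xi>)) powr p)"
    and "(LINT x|lborel. (\<theta> x * (LINT \<xi>|lborel. k (R x - \<xi>) * f \<xi>)) powr p)
      \<le> C powr p * (LINT y|lborel. k y) powr (p - 1) * (LINT y|lborel. k y * exp (\<eta> * p * norm y))
          * (LINT x|lborel. (\<theta> x * f x) powr p)"
proof -
  note [measurable] = borel_measurable_orthogonal[OF R]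
  define w where "w y = k y * exp (\<eta> * p * norm y)" for y
  define g where "g x = (\<theta> x * f x) powr p" for x
  have [measurable]: "w \<in> borel_measurable borel" "g \<in> borel_measurable borel"
    unfolding w_def g_def by measurable
  have w_nonneg: "w y \<ge> 0" and g_nonneg: "g y \<ge> 0" for y
    using nonneg by (auto simp: w_def g_def)
  have k_le_w: "k y \<le> w y" for y
    unfolding w_def using nonneg(1)[of y] \<eta> p by (intro mult_le_cancel_left1[THEN iffD2]) auto
  have k: "integrable lborel k"
    by (rule Bochner_Integration.integrable_bound[OF w]) (use k_le_w nonneg w_nonneg in \<open>auto simp: w_def[symmetric]\<close>)
  have prod: "has_bochner_integral (lborel \<Otimes>\<^sub>M lborel) (\<lambda>z. w (R (fst z) - snd z) * g (snd z))
      ((LINT y|lborel. w y) * (LINT y|lborel. g y))"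
  proof (rule has_bochner_integral_nn_integral)
    have "(\<integral>\<^sup>+z. ennreal (w (R (fst z) - snd z) * g (snd z)) \<partial>(lborel \<Otimes>\<^sub>M lborel))
        = (\<integral>\<^sup>+x. w x \<partial>lborel) * (\<integral>\<^sup>+x. g x \<partial>lborel)"
      using nn_integral_tonelli_convolution[OF R, of w g] w_nonneg g_nonneg by (simp add: ennreal_mult)
    also have "\<dots> = ennreal ((LINT y|lborel. w y) * (LINT y|lborel. g y))"
      using w f w_nonneg g_nonneg
      by (simp add: nn_integral_eq_integral w_def[symmetric] g_def[symmetric] ennreal_mult)
    finally show "(\<integral>\<^sup>+z. ennreal (w (R (fst z) - snd z) * g (snd z)) \<partial>(lborel \<Otimes>\<^sub>M lborel))
        = ennreal ((LINT y|lborel. w y) * (LINT y|lborel. g y))" .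
  qed (use w_nonneg g_nonneg in auto)
  have prod_int: "integrable (lborel \<Otimes>\<^sub>M lborel) (\<lambda>(x, \<xi>). w (R x - \<xi>) * g \<xi>)"
    using prod by (simp add: has_bochner_integral_iff case_prod_unfold)
  define G where "G x = (LINT \<xi>|lborel. w (R x - \<xi>) * g \<xi>)" for x
  have G: "integrable lborel G" "(LINT x|lborel. G x) = (LINT y|lborel. w y) * (LINT y|lborel. g y)"
    unfolding G_def using lborel_pair.integrable_fst[OF prod_int] lborel_pair.integral_fst[OF prod_int] prod
    by (simp_all add: has_bochner_integral_iff case_prod_unfold)
  have pointwise: "k (R x - \<xi>) * (\<theta> x * f \<xi>) powr p \<le> C powr p * (w (R x - \<xi>) * g \<xi>)" for x \<xi>
  proof -
    have "\<theta> x = \<theta> (\<xi> + (R x - \<xi>))"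
      by (rule radial) (simp add: orthogonal_transformation_norm[OF R])
    then have "\<theta> x * f \<xi> \<le> C * \<theta> \<xi> * exp (\<eta> * norm (R x - \<xi>)) * f \<xi>"
      using growth[of \<xi> "R x - \<xi>"] nonneg by (simp add: mult_right_mono)
    then have "(\<theta> x * f \<xi>) powr p \<le> (C * (\<theta> \<xi> * f \<xi>) * exp (\<eta> * norm (R x - \<xi>))) powr p"
      using nonneg(2)[of \<xi>] pos[of x] p by (intro powr_mono2) (simp_all add: mult_ac)
    also have "\<dots> = C powr p * (g \<xi> * exp (\<eta> * p * norm (R x - \<xi>)))"
      using nonneg pos[of \<xi>] C p by (simp add: powr_mult g_def exp_powr_real mult_ac)
    finally have "(\<theta> x * f \<xi>) powr p \<le> C powr p * (g \<xi> * exp (\<eta> * p * norm (R x - \<xi>)))" .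
    from mult_left_mono[OF this nonneg(1)[of "R x - \<xi>"]] show ?thesis
      by (simp add: w_def mult_ac)
  qed
  have k_refl: "integrable lborel (\<lambda>\<xi>. k (c - \<xi>))" "(LINT \<xi>|lborel. k (c - \<xi>)) = (LINT \<xi>|lborel. k \<xi>)" for c
  proof -
    have "(\<integral>\<^sup>+\<xi>. k (c - \<xi>) \<partial>lborel) = ennreal (LINT \<xi>|lborel. k \<xi>)"
      using k nonneg by (subst nn_integral_lborel_reflect) (auto simp: nn_integral_eq_integral)
    then have "has_bochner_integral lborel (\<lambda>\<xi>. k (c - \<xi>)) (LINT \<xi>|lborel. k \<xi>)"
      using nonneg by (intro has_bochner_integral_nn_integral) (auto intro: integral_nonneg_AE)
    then show "integrable lborel (\<lambda>\<xi>. k (c - \<xi>))" "(LINT \<xi>|lborel. k (c - \<xi>)) = (LINT \<xi>|lborel. k \<xi>)"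
      by (simp_all add: has_bochner_integral_iff)
  qed
  define F where "F x = (LINT \<xi>|lborel. k (R x - \<xi>) * f \<xi>)" for x
  have [measurable]: "F \<in> borel_measurable borel"
    unfolding F_def by measurable
  have F_nonneg: "F x \<ge> 0" for x
    unfolding F_def using nonneg by (intro integral_nonneg_AE) auto
  define K where "K = C powr p * (LINT y|lborel. k y) powr (p - 1)"
  \<comment> \<open>For almost every x the section of the product in \<open>prod_int\<close> is
    integrable. At such x Jensen applies, and by \<open>k_refl\<close> the mass of the reflected
    kernel does not depend on x.\<close>
  have main: "AE x in lborel. integrable lborel (\<lambda>\<xi>. k (R x - \<xi>) * f \<xi>) \<and> (\<theta> x * F x) powr p \<le> K * G x"
    using lborel_pair.AE_integrable_fst[OF prod_int]
  proof eventually_elim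
    case (elim x)
    have int: "integrable lborel (\<lambda>\<xi>. k (R x - \<xi>) * (\<theta> x * f \<xi>) powr p)"
      by (rule Bochner_Integration.integrable_bound[OF integrable_mult_right[OF elim, of "C powr p"]])
         (use pointwise nonneg in \<open>auto intro: order_trans[OF _ abs_ge_self]\<close>)
    note J = jensen_powr[OF p _ _ k_refl(1) _ int]
    have "integrable lborel (\<lambda>\<xi>. k (R x - \<xi>) * (\<theta> x * f \<xi>))"
      using nonneg pos[of x] by (intro J) auto
    then have 1: "integrable lborel (\<lambda>\<xi>. k (R x - \<xi>) * f \<xi>)"
      using integrable_mult_right[of "1 / \<theta> x" lborel "\<lambda>\<xi>. k (R x - \<xi>) * (\<theta> x * f \<xi>)"] pos[of x]
      by (simp add: field_simps)
    have "\<theta> x * F x = (LINT \<xi>|lborel. k (R x - \<xi>) * (\<theta> x * f \<xi>))"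
      unfolding F_def by (subst integral_mult_right_zero[symmetric]) (simp add: mult_ac)
    also have "\<dots> powr p \<le> (LINT \<xi>|lborel. k \<xi>) powr (p - 1) * (LINT \<xi>|lborel. k (R x - \<xi>) * (\<theta> x * f \<xi>) powr p)"
      using nonneg pos[of x] by (subst k_refl(2)[of "R x", symmetric], intro J) auto
    also have "\<dots> \<le> (LINT \<xi>|lborel. k \<xi>) powr (p - 1) * (C powr p * G x)"
      unfolding G_def
      by (intro mult_left_mono, subst integral_mult_right_zero[symmetric], intro integral_mono int integrable_mult_right elim pointwise) auto
    finally show ?case
      using 1 by (simp add: K_def mult_ac)
  qed
  show "AE x in lborel. integrable lborel (\<lambda>\<xi>. k (R x - \<xi>) * f \<xi>)"
    using main by eventually_elim auto
  have F_le: "AE x in lborel. (\<theta> x * F x) powr p \<le> K * G x"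
    using main by eventually_elim auto
  show int: "integrable lborel (\<lambda>x. (\<theta> x * (LINT \<xi>|lborel. k (R x - \<xi>) * f \<xi>)) powr p)"
    unfolding F_def[symmetric]
    by (rule Bochner_Integration.integrable_bound[OF integrable_mult_right[OF G(1), of K]])
       (use F_le in \<open>auto elim!: eventually_mono intro: order_trans[OF _ abs_ge_self]\<close>)
  have "(LINT x|lborel. (\<theta> x * F x) powr p) \<le> (LINT x|lborel. K * G x)"
    using F_le int by (intro integral_mono_AE integrable_mult_right G) (auto simp: F_def)
  then show "(LINT x|lborel. (\<theta> x * (LINT \<xi>|lborel. k (R x - \<xi>) * f \<xi>)) powr p)
      \<le> C powr p * (LINT y|lborel. k y) powr (p - 1) * (LINT y|lborel. k y * exp (\<eta> * p * norm y))
          * (LINT x|lborel. (\<theta> x * f x) powr p)"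
    using G(2) unfolding F_def K_def w_def[symmetric] g_def[symmetric] by (simp add: mult_ac)
qed

end

subsection \<open>Density of continuous functions of compact support\<close>

text \<open>The bounds are available only for 0 < t <= 1. Rewriting the filter as
  \<open>at 0 within {0..1}\<close> keeps every test sequence in that range.\<close>

lemma dominated_convergence_at_right_0:
  fixes f :: "real \<Rightarrow> 'a \<Rightarrow> 'b::{banach, second_countable_topology}"
  assumes "\<And>t. 0 < t \<Longrightarrow> t \<le> 1 \<Longrightarrow> f t \<in> borel_measurable M" "l \<in> borel_measurable M"
    and "integrable M w"
    and "\<And>t. 0 < t \<Longrightarrow> t \<le> 1 \<Longrightarrow> AE x in M. norm (f t x) \<le> w x"
    and "AE x in M. ((\<lambda>t. f t x) \<longlongrightarrow> l x) (at_right 0)"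
  shows "((\<lambda>t. LINT x|M. f t x) \<longlongrightarrow> (LINT x|M. l x)) (at_right 0)"
proof -
  have eq: "at_right (0::real) = at 0 within {0..1}"
    by (simp add: at_within_Icc_at_right)
  show ?thesis
    unfolding eq tendsto_at_iff_sequentially comp_def
  proof (intro allI impI)
    fix X :: "nat \<Rightarrow> real" assume X: "\<forall>i. X i \<in> {0..1} - {0}" "X \<longlonglongrightarrow> 0"
    show "(\<lambda>i. LINT x|M. f (X i) x) \<longlonglongrightarrow> (LINT x|M. l x)"
    proof (rule integral_dominated_convergence[OF assms(2) _ assms(3)])
      show "AE x in M. (\<lambda>i. f (X i) x) \<longlonglongrightarrow> l x"
        using assms(5) by eventually_elim (use X in \<open>simp add: eq tendsto_at_iff_sequentially comp_def\<close>)
    qed (use X assms in \<open>auto simp: less_le\<close>)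
  qed
qed

text \<open>Built coordinatewise from the real-valued case. It reduces the spaces over
  \<open>lebesgue\<close> to Borel functions, for which measurability on products and Fubini over
  \<open>lborel\<close> can be used.\<close>

lemma lebesgue_measurable_ex_borel:
  fixes v :: "'a::euclidean_space \<Rightarrow> 'b::euclidean_space"
  assumes "v \<in> borel_measurable lebesgue"
  obtains v' where "v' \<in> borel_measurable borel" "AE x in lborel. v x = v' x"
proof -
  have "\<exists>f\<in>borel_measurable lborel. AE x in lborel. v x \<bullet> b = f x" for b
    by (rule completion_ex_borel_measurable_real) (use assms in measurable)
  then have "\<exists>f. \<forall>b. f b \<in> borel_measurable borel \<and> (AE x in lborel. v x \<bullet> b = f b x)"
    by (intro choice allI) auto
  then obtain f where f: "\<And>b. f b \<in> borel_measurable borel" "\<And>b. AE x in lborel. v x \<bullet> b = f b x"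
    by auto
  show ?thesis
  proof
    show "(\<lambda>x. \<Sum>b\<in>Basis. f b x *\<^sub>R b) \<in> borel_measurable borel"
      using f(1) by measurable
    have "AE x in lborel. \<forall>b\<in>Basis. v x \<bullet> b = f b x"
      using f(2) by (intro AE_finite_allI) auto
    then show "AE x in lborel. v x = (\<Sum>b\<in>Basis. f b x *\<^sub>R b)"
    proof eventually_elim
      case (elim x)
      then have "(\<Sum>b\<in>Basis. f b x *\<^sub>R b) = (\<Sum>b\<in>Basis. (v x \<bullet> b) *\<^sub>R b)"
        by (intro sum.cong) auto
      then show ?case by (simp add: euclidean_representation)
    qed
  qed
qed

text \<open>The notion \<open>measurable_on\<close> means by definition a limit of continuous
  functions outside a negligible set, so it plays the part of Lusin's theorem here.\<close>

lemma borel_ae_limit_continuous: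
  fixes v :: "'a::euclidean_space \<Rightarrow> 'b::euclidean_space"
  assumes "v \<in> borel_measurable borel"
  obtains g where "\<And>n. continuous_on UNIV (g n)" "AE x in lborel. (\<lambda>n. g n x) \<longlonglongrightarrow> v x"
proof -
  have "v measurable_on UNIV"
    by (rule lebesgue_measurable_imp_measurable_on) (use measurable_completion[of v lborel borel] assms in simp_all)
  then obtain N g where *: "negligible N \<and> (\<forall>n. continuous_on UNIV (g n)) \<and>
      (\<forall>x. x \<notin> N \<longrightarrow> (\<lambda>n. g n x) \<longlonglongrightarrow> (if x \<in> UNIV then v x else 0))"
    unfolding measurable_on_def by blast
  have "AE x in lebesgue. x \<notin> N"
    using * by (simp add: AE_not_in negligible_iff_null_sets)
  then have "AE x in lebesgue. (\<lambda>n. g n x) \<longlonglongrightarrow> v x"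
    by eventually_elim (use * in simp)
  then show ?thesis
    using * by (intro that[of g]) (simp_all add: AE_completion_iff)
qed

text \<open>The nearest-point projection onto the ball shortens vectors longer than r to length r.
  It truncates values while preserving continuity of the function to which it is applied.\<close>

definition clamp_ball :: "real \<Rightarrow> 'b::euclidean_space \<Rightarrow> 'b" where
  "clamp_ball r = closest_point (cball 0 r)"

lemma clamp_ball:
  fixes y :: "'b::euclidean_space"
  assumes "r \<ge> 0"
  shows "continuous_on A (clamp_ball r :: 'b \<Rightarrow> 'b)"
    and "norm (clamp_ball r y) \<le> r"
    and "norm (clamp_ball r y) \<le> norm y"
    and "norm y \<le> r \<Longrightarrow> clamp_ball r y = y"
    and "isCont (clamp_ball r) y"
proof -
  have ne: "cball (0::'b) r \<noteq> {}" using assms by simp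
  show "continuous_on A (clamp_ball r)"
    unfolding clamp_ball_def by (rule continuous_on_closest_point) (use ne in auto)
  show "norm (clamp_ball r y) \<le> r"
    using closest_point_in_set[OF closed_cball ne, of y] by (simp add: clamp_ball_def)
  show "norm y \<le> r \<Longrightarrow> clamp_ball r y = y" for y :: 'b
    unfolding clamp_ball_def by (rule closest_point_self) simp
  then have "clamp_ball r 0 = (0 :: 'b)" using assms by simp
  then show "norm (clamp_ball r y) \<le> norm y"
    using closest_point_lipschitz[OF convex_cball closed_cball ne, of y 0]
    by (simp add: clamp_ball_def dist_norm)
  show "isCont (clamp_ball r) y"
    unfolding clamp_ball_def by (rule continuous_at_closest_point) (use ne in auto)
qed

text \<open>From a + b <= 2 max a b. This crude form of Minkowski's inequality is good enough
  wherever only smallness or finiteness matters.\<close>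

lemma powr_add_le:
  fixes a b :: real
  assumes "a \<ge> 0" "b \<ge> 0" "p \<ge> 1"
  shows "(a + b) powr p \<le> 2 powr p * (a powr p + b powr p)"
proof -
  have "(a + b) powr p \<le> (2 * max a b) powr p"
    using assms by (intro powr_mono2) auto
  also have "\<dots> = 2 powr p * max a b powr p"
    using assms by (simp add: powr_mult)
  also have "max a b powr p \<le> a powr p + b powr p"
    by (auto simp: max_def)
  finally show ?thesis by simp
qed

context radial_weight
begin

lemma powr_norm_add_le:
  "(\<theta> x * norm (u + w)) powr p \<le> 2 powr p * ((\<theta> x * norm u) powr p + (\<theta> x * norm w) powr p)"
proof -
  have "(\<theta> x * norm (u + w)) powr p \<le> (\<theta> x * norm u + \<theta> x * norm w) powr p"
    using pos[of x] p norm_triangle_ineq[of u w]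
    by (intro powr_mono2) (auto simp flip: distrib_left)
  also have "\<dots> \<le> 2 powr p * ((\<theta> x * norm u) powr p + (\<theta> x * norm w) powr p)"
    using pos[of x] p by (intro powr_add_le) auto
  finally show ?thesis .
qed

lemma integrable_powr_add:
  fixes u w :: "'a \<Rightarrow> 'b::euclidean_space"
  assumes [measurable]: "u \<in> borel_measurable borel" "w \<in> borel_measurable borel"
    and int: "integrable lborel (\<lambda>x. (\<theta> x * norm (u x)) powr p)" "integrable lborel (\<lambda>x. (\<theta> x * norm (w x)) powr p)"
  shows "integrable lborel (\<lambda>x. (\<theta> x * norm (u x + w x)) powr p)"
    and "(LINT x|lborel. (\<theta> x * norm (u x + w x)) powr p)
      \<le> 2 powr p * ((LINT x|lborel. (\<theta> x * norm (u x)) powr p) + (LINT x|lborel. (\<theta> x * norm (w x)) powr p))"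
proof -
  show *: "integrable lborel (\<lambda>x. (\<theta> x * norm (u x + w x)) powr p)"
  proof (rule Bochner_Integration.integrable_bound)
    show "integrable lborel (\<lambda>x. 2 powr p * ((\<theta> x * norm (u x)) powr p + (\<theta> x * norm (w x)) powr p))"
      using int by (intro integrable_mult_right Bochner_Integration.integrable_add)
  qed (use powr_norm_add_le in \<open>auto intro: order_trans[OF _ abs_ge_self]\<close>)
  show "(LINT x|lborel. (\<theta> x * norm (u x + w x)) powr p)
      \<le> 2 powr p * ((LINT x|lborel. (\<theta> x * norm (u x)) powr p) + (LINT x|lborel. (\<theta> x * norm (w x)) powr p))"
    unfolding Bochner_Integration.integral_add[OF int, symmetric] integral_mult_right_zero[symmetric]
    by (intro integral_mono * integrable_mult_right Bochner_Integration.integrable_add int powr_norm_add_le)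
qed

lemma tendsto_weighted_diff:
  fixes f :: "'i \<Rightarrow> 'b::real_normed_vector"
  assumes "(f \<longlongrightarrow> l) F"
  shows "((\<lambda>k. (\<theta> x * norm (l - f k)) powr p) \<longlongrightarrow> 0) F"
proof (rule tendsto_zero_powrI)
  have "((\<lambda>k. \<theta> x * norm (l - f k)) \<longlongrightarrow> \<theta> x * norm (l - l)) F"
    by (intro tendsto_intros assms)
  then show "((\<lambda>k. \<theta> x * norm (l - f k)) \<longlongrightarrow> 0) F" by simp
qed (use p less_imp_le[OF pos] in auto)

text \<open>Truncating v in space and in size costs little by dominated convergence. With the
  truncation level k then fixed, v is replaced inside it by continuous \<open>g n\<close> converging
  almost everywhere. The truncation is continuous in the value, so convergence is inherited, and it
  makes all differences bounded with support in a fixed ball; nothing is required of the growth of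
  \<open>g n\<close>.\<close>

lemma compact_support_dense:
  fixes v :: "'a \<Rightarrow> 'b::euclidean_space"
  assumes v [measurable]: "v \<in> borel_measurable borel"
    and int: "integrable lborel (\<lambda>x. (\<theta> x * norm (v x)) powr p)" and "\<epsilon> > 0"
  obtains w r W where "continuous_on UNIV w" "\<And>x. norm (w x) \<le> W" "\<And>x. norm x \<ge> r \<Longrightarrow> w x = 0"
    "integrable lborel (\<lambda>x. (\<theta> x * norm (v x - w x)) powr p)"
    "(LINT x|lborel. (\<theta> x * norm (v x - w x)) powr p) < \<epsilon>"
proof -
  define bump where "bump k x = max 0 (1 - norm (x::'a) / real (Suc k))" for k x
  define cut where "cut k u x = bump k x *\<^sub>R clamp_ball (real (Suc k)) (u x)" for k and u :: "'a \<Rightarrow> 'b" and x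
  have bump: "0 \<le> bump k x" "bump k x \<le> 1" for k x
    by (auto simp: bump_def)
  have bump_0: "bump k x = 0" if "norm x \<ge> real (Suc k)" for k x
    using that by (simp add: bump_def max_def field_simps)
  have bump_cont: "continuous_on UNIV (bump k)" for k
    unfolding bump_def by (intro continuous_intros) simp
  have [measurable]: "bump k \<in> borel_measurable borel" for k
    by (rule borel_measurable_continuous_onI[OF bump_cont])
  have [measurable]: "clamp_ball (real (Suc k)) \<in> borel_measurable (borel :: 'b measure)" for k
    by (intro borel_measurable_continuous_onI clamp_ball) simp
  have [measurable]: "cut k u \<in> borel_measurable borel" if "u \<in> borel_measurable borel" for k u
    unfolding cut_def using that by measurable
  have cut_cont: "continuous_on UNIV (cut k u)" if "continuous_on UNIV u" for k u
    unfolding cut_def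
    by (intro continuous_intros bump_cont continuous_on_compose2[OF clamp_ball(1) that]) auto
  have cut_le: "norm (cut k u x) \<le> norm (u x)" "norm (cut k u x) \<le> real (Suc k)" for k u x
  proof -
    have "bump k x * norm (clamp_ball (real (Suc k)) (u x)) \<le> 1 * norm (u x)"
      "bump k x * norm (clamp_ball (real (Suc k)) (u x)) \<le> 1 * real (Suc k)"
      by (intro mult_mono bump clamp_ball; simp)+
    then show "norm (cut k u x) \<le> norm (u x)" "norm (cut k u x) \<le> real (Suc k)"
      using bump(1)[of k x] by (simp_all add: cut_def del: of_nat_Suc)
  qed
  have cut_0: "cut k u x = 0" if "norm x \<ge> real (Suc k)" for k u x
    using bump_0[OF that] by (simp add: cut_def)

  have "(\<lambda>k. cut k v x) \<longlonglongrightarrow> v x" for x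
  proof -
    have "(\<lambda>k. norm x / real (Suc k)) \<longlonglongrightarrow> 0"
      using LIMSEQ_Suc[OF lim_const_over_n[of "norm x"]] by simp
    from tendsto_max[OF tendsto_const[of 0] tendsto_diff[OF tendsto_const[of 1] this]]
    have "(\<lambda>k. bump k x *\<^sub>R v x) \<longlonglongrightarrow> 1 *\<^sub>R v x"
      unfolding bump_def by (intro tendsto_intros) simp
    moreover have "\<forall>\<^sub>F k in sequentially. bump k x *\<^sub>R v x = cut k v x"
    proof -
      obtain m where "norm (v x) \<le> real m" using real_arch_simple by blast
      then show ?thesis
        by (intro eventually_sequentiallyI[of m]) (simp add: cut_def clamp_ball(4))
    qed
    ultimately show ?thesis
      by (simp add: tendsto_cong)
  qed
  then have ptw: "(\<lambda>k. (\<theta> x * norm (v x - cut k v x)) powr p) \<longlonglongrightarrow> 0" for x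
    by (rule tendsto_weighted_diff)
  have bound1: "(\<theta> x * norm (v x - cut k v x)) powr p \<le> 2 powr p * (\<theta> x * norm (v x)) powr p" for k x
  proof -
    have "norm (v x - cut k v x) \<le> 2 * norm (v x)"
      using norm_triangle_ineq4[of "v x" "cut k v x"] cut_le(1)[of k v x] by simp
    then have "(\<theta> x * norm (v x - cut k v x)) powr p \<le> (2 * (\<theta> x * norm (v x))) powr p"
      using pos[of x] p by (intro powr_mono2) auto
    then show ?thesis using pos[of x] by (simp add: powr_mult)
  qed
  have int1: "integrable lborel (\<lambda>x. (\<theta> x * norm (v x - cut k v x)) powr p)" for k
    by (rule Bochner_Integration.integrable_bound[OF integrable_mult_right[OF int, of "2 powr p"]])
       (use bound1 in \<open>auto intro: order_trans[OF _ abs_ge_self]\<close>)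
  have "(\<lambda>k. LINT x|lborel. (\<theta> x * norm (v x - cut k v x)) powr p) \<longlonglongrightarrow> (LINT x|(lborel::'a measure). 0)"
    by (rule integral_dominated_convergence[where w = "\<lambda>x. 2 powr p * (\<theta> x * norm (v x)) powr p"])
       (use ptw bound1 in \<open>auto intro!: integrable_mult_right int\<close>)
  \<comment> \<open>The two approximation errors are combined by \<open>integrable_powr_add\<close>
    with factor 2^p, so each of them then contributes less than \<epsilon>/2.\<close>
  then have "\<forall>\<^sub>F k in sequentially. (LINT x|lborel. (\<theta> x * norm (v x - cut k v x)) powr p) < \<epsilon> / (2 powr p * 2)"
    using \<open>\<epsilon> > 0\<close> by (intro order_tendstoD(2)[of _ 0]) auto
  then obtain k where k: "(LINT x|lborel. (\<theta> x * norm (v x - cut k v x)) powr p) < \<epsilon> / (2 powr p * 2)"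
    by (meson eventually_happens sequentially_bot)

  obtain g where g: "\<And>n. continuous_on UNIV (g n)" "AE x in lborel. (\<lambda>n. g n x) \<longlonglongrightarrow> v x"
    using borel_ae_limit_continuous[OF v] by blast
  have [measurable]: "g n \<in> borel_measurable borel" for n
    by (rule borel_measurable_continuous_onI[OF g(1)])
  obtain \<Theta> where \<Theta>: "\<And>x. norm x \<le> real (Suc k) \<Longrightarrow> \<theta> x \<le> \<Theta>"
  proof -
    have "bounded (\<theta> ` cball 0 (real (Suc k)))"
      by (intro compact_imp_bounded compact_continuous_image continuous_on_subset[OF continuous]) auto
    then obtain b where "\<forall>x\<in>\<theta> ` cball 0 (real (Suc k)). norm x \<le> b"
      unfolding bounded_iff by blast
    then show ?thesis
      by (intro that[of b]) (force dest: abs_le_D1)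
  qed
  have ptw2: "AE x in lborel. (\<lambda>n. (\<theta> x * norm (cut k v x - cut k (g n) x)) powr p) \<longlonglongrightarrow> 0"
    using g(2)
  proof eventually_elim
    case (elim x)
    have "(\<lambda>n. cut k (g n) x) \<longlonglongrightarrow> cut k v x"
      unfolding cut_def
      by (intro tendsto_intros isCont_tendsto_compose[OF clamp_ball(5) elim]) simp
    then show ?case
      by (rule tendsto_weighted_diff)
  qed
  let ?D = "\<lambda>x::'a. indicator (cball 0 (real (Suc k))) x * (\<Theta> * (2 * real (Suc k))) powr p"
  have bound2: "(\<theta> x * norm (cut k v x - cut k (g n) x)) powr p \<le> ?D x" for n x
  proof (cases "norm x \<le> real (Suc k)")
    case True
    have "norm (cut k v x - cut k (g n) x) \<le> 2 * real (Suc k)"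
      unfolding mult_2 by (intro order_trans[OF norm_triangle_ineq4 add_mono] cut_le(2))
    then have "(\<theta> x * norm (cut k v x - cut k (g n) x)) powr p \<le> (\<Theta> * (2 * real (Suc k))) powr p"
      using pos[of x] p \<Theta>[OF True] by (intro powr_mono2 mult_mono) auto
    then show ?thesis using True by simp
  qed (simp add: cut_0)
  have D: "integrable lborel ?D"
    by (intro integrable_mult_left integrable_real_indicator emeasure_bounded_finite) simp_all
  have int2: "integrable lborel (\<lambda>x. (\<theta> x * norm (cut k v x - cut k (g n) x)) powr p)" for n
    by (rule Bochner_Integration.integrable_bound[OF D])
       (use bound2 in \<open>auto intro: order_trans[OF _ abs_ge_self]\<close>)
  have "(\<lambda>n. LINT x|lborel. (\<theta> x * norm (cut k v x - cut k (g n) x)) powr p) \<longlonglongrightarrow> (LINT x|(lborel::'a measure). 0)"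
    by (rule integral_dominated_convergence[where w = ?D]) (use ptw2 bound2 D in auto)
  then have "\<forall>\<^sub>F n in sequentially. (LINT x|lborel. (\<theta> x * norm (cut k v x - cut k (g n) x)) powr p) < \<epsilon> / (2 powr p * 2)"
    using \<open>\<epsilon> > 0\<close> by (intro order_tendstoD(2)[of _ 0]) auto
  then obtain n where n: "(LINT x|lborel. (\<theta> x * norm (cut k v x - cut k (g n) x)) powr p) < \<epsilon> / (2 powr p * 2)"
    by (meson eventually_happens sequentially_bot)
  note sum = integrable_powr_add[OF _ _ int1[of k] int2[of n]]
  show ?thesis
  proof
    show "continuous_on UNIV (cut k (g n))"
      by (intro cut_cont g)
    show "integrable lborel (\<lambda>x. (\<theta> x * norm (v x - cut k (g n) x)) powr p)"
      using sum(1) by simp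
    have "2 powr p * (LINT x|lborel. (\<theta> x * norm (v x - cut k v x)) powr p) < \<epsilon> / 2"
      "2 powr p * (LINT x|lborel. (\<theta> x * norm (cut k v x - cut k (g n) x)) powr p) < \<epsilon> / 2"
      using k n by (simp_all add: field_simps)
    then show "(LINT x|lborel. (\<theta> x * norm (v x - cut k (g n) x)) powr p) < \<epsilon>"
      using sum(2) by (simp add: distrib_left)
  qed (use cut_le(2) cut_0 in auto)
qed

end

subsection \<open>Convolution semigroups with a Gaussian majorant\<close>

text \<open>Half of the quadratic decay pays for the exponential: b r <= b^2 / (2 \<alpha>) +
  \<alpha> r^2 / 2.\<close>

lemma integrable_gaussian_times_exp:
  fixes \<alpha> b :: real
  assumes "\<alpha> > 0"
  shows "integrable lborel (\<lambda>y::'a::euclidean_space. exp (- (\<alpha> * (norm y)\<^sup>2)) * exp (b * norm y))"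
proof (rule Bochner_Integration.integrable_bound)
  show "integrable lborel (\<lambda>y::'a. exp (b\<^sup>2 / (2 * \<alpha>)) * exp (- (\<alpha> / 2 * (norm y)\<^sup>2)))"
    using assms by (intro integrable_mult_right integrable_gaussian) simp
  show "AE y::'a in lborel. norm (exp (- (\<alpha> * (norm y)\<^sup>2)) * exp (b * norm y))
      \<le> norm (exp (b\<^sup>2 / (2 * \<alpha>)) * exp (- (\<alpha> / 2 * (norm y)\<^sup>2)))"
  proof (intro always_eventually allI)
    fix y :: 'a
    have "0 \<le> (b - \<alpha> * norm y)\<^sup>2 / (2 * \<alpha>)"
      using assms by simp
    also have "\<dots> = b\<^sup>2 / (2 * \<alpha>) - b * norm y + \<alpha> / 2 * (norm y)\<^sup>2"
      using assms by (simp add: power2_eq_square field_simps)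
    finally show "norm (exp (- (\<alpha> * (norm y)\<^sup>2)) * exp (b * norm y))
        \<le> norm (exp (b\<^sup>2 / (2 * \<alpha>)) * exp (- (\<alpha> / 2 * (norm y)\<^sup>2)))"
      by (simp flip: exp_add)
  qed
qed measurable

lemma integral_lborel_scale:
  fixes f :: "'a::euclidean_space \<Rightarrow> real"
  assumes "r > 0" and [measurable]: "f \<in> borel_measurable borel"
  shows "(LINT y|lborel. f y) = (LINT z|lborel. r ^ DIM('a) * f (r *\<^sub>R z))"
  by (subst lborel_affine[of r "0::'a"]) (use assms in \<open>simp_all add: integral_density integral_distr\<close>)

lemma integral_lborel_reflect:
  fixes f :: "'a::euclidean_space \<Rightarrow> 'b::{banach, second_countable_topology}"
  assumes [measurable]: "f \<in> borel_measurable borel"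
  shows "(LINT x|lborel. f (c - x)) = (LINT x|lborel. f x)"
proof -
  have "(LINT x|lborel. f (c - x)) = (LINT x|distr lborel borel uminus. f (c + x))"
    by (subst integral_distr) simp_all
  then show ?thesis
    by (simp add: lborel_distr_uminus_euclidean integral_lborel_shift)
qed

text \<open>What the semigroup argument needs to know about the heat kernel, with the matrices
  hidden: \<kappa> takes values in a space of multipliers, and \<open>act\<close> lets them operate
  on vectors. The estimate concerns \<open>act (\<kappa> t y) u\<close>, so that M absorbs the norm
  of the bilinear map. The mass of \<kappa> is required to tend to the neutral multiplier e, not to
  equal it. The law \<open>kernel_convolution\<close> is the Chapman-Kolmogorov identity for the
  two-point kernel \<kappa> t (R t x - \<xi>).\<close>

locale diffusion_kernel = radial_weight \<theta> \<eta> C p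
  for \<theta> :: "'a::euclidean_space \<Rightarrow> real" and \<eta> C p :: real +
  fixes act :: "'c::euclidean_space \<Rightarrow> 'b::euclidean_space \<Rightarrow> 'b"
    and \<kappa> :: "real \<Rightarrow> 'a \<Rightarrow> 'c" and e :: 'c and R :: "real \<Rightarrow> 'a \<Rightarrow> 'a" and M \<beta> c :: real
  assumes act: "bounded_bilinear act" and act_e: "act e u = u"
    and kernel_integrable: "t > 0 \<Longrightarrow> integrable lborel (\<kappa> t)"
    and kernel_bound: "t > 0 \<Longrightarrow> norm (act (\<kappa> t y) u)
      \<le> M * exp (\<beta> * t) * (1 / sqrt t) ^ DIM('a) * exp (- (c / t * (norm y)\<^sup>2)) * norm u"
    and kernel_tendsto: "((\<lambda>t. LINT y|lborel. \<kappa> t y) \<longlongrightarrow> e) (at_right 0)"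
    and kernel_convolution: "s > 0 \<Longrightarrow> t > 0 \<Longrightarrow>
      (LINT \<xi>|lborel. act (\<kappa> s (R s x - \<xi>)) (act (\<kappa> t (R t \<xi> - \<zeta>)) u)) = act (\<kappa> (s + t) (R (s + t) x - \<zeta>)) u"
    and R: "orthogonal_transformation (R t)"
    and R_tendsto: "((\<lambda>t. R t x) \<longlongrightarrow> x) (at_right 0)"
    and M: "M \<ge> 0" and \<beta>: "\<beta> \<ge> 0" and c: "c > 0"
begin

definition T :: "real \<Rightarrow> ('a \<Rightarrow> 'b) \<Rightarrow> 'a \<Rightarrow> 'b" where
  "T t v x = (LINT \<xi>|lborel. act (\<kappa> t (R t x - \<xi>)) (v \<xi>))"

definition majorant :: "real \<Rightarrow> 'a \<Rightarrow> real" where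
  "majorant t y = M * exp (\<beta> * t) * (1 / sqrt t) ^ DIM('a) * exp (- (c / t * (norm y)\<^sup>2))"

text \<open>The weighted kernel norm from Young's inequality; C times it bounds the operator norm of
  \<open>T t\<close>.\<close>

definition mass :: "real \<Rightarrow> real" where
  "mass t = (LINT y|lborel. majorant t y * exp (\<eta> * p * norm y))"

sublocale act: bounded_bilinear act by (rule act)

section \<open>The Gaussian majorant and its weighted mass\<close>

lemma R_measurable [measurable]: "R t \<in> borel_measurable borel"
  by (rule borel_measurable_orthogonal[OF R])

lemma norm_R: "norm (R t x) = norm x"
  by (rule orthogonal_transformation_norm[OF R])

lemma majorant_measurable [measurable]: "majorant t \<in> borel_measurable borel"
  unfolding majorant_def by measurable

lemma majorant_nonneg: "t > 0 \<Longrightarrow> majorant t y \<ge> 0"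
  using M by (simp add: majorant_def)

lemma act_measurable [measurable (raw)]:
  assumes [measurable]: "f \<in> borel_measurable N" "g \<in> borel_measurable N"
  shows "(\<lambda>x. act (f x) (g x)) \<in> borel_measurable N"
  by (rule borel_measurable_continuous_Pair)
     (auto intro!: act.continuous_on continuous_intros)

lemma kernel_measurable: "t > 0 \<Longrightarrow> \<kappa> t \<in> borel_measurable borel"
  using borel_measurable_integrable[OF kernel_integrable] by simp

lemma norm_act_le: "t > 0 \<Longrightarrow> norm (act (\<kappa> t y) u) \<le> majorant t y * norm u"
  using kernel_bound by (simp add: majorant_def)

lemma majorant_exp_integrable:
  "t > 0 \<Longrightarrow> integrable lborel (\<lambda>y. majorant t y * exp (b * norm y))"
  using integrable_mult_right[OF integrable_gaussian_times_exp[of "c / t" b, where 'a = 'a],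
      of "M * exp (\<beta> * t) * (1 / sqrt t) ^ DIM('a)"] c
  by (simp add: majorant_def mult.assoc)

lemma majorant_integrable: "t > 0 \<Longrightarrow> integrable lborel (majorant t)"
  using majorant_exp_integrable[of t 0] by simp

text \<open>Parabolic scaling y = sqrt t z: the Jacobian cancels the factor t^(-d/2), leaving an
  integrand without singularity at t = 0. The uniform bound on \<open>mass\<close> and the limit t
  to 0 both rest on this.\<close>

lemma integral_majorant_scale:
  assumes t: "t > 0" and [measurable]: "u \<in> borel_measurable borel"
  shows "(LINT y|lborel. majorant t y * u y)
      = (LINT z|lborel. M * exp (\<beta> * t) * exp (- (c * (norm z)\<^sup>2)) * u (sqrt t *\<^sub>R z))"
proof -
  have eq: "sqrt t ^ DIM('a) * (majorant t (sqrt t *\<^sub>R z) * u (sqrt t *\<^sub>R z))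
      = M * exp (\<beta> * t) * exp (- (c * (norm z)\<^sup>2)) * u (sqrt t *\<^sub>R z)" for z
    using t by (simp add: majorant_def power_mult_distrib power_divide)
  have "(LINT y|lborel. majorant t y * u y)
      = (LINT z|lborel. sqrt t ^ DIM('a) * (majorant t (sqrt t *\<^sub>R z) * u (sqrt t *\<^sub>R z)))"
    by (rule integral_lborel_scale) (use t in simp_all)
  then show ?thesis by (simp only: eq)
qed

lemma mass_nonneg: "t > 0 \<Longrightarrow> mass t \<ge> 0"
  unfolding mass_def by (intro integral_nonneg_AE) (simp add: majorant_nonneg)

lemma integral_majorant_le_mass:
  assumes "t > 0"
  shows "(LINT y|lborel. majorant t y) \<le> mass t"
  unfolding mass_def
proof (intro integral_mono majorant_integrable majorant_exp_integrable assms)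
  fix y :: 'a
  have "1 \<le> exp (\<eta> * p * norm y)"
    using \<eta> p by simp
  from mult_left_mono[OF this majorant_nonneg[OF assms, of y]]
  show "majorant t y \<le> majorant t y * exp (\<eta> * p * norm y)" by simp
qed

text \<open>After scaling, t enters only through exp (\<beta> t) and exp (\<eta> p sqrt t |z|). Both
  are nondecreasing in t, so the integral at t = 1 serves as the bound.\<close>

lemma mass_bounded:
  obtains D where "\<And>t. 0 < t \<Longrightarrow> t \<le> 1 \<Longrightarrow> mass t \<le> D" "D \<ge> 0"
proof -
  define D where "D = (LINT z|lborel. M * exp \<beta> * (exp (- (c * (norm (z::'a))\<^sup>2)) * exp (\<eta> * p * norm z)))"
  have "mass t \<le> D" if t: "0 < t" "t \<le> 1" for t
  proof -
    have "mass t = (LINT z|lborel. M * exp (\<beta> * t) * (exp (- (c * (norm (z::'a))\<^sup>2)) * exp (\<eta> * p * sqrt t * norm z)))"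
      unfolding mass_def using t by (subst integral_majorant_scale) (simp_all add: mult_ac)
    also have "\<dots> \<le> D"
      unfolding D_def
    proof (intro integral_mono integrable_mult_right integrable_gaussian_times_exp c)
      fix z :: 'a
      have "\<beta> * t \<le> \<beta>" "\<eta> * p * sqrt t * norm z \<le> \<eta> * p * norm z"
        using t \<beta> \<eta> p by (auto intro!: mult_right_mono simp: mult_left_le)
      then show "M * exp (\<beta> * t) * (exp (- (c * (norm z)\<^sup>2)) * exp (\<eta> * p * sqrt t * norm z))
          \<le> M * exp \<beta> * (exp (- (c * (norm z)\<^sup>2)) * exp (\<eta> * p * norm z))"
        using M by (intro mult_mono) auto
    qed
    finally show ?thesis .
  qed
  moreover have "D \<ge> 0"
    unfolding D_def using M by (intro integral_nonneg_AE) auto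
  ultimately show ?thesis by (rule that)
qed

section \<open>Boundedness, linearity and the semigroup law\<close>

lemma T_measurable [measurable]:
  assumes "t > 0" and [measurable]: "v \<in> borel_measurable borel"
  shows "T t v \<in> borel_measurable borel"
proof -
  note [measurable] = kernel_measurable[OF assms(1)]
  show ?thesis unfolding T_def by measurable
qed

context
  fixes t :: real and v :: "'a \<Rightarrow> 'b"
  assumes t: "t > 0" and v [measurable]: "v \<in> borel_measurable borel"
    and int: "integrable lborel (\<lambda>x. (\<theta> x * norm (v x)) powr p)"
begin

text \<open>The exponential weight is at least 1, so \<open>mass t\<close> also bounds the
  unweighted mass in Young's inequality, and the two kernel factors combine to its p-th
  power.\<close>

lemma majorant_convolution:
  "AE x in lborel. integrable lborel (\<lambda>\<xi>. majorant t (R t x - \<xi>) * norm (v \<xi>))"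
  "integrable lborel (\<lambda>x. (\<theta> x * (LINT \<xi>|lborel. majorant t (R t x - \<xi>) * norm (v \<xi>))) powr p)"
  "(LINT x|lborel. (\<theta> x * (LINT \<xi>|lborel. majorant t (R t x - \<xi>) * norm (v \<xi>))) powr p)
      \<le> C powr p * mass t powr p * (LINT x|lborel. (\<theta> x * norm (v x)) powr p)"
proof -
  note Y = weighted_young[OF R[of t] majorant_measurable[of t] _ majorant_nonneg[OF t] norm_ge_zero
      majorant_exp_integrable[OF t, of "\<eta> * p"] int]
  show "AE x in lborel. integrable lborel (\<lambda>\<xi>. majorant t (R t x - \<xi>) * norm (v \<xi>))"
    "integrable lborel (\<lambda>x. (\<theta> x * (LINT \<xi>|lborel. majorant t (R t x - \<xi>) * norm (v \<xi>))) powr p)"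
    by (intro Y; simp)+
  have "(LINT y|lborel. majorant t y) powr (p - 1) * mass t \<le> mass t powr (p - 1) * mass t"
    using p mass_nonneg[OF t] integral_majorant_le_mass[OF t] majorant_nonneg[OF t]
    by (intro mult_right_mono powr_mono2) (auto intro: integral_nonneg_AE)
  also have "\<dots> = mass t powr p"
    using mass_nonneg[OF t] p by (cases "mass t = 0") (simp_all add: powr_diff)
  finally have "C powr p * (LINT y|lborel. majorant t y) powr (p - 1) * mass t
        * (LINT x|lborel. (\<theta> x * norm (v x)) powr p)
      \<le> C powr p * mass t powr p * (LINT x|lborel. (\<theta> x * norm (v x)) powr p)"
    by (intro mult_right_mono) (auto simp: mult.assoc intro!: mult_left_mono integral_nonneg_AE)
  moreover have "(LINT x|lborel. (\<theta> x * (LINT \<xi>|lborel. majorant t (R t x - \<xi>) * norm (v \<xi>))) powr p)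
      \<le> C powr p * (LINT y|lborel. majorant t y) powr (p - 1) * mass t
        * (LINT x|lborel. (\<theta> x * norm (v x)) powr p)"
    unfolding mass_def by (intro Y) simp
  ultimately show "(LINT x|lborel. (\<theta> x * (LINT \<xi>|lborel. majorant t (R t x - \<xi>) * norm (v \<xi>))) powr p)
      \<le> C powr p * mass t powr p * (LINT x|lborel. (\<theta> x * norm (v x)) powr p)"
    by linarith
qed

lemma kernel_integrable_AE:
  "AE x in lborel. integrable lborel (\<lambda>\<xi>. act (\<kappa> t (R t x - \<xi>)) (v \<xi>))"
  using majorant_convolution(1)
proof eventually_elim
  case (elim x)
  note [measurable] = kernel_measurable[OF t]
  show ?case
    by (rule Bochner_Integration.integrable_bound[OF elim])
       (use norm_act_le[OF t] in \<open>auto intro: order_trans[OF _ abs_ge_self]\<close>)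
qed

lemma T_bounded:
  "integrable lborel (\<lambda>x. (\<theta> x * norm (T t v x)) powr p)"
  "(LINT x|lborel. (\<theta> x * norm (T t v x)) powr p)
      \<le> C powr p * mass t powr p * (LINT x|lborel. (\<theta> x * norm (v x)) powr p)"
proof -
  have le: "AE x in lborel. (\<theta> x * norm (T t v x)) powr p
      \<le> (\<theta> x * (LINT \<xi>|lborel. majorant t (R t x - \<xi>) * norm (v \<xi>))) powr p"
    using kernel_integrable_AE majorant_convolution(1)
  proof eventually_elim
    case (elim x)
    have "norm (T t v x) \<le> (LINT \<xi>|lborel. majorant t (R t x - \<xi>) * norm (v \<xi>))"
      unfolding T_def
      by (rule Bochner_Integration.integral_norm_bound_integral[OF elim norm_act_le[OF t]])
    then show ?case
      using pos[of x] p by (intro powr_mono2 mult_left_mono) auto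
  qed
  note [measurable] = T_measurable[OF t v]
  show 1: "integrable lborel (\<lambda>x. (\<theta> x * norm (T t v x)) powr p)"
    by (rule Bochner_Integration.integrable_bound[OF majorant_convolution(2)])
       (use le in \<open>auto elim!: eventually_mono intro: order_trans[OF _ abs_ge_self]\<close>)
  show "(LINT x|lborel. (\<theta> x * norm (T t v x)) powr p)
      \<le> C powr p * mass t powr p * (LINT x|lborel. (\<theta> x * norm (v x)) powr p)"
    using integral_mono_AE[OF 1 majorant_convolution(2) le] majorant_convolution(3) by linarith
qed

end

text \<open>The identity is claimed only almost everywhere: where one of the integrals diverges, the
  Bochner integral takes its default value 0 and additivity may fail.\<close>

lemma T_add_scaled:
  assumes t: "t > 0" and [measurable]: "u \<in> borel_measurable borel" "v \<in> borel_measurable borel"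
    and int: "integrable lborel (\<lambda>x. (\<theta> x * norm (u x)) powr p)" "integrable lborel (\<lambda>x. (\<theta> x * norm (v x)) powr p)"
    and f: "bounded_linear f" "\<And>k u. act k (f u) = f (act k u)"
    and g: "bounded_linear g" "\<And>k u. act k (g u) = g (act k u)"
  shows "AE x in lborel. T t (\<lambda>x. f (u x) + g (v x)) x = f (T t u x) + g (T t v x)"
  using kernel_integrable_AE[OF t assms(2) int(1)] kernel_integrable_AE[OF t assms(3) int(2)]
proof eventually_elim
  case (elim x)
  have "f (T t u x) + g (T t v x) = (LINT \<xi>|lborel. f (act (\<kappa> t (R t x - \<xi>)) (u \<xi>)) + g (act (\<kappa> t (R t x - \<xi>)) (v \<xi>)))"
    unfolding T_def
    by (subst Bochner_Integration.integral_add)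
       (simp_all add: integral_bounded_linear[OF f(1) elim(1)] integral_bounded_linear[OF g(1) elim(2)]
         integrable_bounded_linear[OF f(1) elim(1)] integrable_bounded_linear[OF g(1) elim(2)])
  then show ?case
    by (simp add: T_def act.add_right f(2) g(2))
qed

lemma T_semigroup:
  assumes s: "s > 0" and t: "t > 0" and v [measurable]: "v \<in> borel_measurable borel"
    and int: "integrable lborel (\<lambda>x. (\<theta> x * norm (v x)) powr p)"
  shows "AE x in lborel. T (s + t) v x = T s (T t v) x"
proof -
  note [measurable] = kernel_measurable[OF s] kernel_measurable[OF t]
  \<comment> \<open>U again has finite weighted norm, by \<open>majorant_convolution\<close>, so
    Young's inequality applies a second time, now to the majorant at time s. For almost every x this
    gives the absolute convergence of the double integral that Fubini requires.\<close>
  define U where "U \<xi> = (LINT \<zeta>|lborel. majorant t (R t \<xi> - \<zeta>) * norm (v \<zeta>))" for \<xi>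
  have [measurable]: "U \<in> borel_measurable borel"
    unfolding U_def by measurable
  have U_nonneg: "U \<xi> \<ge> 0" for \<xi>
    unfolding U_def using majorant_nonneg[OF t] by (intro integral_nonneg_AE) auto
  have "AE x in lborel. integrable lborel (\<lambda>\<xi>. majorant s (R s x - \<xi>) * U \<xi>)"
    using majorant_convolution(2)[OF t v int] U_nonneg
    by (intro weighted_young(1)[OF R] majorant_nonneg[OF s] majorant_exp_integrable[OF s]) (auto simp: U_def)
  then show ?thesis
  proof eventually_elim
    case (elim x)
    define F where "F \<xi> \<zeta> = act (\<kappa> s (R s x - \<xi>)) (act (\<kappa> t (R t \<xi> - \<zeta>)) (v \<zeta>))" for \<xi> \<zeta>
    have [measurable]: "case_prod F \<in> borel_measurable (lborel \<Otimes>\<^sub>M lborel)"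
      unfolding F_def by measurable
    have F_le: "norm (F \<xi> \<zeta>) \<le> majorant s (R s x - \<xi>) * (majorant t (R t \<xi> - \<zeta>) * norm (v \<zeta>))" for \<xi> \<zeta>
      unfolding F_def
      by (rule order_trans[OF norm_act_le[OF s] mult_left_mono[OF norm_act_le[OF t] majorant_nonneg[OF s]]])
    have ae: "AE \<xi> in lborel. integrable lborel (F \<xi>) \<and> (LINT \<zeta>|lborel. norm (F \<xi> \<zeta>)) \<le> majorant s (R s x - \<xi>) * U \<xi>"
      using majorant_convolution(1)[OF t v int]
    proof eventually_elim
      case (elim \<xi>)
      from integrable_mult_right[OF elim, of "majorant s (R s x - \<xi>)"]
      have 1: "integrable lborel (\<lambda>\<zeta>. majorant s (R s x - \<xi>) * (majorant t (R t \<xi> - \<zeta>) * norm (v \<zeta>)))" .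
      have 2: "integrable lborel (F \<xi>)"
      proof (rule Bochner_Integration.integrable_bound[OF 1])
        show "F \<xi> \<in> borel_measurable lborel" unfolding F_def by measurable
      qed (use F_le in \<open>auto intro: order_trans[OF _ abs_ge_self]\<close>)
      have "(LINT \<zeta>|lborel. norm (F \<xi> \<zeta>)) \<le> (LINT \<zeta>|lborel. majorant s (R s x - \<xi>) * (majorant t (R t \<xi> - \<zeta>) * norm (v \<zeta>)))"
        by (intro integral_mono integrable_norm 1 2 F_le)
      with 2 show ?case by (simp add: U_def)
    qed
    have "integrable (lborel \<Otimes>\<^sub>M lborel) (case_prod F)"
    proof (rule lborel_pair.Fubini_integrable)
      show "integrable lborel (\<lambda>\<xi>. LINT \<zeta>|lborel. norm (case_prod F (\<xi>, \<zeta>)))"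
      proof (rule Bochner_Integration.integrable_bound[OF elim])
        show "AE \<xi> in lborel. norm (LINT \<zeta>|lborel. norm (case_prod F (\<xi>, \<zeta>))) \<le> norm (majorant s (R s x - \<xi>) * U \<xi>)"
          using ae by eventually_elim (auto intro: order_trans[OF _ abs_ge_self] simp: integral_nonneg_AE)
      qed measurable
      show "AE \<xi> in lborel. integrable lborel (\<lambda>\<zeta>. case_prod F (\<xi>, \<zeta>))"
        using ae by eventually_elim simp
    qed measurable
    then have "(LINT \<zeta>|lborel. LINT \<xi>|lborel. F \<xi> \<zeta>) = (LINT \<xi>|lborel. LINT \<zeta>|lborel. F \<xi> \<zeta>)"
      by (rule lborel_pair.Fubini_integral)
    moreover have "(LINT \<xi>|lborel. F \<xi> \<zeta>) = act (\<kappa> (s + t) (R (s + t) x - \<zeta>)) (v \<zeta>)" for \<zeta>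
      unfolding F_def by (rule kernel_convolution[OF s t])
    moreover have "(LINT \<xi>|lborel. LINT \<zeta>|lborel. F \<xi> \<zeta>) = (LINT \<xi>|lborel. act (\<kappa> s (R s x - \<xi>)) (T t v \<xi>))"
    proof (rule integral_cong_AE)
      show "AE \<xi> in lborel. (LINT \<zeta>|lborel. F \<xi> \<zeta>) = act (\<kappa> s (R s x - \<xi>)) (T t v \<xi>)"
        using kernel_integrable_AE[OF t v int]
        by eventually_elim (simp add: F_def T_def integral_bounded_linear[OF act.bounded_linear_right])
      note [measurable] = T_measurable[OF t v]
      show "(\<lambda>\<xi>. act (\<kappa> s (R s x - \<xi>)) (T t v \<xi>)) \<in> borel_measurable lborel" by measurable
    qed measurable
    ultimately show ?case
      by (simp add: T_def)
  qed
qed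

section \<open>Strong continuity on continuous functions of compact support\<close>

context
  fixes w :: "'a \<Rightarrow> 'b" and W r :: real
  assumes w: "continuous_on UNIV w" and W: "\<And>x. norm (w x) \<le> W" and r: "\<forall>x. norm x \<ge> r \<longrightarrow> w x = 0"
begin

lemma compactly_supported_measurable: "w \<in> borel_measurable borel"
  by (rule borel_measurable_continuous_onI[OF w])

lemma bound_nonneg: "W \<ge> 0"
  using order_trans[OF norm_ge_zero W] .

lemma kernel_times_bounded_integrable:
  assumes t: "t > 0" and [measurable]: "f \<in> borel_measurable borel" and f: "\<And>y. norm (f y) \<le> L"
  shows "integrable lborel (\<lambda>y. act (\<kappa> t y) (f y))"
proof (rule Bochner_Integration.integrable_bound[OF integrable_mult_left[OF majorant_integrable[OF t], of L]])
  note [measurable] = kernel_measurable[OF t]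
  show "(\<lambda>y. act (\<kappa> t y) (f y)) \<in> borel_measurable lborel" by measurable
  show "AE y in lborel. norm (act (\<kappa> t y) (f y)) \<le> norm (majorant t y * L)"
    using order_trans[OF norm_act_le[OF t] mult_left_mono[OF f majorant_nonneg[OF t]]]
    by (auto intro: order_trans[OF _ abs_ge_self])
qed

lemma T_eq_convolution:
  assumes t: "t > 0"
  shows "T t w x = (LINT y|lborel. act (\<kappa> t y) (w (R t x - y)))"
proof -
  note [measurable] = kernel_measurable[OF t] compactly_supported_measurable
  have "(LINT y|lborel. act (\<kappa> t y) (w (R t x - y))) = (LINT \<xi>|lborel. act (\<kappa> t (R t x - \<xi>)) (w (R t x - (R t x - \<xi>))))"
    by (rule integral_lborel_reflect[symmetric]) measurable
  then show ?thesis by (simp add: T_def)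
qed

lemma norm_kernel_integral_le:
  assumes t: "t > 0" and [measurable]: "f \<in> borel_measurable borel" and f: "\<And>y. norm (f y) \<le> L"
  shows "norm (LINT y|lborel. act (\<kappa> t y) (f y))
    \<le> (LINT z|lborel. M * exp (\<beta> * t) * exp (- (c * (norm z)\<^sup>2)) * norm (f (sqrt t *\<^sub>R z)))"
proof -
  have "norm (LINT y|lborel. act (\<kappa> t y) (f y)) \<le> (LINT y|lborel. majorant t y * norm (f y))"
  proof (rule Bochner_Integration.integral_norm_bound_integral[OF kernel_times_bounded_integrable[OF t _ f] _ norm_act_le[OF t]])
    show "integrable lborel (\<lambda>y. majorant t y * norm (f y))"
      by (rule Bochner_Integration.integrable_bound[OF integrable_mult_left[OF majorant_integrable[OF t], of L]])
         (use majorant_nonneg[OF t] in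
           \<open>auto simp: abs_mult intro!: always_eventually mult_left_mono order_trans[OF f abs_ge_self]\<close>)
  qed simp
  also have "\<dots> = (LINT z|lborel. M * exp (\<beta> * t) * exp (- (c * (norm z)\<^sup>2)) * norm (f (sqrt t *\<^sub>R z)))"
    by (rule integral_majorant_scale[OF t]) measurable
  finally show ?thesis .
qed

text \<open>An approximate-identity argument with two errors. D t bounds the oscillation of w near
  x; after scaling it involves w (R t x - sqrt t z) - w x, which tends to 0 for each fixed z. The
  other error comes from the mass of the kernel differing from e.\<close>

lemma T_pointwise_tendsto: "((\<lambda>t. T t w x) \<longlongrightarrow> w x) (at_right 0)"
proof -
  note [measurable] = compactly_supported_measurable
  define D where "D t = (LINT z|lborel. M * exp (\<beta> * t) * exp (- (c * (norm z)\<^sup>2))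
      * norm (w (R t x - sqrt t *\<^sub>R z) - w x))" for t
  have "(D \<longlongrightarrow> (LINT z|(lborel::'a measure). 0)) (at_right 0)"
    unfolding D_def
  proof (rule dominated_convergence_at_right_0)
    show "integrable lborel (\<lambda>z::'a. M * exp \<beta> * exp (- (c * (norm z)\<^sup>2)) * (2 * W))"
      by (intro integrable_mult_left integrable_mult_right integrable_gaussian c)
    show "AE z in lborel. norm (M * exp (\<beta> * t) * exp (- (c * (norm z)\<^sup>2)) * norm (w (R t x - sqrt t *\<^sub>R z) - w x))
        \<le> M * exp \<beta> * exp (- (c * (norm z)\<^sup>2)) * (2 * W)" if "0 < t" "t \<le> 1" for t
    proof (intro always_eventually allI)
      fix z
      have "\<beta> * t \<le> \<beta>" using that \<beta> by (simp add: mult_left_le)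
      moreover have "norm (w (R t x - sqrt t *\<^sub>R z) - w x) \<le> 2 * W"
        unfolding mult_2 by (intro order_trans[OF norm_triangle_ineq4 add_mono] W)
      ultimately have "M * exp (\<beta> * t) * exp (- (c * (norm z)\<^sup>2)) * norm (w (R t x - sqrt t *\<^sub>R z) - w x)
          \<le> M * exp \<beta> * exp (- (c * (norm z)\<^sup>2)) * (2 * W)"
        using M by (intro mult_mono) auto
      then show "norm (M * exp (\<beta> * t) * exp (- (c * (norm z)\<^sup>2)) * norm (w (R t x - sqrt t *\<^sub>R z) - w x))
          \<le> M * exp \<beta> * exp (- (c * (norm z)\<^sup>2)) * (2 * W)"
        using M by (simp add: abs_mult)
    qed
    show "AE z in lborel. ((\<lambda>t. M * exp (\<beta> * t) * exp (- (c * (norm z)\<^sup>2))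
        * norm (w (R t x - sqrt t *\<^sub>R z) - w x)) \<longlongrightarrow> 0) (at_right 0)"
    proof (intro always_eventually allI)
      fix z :: 'a
      have "((\<lambda>t. R t x - sqrt t *\<^sub>R z) \<longlongrightarrow> x - sqrt 0 *\<^sub>R z) (at_right 0)"
        by (intro tendsto_intros R_tendsto)
      then have "((\<lambda>t. w (R t x - sqrt t *\<^sub>R z)) \<longlongrightarrow> w x) (at_right 0)"
        using w by (intro isCont_tendsto_compose[of x w]) (auto simp: continuous_on_eq_continuous_at)
      then have "((\<lambda>t. M * exp (\<beta> * t) * exp (- (c * (norm z)\<^sup>2)) * norm (w (R t x - sqrt t *\<^sub>R z) - w x))
          \<longlongrightarrow> M * exp (\<beta> * 0) * exp (- (c * (norm z)\<^sup>2)) * norm (w x - w x)) (at_right 0)"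
        by (intro tendsto_intros)
      then show "((\<lambda>t. M * exp (\<beta> * t) * exp (- (c * (norm z)\<^sup>2)) * norm (w (R t x - sqrt t *\<^sub>R z) - w x))
          \<longlongrightarrow> 0) (at_right 0)" by simp
    qed
  qed measurable
  then have D: "(D \<longlongrightarrow> 0) (at_right 0)" by simp
  have "((\<lambda>t. norm (act ((LINT y|lborel. \<kappa> t y) - e) (w x))) \<longlongrightarrow> norm (act (e - e) (w x))) (at_right 0)"
    by (intro tendsto_intros act.tendsto kernel_tendsto)
  from tendsto_add[OF D this]
  have lim: "((\<lambda>t. D t + norm (act ((LINT y|lborel. \<kappa> t y) - e) (w x))) \<longlongrightarrow> 0) (at_right 0)"
    by (simp add: act.zero_left)
  have "\<forall>\<^sub>F t in at_right 0. norm (T t w x - w x) \<le> D t + norm (act ((LINT y|lborel. \<kappa> t y) - e) (w x))"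
    unfolding eventually_at_filter
  proof (intro always_eventually allI impI)
    fix t :: real assume "t \<noteq> 0" "t \<in> {0<..}"
    then have t: "t > 0" by simp
    have int1: "integrable lborel (\<lambda>y. act (\<kappa> t y) (w (R t x - y)))"
      by (rule kernel_times_bounded_integrable[OF t _ W]) measurable
    have int2: "integrable lborel (\<lambda>y. act (\<kappa> t y) (w x))"
      by (rule kernel_times_bounded_integrable[OF t _ W]) measurable
    have "(LINT y|lborel. act (\<kappa> t y) (w x)) = act (LINT y|lborel. \<kappa> t y) (w x)"
      by (rule integral_bounded_linear[OF act.bounded_linear_left kernel_integrable[OF t]])
    then have "T t w x - w x = (LINT y|lborel. act (\<kappa> t y) (w (R t x - y) - w x))
        + act ((LINT y|lborel. \<kappa> t y) - e) (w x)"
      using int1 int2 by (simp add: T_eq_convolution[OF t] act.diff_left act.diff_right act_e)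
    also have "norm \<dots> \<le> norm (LINT y|lborel. act (\<kappa> t y) (w (R t x - y) - w x))
        + norm (act ((LINT y|lborel. \<kappa> t y) - e) (w x))"
      by (rule norm_triangle_ineq)
    also have "norm (LINT y|lborel. act (\<kappa> t y) (w (R t x - y) - w x)) \<le> D t"
      unfolding D_def
    proof (rule norm_kernel_integral_le[OF t])
      show "norm (w (R t x - y) - w x) \<le> W + W" for y
        by (intro order_trans[OF norm_triangle_ineq4 add_mono] W)
    qed measurable
    finally show "norm (T t w x - w x) \<le> D t + norm (act ((LINT y|lborel. \<kappa> t y) - e) (w x))"
      by simp
  qed
  then have "((\<lambda>t. T t w x - w x) \<longlongrightarrow> 0) (at_right 0)"
    by (rule Lim_null_comparison[OF _ lim])
  then show ?thesis by (rule LIM_zero_cancel)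
qed

text \<open>If w does not vanish at x' - s z, then |x| <= r + |z|, hence |x|^2 <= 2 r^2 + 2 |z|^2
  and the exponential is at least 1. Compact support is traded for decay in x that survives the
  integration over z.\<close>

lemma bounded_le_gaussian:
  assumes \<delta>: "\<delta> \<ge> 0" and "norm x = norm x'" "0 \<le> s" "s \<le> 1"
  shows "norm (w (x' - s *\<^sub>R z)) \<le> W * exp (\<delta> * (2 * r\<^sup>2 + 2 * (norm z)\<^sup>2 - (norm x)\<^sup>2))"
proof (cases "norm (x' - s *\<^sub>R z) \<ge> r")
  case True
  then show ?thesis using r bound_nonneg by simp
next
  case False
  have "norm x \<le> norm (x' - s *\<^sub>R z) + norm (s *\<^sub>R z)"
    using norm_triangle_ineq[of "x' - s *\<^sub>R z" "s *\<^sub>R z"] assms(2) by simp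
  also have "\<dots> \<le> r + norm z"
    using False assms by (intro add_mono) (auto intro: mult_left_le_one_le)
  finally have "(norm x)\<^sup>2 \<le> (r + norm z)\<^sup>2"
    by (intro power_mono) auto
  also have "\<dots> \<le> 2 * r\<^sup>2 + 2 * (norm z)\<^sup>2"
    using sum_squares_bound[of r "norm z"] by (simp add: power2_sum)
  finally have "1 \<le> exp (\<delta> * (2 * r\<^sup>2 + 2 * (norm z)\<^sup>2 - (norm x)\<^sup>2))"
    using \<delta> by simp
  then show ?thesis
    using mult_mono[OF W[of "x' - s *\<^sub>R z"], of 1 "exp (\<delta> * (2 * r\<^sup>2 + 2 * (norm z)\<^sup>2 - (norm x)\<^sup>2))"] bound_nonneg
    by simp
qed

lemma T_le_gaussian:
  obtains D where "D \<ge> 0"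
    "\<And>t x. 0 < t \<Longrightarrow> t \<le> 1 \<Longrightarrow> norm (T t w x - w x) \<le> D * exp (- (c / 4 * (norm x)\<^sup>2))"
proof -
  note [measurable] = compactly_supported_measurable
  \<comment> \<open>\<open>bounded_le_gaussian\<close> is used with \<delta> = c/4. Its growth c/2
    |z|^2 consumes half of the kernel's decay c |z|^2, the other half keeps the z-integral finite,
    and exp (-(c/4) |x|^2) remains. D1 controls \<open>T t w\<close> and D2 controls w
    itself.\<close>
  define D1 where "D1 = M * exp \<beta> * (W * exp (c / 2 * r\<^sup>2)) * (LINT z|lborel. exp (- (c / 2 * (norm (z::'a))\<^sup>2)))"
  define D2 where "D2 = W * exp (c / 2 * r\<^sup>2)"
  have "D1 \<ge> 0" "D2 \<ge> 0"
    unfolding D1_def D2_def using M bound_nonneg by (auto intro!: mult_nonneg_nonneg integral_nonneg_AE)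
  moreover have "norm (T t w x - w x) \<le> (D1 + D2) * exp (- (c / 4 * (norm x)\<^sup>2))" if t: "0 < t" "t \<le> 1" for t x
  proof -
    have "norm (T t w x) \<le> (LINT z|lborel. M * exp (\<beta> * t) * exp (- (c * (norm z)\<^sup>2)) * norm (w (R t x - sqrt t *\<^sub>R z)))"
      unfolding T_eq_convolution[OF t(1)] by (rule norm_kernel_integral_le[OF t(1) _ W]) measurable
    also have "\<dots> \<le> (LINT z|lborel. (M * exp \<beta> * (W * exp (c / 2 * r\<^sup>2)) * exp (- (c / 4 * (norm x)\<^sup>2)))
        * exp (- (c / 2 * (norm (z::'a))\<^sup>2)))"
    proof (rule integral_mono_AE')
      show "AE z in lborel. M * exp (\<beta> * t) * exp (- (c * (norm z)\<^sup>2)) * norm (w (R t x - sqrt t *\<^sub>R z))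
          \<le> (M * exp \<beta> * (W * exp (c / 2 * r\<^sup>2)) * exp (- (c / 4 * (norm x)\<^sup>2))) * exp (- (c / 2 * (norm z)\<^sup>2))"
      proof (intro always_eventually allI)
        fix z :: 'a
        have "\<beta> * t \<le> \<beta>" using t \<beta> by (simp add: mult_left_le)
        moreover have "norm (w (R t x - sqrt t *\<^sub>R z)) \<le> W * exp (c / 4 * (2 * r\<^sup>2 + 2 * (norm z)\<^sup>2 - (norm x)\<^sup>2))"
          using c t by (intro bounded_le_gaussian) (auto simp: norm_R)
        ultimately have "M * exp (\<beta> * t) * exp (- (c * (norm z)\<^sup>2)) * norm (w (R t x - sqrt t *\<^sub>R z))
            \<le> M * exp \<beta> * exp (- (c * (norm z)\<^sup>2)) * (W * exp (c / 4 * (2 * r\<^sup>2 + 2 * (norm z)\<^sup>2 - (norm x)\<^sup>2)))"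
          using M by (intro mult_mono) auto
        also have "\<dots> = M * exp \<beta> * W * exp (- (c * (norm z)\<^sup>2) + c / 4 * (2 * r\<^sup>2 + 2 * (norm z)\<^sup>2 - (norm x)\<^sup>2))"
          by (simp only: exp_add mult_ac)
        also have "- (c * (norm z)\<^sup>2) + c / 4 * (2 * r\<^sup>2 + 2 * (norm z)\<^sup>2 - (norm x)\<^sup>2)
            = c / 2 * r\<^sup>2 + (- (c / 4 * (norm x)\<^sup>2) + - (c / 2 * (norm z)\<^sup>2))"
          by (simp add: algebra_simps)
        finally show "M * exp (\<beta> * t) * exp (- (c * (norm z)\<^sup>2)) * norm (w (R t x - sqrt t *\<^sub>R z))
          \<le> (M * exp \<beta> * (W * exp (c / 2 * r\<^sup>2)) * exp (- (c / 4 * (norm x)\<^sup>2))) * exp (- (c / 2 * (norm z)\<^sup>2))"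
          unfolding exp_add by (simp only: mult.assoc)
      qed
      show "integrable lborel (\<lambda>z::'a. (M * exp \<beta> * (W * exp (c / 2 * r\<^sup>2)) * exp (- (c / 4 * (norm x)\<^sup>2)))
          * exp (- (c / 2 * (norm z)\<^sup>2)))"
        using c by (intro integrable_mult_right integrable_gaussian) simp
    qed (use M bound_nonneg in auto)
    also have "\<dots> = D1 * exp (- (c / 4 * (norm x)\<^sup>2))"
      unfolding D1_def by (simp add: mult_ac)
    finally have 1: "norm (T t w x) \<le> D1 * exp (- (c / 4 * (norm x)\<^sup>2))" .
    have "norm (w x) \<le> W * exp (c / 4 * (2 * r\<^sup>2 - (norm x)\<^sup>2))"
      using bounded_le_gaussian[of "c / 4" x x 0 0] c by simp
    also have "\<dots> = D2 * exp (- (c / 4 * (norm x)\<^sup>2))"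
      unfolding D2_def by (simp add: mult.assoc algebra_simps flip: exp_add)
    finally have 2: "norm (w x) \<le> D2 * exp (- (c / 4 * (norm x)\<^sup>2))" .
    show ?thesis
      unfolding distrib_right by (rule order_trans[OF norm_triangle_ineq4 add_mono[OF 1 2]])
  qed
  ultimately show ?thesis
    using that[of "D1 + D2"] by simp
qed

lemma weight_le_exp: "\<theta> x \<le> C * \<theta> 0 * exp (\<eta> * norm x)"
  using growth[of 0 x] by simp

text \<open>The Gaussian bound on T t w - w outweighs the exponential growth of \<theta>, so one
  integrable function dominates the p-th powers for all t in (0, 1].\<close>

lemma T_strongly_continuous_compactly_supported:
  "((\<lambda>t. LINT x|lborel. (\<theta> x * norm (w x - T t w x)) powr p) \<longlongrightarrow> 0) (at_right 0)"
  "0 < t \<Longrightarrow> t \<le> 1 \<Longrightarrow> integrable lborel (\<lambda>x. (\<theta> x * norm (w x - T t w x)) powr p)"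
proof -
  note [measurable] = compactly_supported_measurable
  obtain D where D: "D \<ge> 0"
    "\<And>t x. 0 < t \<Longrightarrow> t \<le> 1 \<Longrightarrow> norm (T t w x - w x) \<le> D * exp (- (c / 4 * (norm x)\<^sup>2))"
    using T_le_gaussian by blast
  let ?B = "\<lambda>x::'a. (C * \<theta> 0 * D) powr p * (exp (- (c / 4 * p * (norm x)\<^sup>2)) * exp (\<eta> * p * norm x))"
  have B: "integrable lborel ?B"
    using c p by (intro integrable_mult_right integrable_gaussian_times_exp) simp
  have bound: "(\<theta> x * norm (w x - T t w x)) powr p \<le> ?B x" if "0 < t" "t \<le> 1" for t x
  proof -
    have "\<theta> x * norm (w x - T t w x) \<le> (C * \<theta> 0 * exp (\<eta> * norm x)) * (D * exp (- (c / 4 * (norm x)\<^sup>2)))"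
      using weight_le_exp[of x] D(2)[OF that, of x] pos[of 0] C
      by (intro mult_mono) (auto simp: norm_minus_commute)
    then have "(\<theta> x * norm (w x - T t w x)) powr p
        \<le> ((C * \<theta> 0 * D) * (exp (- (c / 4 * (norm x)\<^sup>2)) * exp (\<eta> * norm x))) powr p"
      using p pos[of x] by (intro powr_mono2) (simp_all add: mult_ac)
    also have "\<dots> = ?B x"
      using C pos[of 0] D(1) by (simp add: powr_mult exp_powr_real mult_ac)
    finally show ?thesis .
  qed
  have meas: "(\<lambda>x. (\<theta> x * norm (w x - T t w x)) powr p) \<in> borel_measurable lborel" if "t > 0" for t
  proof -
    note [measurable] = T_measurable[OF that compactly_supported_measurable]
    show ?thesis by measurable
  qed
  show "integrable lborel (\<lambda>x. (\<theta> x * norm (w x - T t w x)) powr p)" if "0 < t" "t \<le> 1"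
    by (rule Bochner_Integration.integrable_bound[OF B])
       (use bound that meas in \<open>auto intro: order_trans[OF _ abs_ge_self]\<close>)
  have "((\<lambda>t. LINT x|lborel. (\<theta> x * norm (w x - T t w x)) powr p) \<longlongrightarrow> (LINT x|(lborel::'a measure). 0)) (at_right 0)"
    by (rule dominated_convergence_at_right_0[OF _ _ B])
       (use meas bound tendsto_weighted_diff[OF T_pointwise_tendsto] in auto)
  then show "((\<lambda>t. LINT x|lborel. (\<theta> x * norm (w x - T t w x)) powr p) \<longlongrightarrow> 0) (at_right 0)"
    by simp
qed

end

text \<open>Splits T t v - v into T t (v - w), T t w - w and w - v, with w continuous of compact
  support close to v; the first term is controlled uniformly in t <= 1.\<close>

lemma T_strongly_continuous:
  assumes v [measurable]: "v \<in> borel_measurable borel"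
    and int: "integrable lborel (\<lambda>x. (\<theta> x * norm (v x)) powr p)"
  shows "((\<lambda>t. LINT x|lborel. (\<theta> x * norm (T t v x - v x)) powr p) \<longlongrightarrow> 0) (at_right 0)"
proof (rule tendstoI)
  let ?N = "\<lambda>u :: 'a \<Rightarrow> 'b. LINT x|lborel. (\<theta> x * norm (u x)) powr p"
  fix \<epsilon> :: real assume \<epsilon>: "\<epsilon> > 0"
  obtain D where D: "\<And>t. 0 < t \<Longrightarrow> t \<le> 1 \<Longrightarrow> mass t \<le> D" "D \<ge> 0"
    using mass_bounded by blast
  define K where "K = C powr p * D powr p"
  \<comment> \<open>The total factor in front of the p-th power integral of v - w: the sum of three
    terms is split twice, so T t (v - w) receives 2^p K and w - v receives (2^p)^2.\<close>
  define A where "A = 2 powr p * K + (2 powr p)\<^sup>2"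
  have "K \<ge> 0" by (simp add: K_def)
  then have A: "A > 0" by (simp add: A_def add_nonneg_pos)
  have \<epsilon>': "\<epsilon> / (2 * A) > 0"
    using \<epsilon> A by simp
  obtain w r W where w: "continuous_on UNIV w" "\<And>x. norm (w x) \<le> W" "\<And>x. norm x \<ge> r \<Longrightarrow> w x = 0"
    and vw_int: "integrable lborel (\<lambda>x. (\<theta> x * norm (v x - w x)) powr p)"
    and vw: "?N (\<lambda>x. v x - w x) < \<epsilon> / (2 * A)"
    by (rule compact_support_dense[OF v int \<epsilon>']) (rule that; assumption)
  have [measurable]: "w \<in> borel_measurable borel"
    by (rule borel_measurable_continuous_onI[OF w(1)])
  have w0: "\<forall>x. norm x \<ge> r \<longrightarrow> w x = 0"
    using w(3) by blast
  note cs = T_strongly_continuous_compactly_supported[OF w(1,2) w0]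
  have wv_int: "integrable lborel (\<lambda>x. (\<theta> x * norm (w x - v x)) powr p)"
    using vw_int by (simp add: norm_minus_commute)
  have w_int: "integrable lborel (\<lambda>x. (\<theta> x * norm (w x)) powr p)"
    using integrable_powr_add(1)[OF _ _ wv_int int] by simp
  have "\<forall>\<^sub>F t in at_right 0. ?N (\<lambda>x. w x - T t w x) < \<epsilon> / (2 * (2 powr p)\<^sup>2)"
    using \<epsilon> by (intro order_tendstoD(2)[OF cs(1)] divide_pos_pos mult_pos_pos zero_less_power) auto
  moreover have "\<forall>\<^sub>F t::real in at_right 0. 0 < t \<and> t \<le> 1"
    by (auto simp: eventually_at_right_field intro!: exI[of _ 1])
  ultimately show "\<forall>\<^sub>F t in at_right 0. dist (?N (\<lambda>x. T t v x - v x)) 0 < \<epsilon>"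
  proof eventually_elim
    case (elim t)
    then have t: "0 < t" "t \<le> 1" by auto
    note [measurable] = T_measurable[OF t(1)]
    have "?N (\<lambda>x. T t (\<lambda>x. v x - w x) x) \<le> C powr p * mass t powr p * ?N (\<lambda>x. v x - w x)"
      by (rule T_bounded(2)[OF t(1) _ vw_int]) measurable
    also have "\<dots> \<le> K * ?N (\<lambda>x. v x - w x)"
      unfolding K_def using D(1)[OF t] mass_nonneg[OF t(1)] p
      by (intro mult_right_mono mult_left_mono powr_mono2) (auto intro: integral_nonneg_AE)
    finally have a: "?N (\<lambda>x. T t (\<lambda>x. v x - w x) x) \<le> K * ?N (\<lambda>x. v x - w x)" .
    have Tw: "integrable lborel (\<lambda>x. (\<theta> x * norm (T t w x - w x)) powr p)"
      "?N (\<lambda>x. T t w x - w x) = ?N (\<lambda>x. w x - T t w x)"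
      using cs(2)[OF t] by (simp_all add: norm_minus_commute)
    have b: "integrable lborel (\<lambda>x. (\<theta> x * norm ((T t w x - w x) + (w x - v x))) powr p)"
      "?N (\<lambda>x. (T t w x - w x) + (w x - v x)) \<le> 2 powr p * (?N (\<lambda>x. T t w x - w x) + ?N (\<lambda>x. w x - v x))"
      by (rule integrable_powr_add[OF _ _ Tw(1) wv_int]; measurable)+
    have Tvw: "integrable lborel (\<lambda>x. (\<theta> x * norm (T t (\<lambda>x. v x - w x) x)) powr p)"
      by (rule T_bounded(1)[OF t(1) _ vw_int]) measurable
    note d = integrable_powr_add[OF _ _ Tvw b(1)]
    have "AE x in lborel. T t (\<lambda>x. v x - w x) x = T t v x - T t w x"
      using T_add_scaled[OF t(1) v _ int w_int bounded_linear_ident _ bounded_linear_minus[OF bounded_linear_ident]]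
      by (simp add: act.minus_right)
    then have "?N (\<lambda>x. T t v x - v x) = ?N (\<lambda>x. T t (\<lambda>x. v x - w x) x + ((T t w x - w x) + (w x - v x)))"
      by (intro integral_cong_AE) (auto elim!: eventually_mono)
    also have "\<dots> \<le> 2 powr p * (?N (\<lambda>x. T t (\<lambda>x. v x - w x) x) + ?N (\<lambda>x. (T t w x - w x) + (w x - v x)))"
      by (rule d) measurable
    also have "\<dots> \<le> 2 powr p * (K * ?N (\<lambda>x. v x - w x)
        + 2 powr p * (?N (\<lambda>x. T t w x - w x) + ?N (\<lambda>x. w x - v x)))"
      by (intro mult_left_mono add_mono a b(2)) simp
    also have "\<dots> = A * ?N (\<lambda>x. v x - w x) + (2 powr p)\<^sup>2 * ?N (\<lambda>x. w x - T t w x)"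
      by (simp add: A_def Tw(2) norm_minus_commute[of "w _" "v _"] algebra_simps power2_eq_square)
    also have "\<dots> < \<epsilon> / 2 + \<epsilon> / 2"
      using vw elim(1) A by (intro add_strict_mono) (simp_all add: field_simps)
    finally have "?N (\<lambda>x. T t v x - v x) < \<epsilon>" by simp
    moreover have "?N (\<lambda>x. T t v x - v x) \<ge> 0"
      by (intro integral_nonneg_AE) auto
    ultimately show ?case by simp
  qed
qed

end

subsection \<open>The heat kernel in an eigenbasis\<close>

lemma
  fixes Y :: "'a::field^'n^'n"
  assumes "invertible Y"
  shows matrix_inv_left: "matrix_inv Y ** Y = mat 1" and matrix_inv_right: "Y ** matrix_inv Y = mat 1"
  using someI_ex[OF assms[unfolded invertible_def]] unfolding matrix_inv_def by auto

lemma matrix_inv_eqI: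
  fixes A X :: "'a::field^'n^'n"
  assumes "A ** X = mat 1"
  shows "matrix_inv A = X"
proof -
  have "X ** A = mat 1"
    using assms matrix_left_right_inverse by blast
  then have "invertible A"
    using assms by (auto simp: invertible_def)
  have "matrix_inv A = matrix_inv A ** (A ** X)"
    by (simp add: assms)
  then show ?thesis
    by (simp add: matrix_mul_assoc matrix_inv_left[OF \<open>invertible A\<close>])
qed

text \<open>The eigenvalues form a vector because the ring operations on that type are
  componentwise. For invertible Y, \<open>diag_in Y\<close> is then a unital ring homomorphism into
  the matrices, and the matrix functions of the kernel become componentwise functions.\<close>

definition diag_in :: "complex^'n^'n \<Rightarrow> complex^'n \<Rightarrow> complex^'n^'n" where
  "diag_in Y l = Y ** diag_mat (\<lambda>k. l $ k) ** matrix_inv Y"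

lemma diag_in_component: "diag_in Y l $ i $ j = (\<Sum>k\<in>UNIV. Y $ i $ k * l $ k * matrix_inv Y $ k $ j)"
  by (simp add: diag_in_def matrix_matrix_mult_def[of "Y ** diag_mat _"] diag_mat_mult_right)

lemma diag_in_scaleR: "r *\<^sub>R diag_in Y l = diag_in Y (r *\<^sub>R l)"
  by (simp add: vec_eq_iff diag_in_component scaleR_sum_right)

lemma diag_in_diff: "diag_in Y l - diag_in Y m = diag_in Y (l - m)"
  by (simp add: vec_eq_iff diag_in_component sum_subtractf algebra_simps)

lemma diag_in_minus: "- diag_in Y l = diag_in Y (- l)"
  by (simp add: vec_eq_iff diag_in_component sum_negf)

lemma diag_mat_mult: "diag_mat l ** diag_mat m = diag_mat (\<lambda>k. l k * (m k :: complex))"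
  by (simp add: vec_eq_iff diag_mat_mult_left) (simp add: diag_mat_def)

lemma diag_in_mult:
  assumes "invertible Y"
  shows "diag_in Y l ** diag_in Y m = diag_in Y (l * m)"
proof -
  have "diag_in Y l ** diag_in Y m
      = Y ** diag_mat (\<lambda>k. l $ k) ** (matrix_inv Y ** Y) ** diag_mat (\<lambda>k. m $ k) ** matrix_inv Y"
    by (simp only: diag_in_def matrix_mul_assoc)
  also have "\<dots> = Y ** (diag_mat (\<lambda>k. l $ k) ** diag_mat (\<lambda>k. m $ k)) ** matrix_inv Y"
    by (simp only: matrix_inv_left[OF assms] matrix_mul_rid matrix_mul_assoc)
  finally show ?thesis
    by (simp add: diag_mat_mult diag_in_def)
qed

lemma diag_in_one:
  fixes Y :: "complex^'n^'n"
  shows "invertible Y \<Longrightarrow> diag_in Y 1 = mat 1"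
proof -
  have "diag_mat (\<lambda>k. (1 :: complex^'n) $ k) = mat 1"
    by (simp add: diag_mat_def mat_def)
  then show "invertible Y \<Longrightarrow> diag_in Y 1 = mat 1"
    by (simp add: diag_in_def matrix_inv_right)
qed

lemma matrix_inv_diag_in:
  assumes "invertible Y" "\<And>k. l $ k \<noteq> 0"
  shows "matrix_inv (diag_in Y l) = diag_in Y (\<chi> k. 1 / l $ k)"
proof (rule matrix_inv_eqI)
  have "l * (\<chi> k. 1 / l $ k) = 1"
    using assms(2) by (simp add: vec_eq_iff)
  then show "diag_in Y l ** diag_in Y (\<chi> k. 1 / l $ k) = mat 1"
    by (simp add: diag_in_mult diag_in_one assms(1))
qed

lemma mat_pow_diag_in:
  assumes "invertible Y"
  shows "mat_pow (diag_in Y l) k = diag_in Y (\<chi> i. (l $ i) ^ k)"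
proof (induction k)
  case 0
  have "(\<chi> i. (l $ i) ^ 0) = 1"
    by (simp add: vec_eq_iff)
  then show ?case using diag_in_one[OF assms] by simp
next
  case (Suc k)
  then show ?case
    by (simp add: diag_in_mult[OF assms]) (simp add: times_vec_def)
qed

lemma mat_exp_diag_in:
  assumes "invertible Y"
  shows "mat_exp (diag_in Y l) = diag_in Y (\<chi> k. exp (l $ k))"
proof -
  have "(\<lambda>k. (inverse (fact k) *\<^sub>R mat_pow (diag_in Y l) k) $ i $ j) sums (diag_in Y (\<chi> k. exp (l $ k)) $ i $ j)" for i j
  proof -
    have "(\<lambda>k. \<Sum>h\<in>UNIV. Y $ i $ h * ((l $ h) ^ k /\<^sub>R fact k) * matrix_inv Y $ h $ j) sums
        (\<Sum>h\<in>UNIV. Y $ i $ h * exp (l $ h) * matrix_inv Y $ h $ j)"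
      by (intro sums_sum sums_mult sums_mult2 exp_converges)
    then show ?thesis
      by (simp add: mat_pow_diag_in[OF assms] diag_in_scaleR diag_in_component)
  qed
  then have "(\<lambda>k. inverse (fact k) *\<^sub>R mat_pow (diag_in Y l) k) sums diag_in Y (\<chi> k. exp (l $ k))"
    unfolding sums_def by (intro vec_tendstoI) (simp add: sum_component)
  then show ?thesis
    unfolding mat_exp_def by (rule sums_unique[symmetric])
qed

lemma mat_powr_diag_in:
  assumes "invertible Y"
  shows "mat_powr (diag_in Y l) r = diag_in Y (\<chi> k. exp (complex_of_real r * Ln (l $ k)))"
  unfolding mat_powr_def using mat_fun_diag[OF assms diag_in_def] by (simp add: diag_in_def)

text \<open>The k-th column of Y is an eigenvector. This carries the hypothesis on the spectrum of A
  over to every diagonal entry.\<close>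

lemma mat_eigenvalue_diag_in:
  assumes "invertible Y"
  shows "mat_eigenvalue (diag_in Y l) (l $ k)"
  unfolding mat_eigenvalue_def
proof (intro exI conjI)
  have inv: "matrix_inv Y *v (Y *v v) = v" for v
    by (simp add: matrix_vector_mul_assoc matrix_inv_left[OF assms])
  show "Y *v axis k 1 \<noteq> 0"
  proof
    assume "Y *v axis k 1 = 0"
    then have "matrix_inv Y *v (Y *v axis k 1) = 0" by simp
    then show False by (simp add: inv axis_eq_0_iff)
  qed
  have "diag_mat (\<lambda>k. l $ k) *v axis k 1 = l $ k *s axis k 1"
    by (simp add: vec_eq_iff diag_mat_def matrix_vector_mult_def axis_def if_distrib[where f = "\<lambda>z. _ * z"] cong: if_cong)
  then have "diag_in Y l *v (Y *v axis k 1) = Y *v (l $ k *s axis k 1)"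
    unfolding diag_in_def by (simp add: matrix_vector_mul_assoc[symmetric] inv)
  then show "diag_in Y l *v (Y *v axis k 1) = l $ k *s (Y *v axis k 1)"
    by (simp add: vector_scalar_commute)
qed

section \<open>The heat kernel in eigenvalue coordinates\<close>

definition diag_act :: "complex^'n^'n \<Rightarrow> complex^'n \<Rightarrow> complex^'n \<Rightarrow> complex^'n" where
  "diag_act Y l v = diag_in Y l *v v"

definition diag_kernel :: "complex^'n \<Rightarrow> complex^'n \<Rightarrow> real \<Rightarrow> real^'d \<Rightarrow> complex^'n" where
  "diag_kernel a b t y = (\<chi> k. exp (- (of_real t * b $ k)) * gauss_kernel (a $ k) t y)"

text \<open>The power, the exponential and the inverse are all evaluated in the same basis Y, so the
  kernel reduces to one scalar Gaussian per eigenvalue pair.\<close>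

lemma heat_kernel_diag:
  fixes a b :: "complex^'n" and S :: "real^'d^'d"
  assumes Y: "invertible Y" and a: "\<And>k. Re (a $ k) > 0" and t: "t > 0"
  shows "heat_kernel (diag_in Y a) (diag_in Y b) S x \<xi> t *v v
      = diag_act Y (diag_kernel a b t (mat_exp (t *\<^sub>R S) *v x - \<xi>)) v"
proof -
  define n2 where "n2 = (norm (mat_exp (t *\<^sub>R S) *v x - \<xi>))\<^sup>2"
  have nz: "((4 * t) *\<^sub>R a) $ k \<noteq> 0" for k
    using t a[of k] by auto
  have "heat_kernel (diag_in Y a) (diag_in Y b) S x \<xi> t
    = diag_in Y ((\<chi> k. exp (complex_of_real (- (real CARD('d) / 2)) * Ln (((4 * pi * t) *\<^sub>R a) $ k)))
        * (\<chi> k. exp ((- (t *\<^sub>R b) - n2 *\<^sub>R (\<chi> k. 1 / ((4 * t) *\<^sub>R a) $ k)) $ k)))"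
    unfolding heat_kernel_def n2_def[symmetric] diag_in_scaleR matrix_inv_diag_in[OF Y nz] diag_in_minus
      diag_in_diff mat_exp_diag_in[OF Y] mat_powr_diag_in[OF Y] diag_in_mult[OF Y] ..
  also have "\<dots> = diag_in Y (diag_kernel a b t (mat_exp (t *\<^sub>R S) *v x - \<xi>))"
  proof (rule arg_cong[of _ _ "diag_in Y"], unfold vec_eq_iff, rule allI)
    fix k
    have "exp (complex_of_real (- (real CARD('d) / 2)) * Ln (((4 * pi * t) *\<^sub>R a) $ k))
        * exp ((- (t *\<^sub>R b) - n2 *\<^sub>R (\<chi> k. 1 / ((4 * t) *\<^sub>R a) $ k)) $ k)
      = exp (- (of_nat CARD('d) / 2 * Ln (of_real (4 * pi * t) * a $ k)) + (- (of_real t * b $ k)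
          + - (1 / (of_real (4 * t) * a $ k) * of_real n2)))"
      unfolding exp_add[symmetric] by (rule arg_cong[where f = exp]) (simp, simp add: scaleR_conv_of_real)
    then show "((\<chi> k. exp (complex_of_real (- (real CARD('d) / 2)) * Ln (((4 * pi * t) *\<^sub>R a) $ k)))
        * (\<chi> k. exp ((- (t *\<^sub>R b) - n2 *\<^sub>R (\<chi> k. 1 / ((4 * t) *\<^sub>R a) $ k)) $ k))) $ k
      = diag_kernel a b t (mat_exp (t *\<^sub>R S) *v x - \<xi>) $ k"
      by (simp only: vector_mult_component vec_lambda_beta diag_kernel_def gauss_kernel_def n2_def exp_add
          DIM_cart DIM_real mult_1_right mult_1_left mult_ac)
  qed
  finally show ?thesis
    by (simp add: diag_act_def)
qed

lemma bounded_bilinear_diag_act: "bounded_bilinear (diag_act Y)"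
proof -
  have "diag_act Y (l + m) v = diag_act Y l v + diag_act Y m v"
    "diag_act Y (r *\<^sub>R l) v = r *\<^sub>R diag_act Y l v"
    "diag_act Y l (u + v) = diag_act Y l u + diag_act Y l v"
    "diag_act Y l (r *\<^sub>R v) = r *\<^sub>R diag_act Y l v" for l m u v r
    by (simp_all add: diag_act_def vec_eq_iff matrix_vector_mult_def diag_in_component
        sum_distrib_right sum_distrib_left scaleR_sum_right algebra_simps sum.distrib)
  then show ?thesis
    by (simp add: bilinear_conv_bounded_bilinear[symmetric] bilinear_def linear_iff)
qed

lemma diag_act_mult: "invertible Y \<Longrightarrow> diag_act Y l (diag_act Y m v) = diag_act Y (l * m) v"
  by (simp add: diag_act_def matrix_vector_mul_assoc diag_in_mult)

lemma diag_act_one: "invertible Y \<Longrightarrow> diag_act Y 1 v = v"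
  by (simp add: diag_act_def diag_in_one)

lemma diag_act_scale: "diag_act Y l (z *s v) = z *s diag_act Y l v"
  by (simp add: diag_act_def vector_scalar_commute)

lemma vec_sum_axis: "(\<chi> k. f k) = (\<Sum>k\<in>UNIV. axis k (f k))"
  by (simp add: vec_eq_iff axis_def if_distrib[where f = "\<lambda>x. x $ _"] cong: if_cong)

lemma
  fixes f :: "'x \<Rightarrow> complex^'n"
  assumes "\<And>k. integrable M (\<lambda>x. f x $ k)"
  shows integrable_vec: "integrable M f"
    and integral_vec_component: "(LINT x|M. f x) $ k = (LINT x|M. f x $ k)"
proof -
  have "bounded_linear (axis k :: complex \<Rightarrow> complex^'n)" for k
    by (auto simp: linear_conv_bounded_linear[symmetric] linear_iff vec_eq_iff axis_def)
  then have "integrable M (\<lambda>x. \<Sum>k\<in>UNIV. axis k (f x $ k))"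
    by (intro Bochner_Integration.integrable_sum integrable_bounded_linear[of "axis _"] assms)
  then show f: "integrable M f"
    by (simp flip: vec_sum_axis)
  show "(LINT x|M. f x) $ k = (LINT x|M. f x $ k)"
    by (rule integral_bounded_linear[OF bounded_linear_vec_nth f, symmetric])
qed

lemma diag_kernel_component: "diag_kernel a b t y $ k = exp (- (of_real t * b $ k)) * gauss_kernel (a $ k) t y"
  by (simp add: diag_kernel_def)

lemma
  fixes a b :: "complex^'n"
  assumes a: "\<And>k. Re (a $ k) > 0" and t: "t > 0"
  shows diag_kernel_integrable: "integrable lborel (diag_kernel a b t :: real^'d \<Rightarrow> complex^'n)"
    and diag_kernel_integral: "(LINT y|lborel. diag_kernel a b t (y :: real^'d)) = (\<chi> k. exp (- (of_real t * b $ k)))"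
proof -
  have comp: "integrable lborel (\<lambda>y::real^'d. diag_kernel a b t y $ k)" for k
    unfolding diag_kernel_component by (intro integrable_mult_right gauss_kernel_integrable a t)
  then show "integrable lborel (diag_kernel a b t :: real^'d \<Rightarrow> complex^'n)"
    by (rule integrable_vec)
  show "(LINT y|lborel. diag_kernel a b t (y :: real^'d)) = (\<chi> k. exp (- (of_real t * b $ k)))"
    by (simp add: vec_eq_iff integral_vec_component[OF comp])
       (simp add: diag_kernel_component gauss_kernel_integral[OF a t])
qed

lemma diag_kernel_tendsto:
  fixes a b :: "complex^'n"
  assumes a: "\<And>k. Re (a $ k) > 0"
  shows "((\<lambda>t. LINT y|lborel. diag_kernel a b t (y :: real^'d)) \<longlongrightarrow> 1) (at_right 0)"
proof (rule Lim_transform_eventually)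
  have "((\<lambda>t. exp (- (complex_of_real t * b $ k))) \<longlongrightarrow> exp (- (complex_of_real 0 * b $ k))) (at_right 0)" for k
    by (intro tendsto_intros)
  then show "((\<lambda>t. \<chi> k. exp (- (complex_of_real t * b $ k))) \<longlongrightarrow> 1) (at_right 0)"
    by (intro vec_tendstoI) simp
  show "\<forall>\<^sub>F t in at_right 0. (\<chi> k. exp (- (complex_of_real t * b $ k))) = (LINT y|lborel. diag_kernel a b t (y :: real^'d))"
    unfolding eventually_at_filter by (intro always_eventually) (simp add: diag_kernel_integral[OF a])
qed

lemma diag_kernel_bound:
  fixes a b :: "complex^'n"
  assumes a: "\<And>k. Re (a $ k) > 0"
  obtains m \<beta> c where "m \<ge> 0" "\<beta> \<ge> 0" "c > 0"
    "\<And>t y. t > 0 \<Longrightarrow> norm (diag_kernel a b t (y :: real^'d))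
      \<le> m * exp (\<beta> * t) * (1 / sqrt t) ^ CARD('d) * exp (- (c / t * (norm y)\<^sup>2))"
proof -
  \<comment> \<open>The sum of the scalar prefactors at t = 1. Next, \<beta> dominates every -Re
    (b_k), and c is the slowest decay rate, positive as a minimum of finitely many positive
    numbers.\<close>
  define m where "m = (\<Sum>k\<in>UNIV. sqrt (1 / (4 * pi * norm (a $ k))) ^ CARD('d))"
  define \<beta> where "\<beta> = (\<Sum>k\<in>UNIV. norm (b $ k))"
  define c where "c = Min (range (\<lambda>k. Re (1 / a $ k) / 4))"
  have Re_pos: "Re (1 / a $ k) > 0" for k
    using Re_inverse_scaled_pos[OF a, of "1/4" k] by simp
  have c_le: "c \<le> Re (1 / a $ k) / 4" for k
    unfolding c_def by (rule Min_le) auto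
  have c0: "c > 0"
    unfolding c_def using Re_pos by (subst Min_gr_iff) auto
  have m\<beta>: "m \<ge> 0" "\<beta> \<ge> 0"
    unfolding \<beta>_def m_def by (auto intro!: sum_nonneg)
  have bound: "norm (diag_kernel a b t y)
      \<le> m * exp (\<beta> * t) * (1 / sqrt t) ^ CARD('d) * exp (- (c / t * (norm y)\<^sup>2))"
    if t: "t > 0" for t and y :: "real^'d"
  proof -
    have "norm (diag_kernel a b t y) \<le> (\<Sum>k\<in>UNIV. norm (diag_kernel a b t y $ k))"
      unfolding norm_vec_def by (rule L2_set_le_sum) simp
    also have "\<dots> \<le> (\<Sum>k\<in>UNIV. sqrt (1 / (4 * pi * norm (a $ k))) ^ CARD('d)
        * (exp (\<beta> * t) * (1 / sqrt t) ^ CARD('d) * exp (- (c / t * (norm y)\<^sup>2))))"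
    proof (rule sum_mono)
      fix k
      have "norm (b $ k) \<le> \<beta>"
        unfolding \<beta>_def by (rule member_le_sum) auto
      then have "- Re (b $ k) \<le> \<beta>"
        using abs_Re_le_cmod[of "b $ k"] by linarith
      then have e1: "norm (exp (- (of_real t * b $ k))) \<le> exp (\<beta> * t)"
        using t mult_left_mono[of "- Re (b $ k)" \<beta> t] by (simp add: norm_exp_eq_Re mult.commute)
      have "c / t \<le> Re (1 / a $ k) / (4 * t)"
        using divide_right_mono[OF c_le[of k], of t] t by simp
      then have e2: "exp (- (Re (1 / a $ k) / (4 * t) * (norm y)\<^sup>2)) \<le> exp (- (c / t * (norm y)\<^sup>2))"
        unfolding exp_le_cancel_iff neg_le_iff_le by (rule mult_right_mono) simp
      have s: "sqrt (1 / (4 * pi * t * norm (a $ k))) = sqrt (1 / (4 * pi * norm (a $ k))) * (1 / sqrt t)"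
        by (simp add: real_sqrt_divide real_sqrt_mult)
      have "norm (diag_kernel a b t y $ k) = norm (exp (- (of_real t * b $ k)))
          * (sqrt (1 / (4 * pi * norm (a $ k))) ^ CARD('d) * (1 / sqrt t) ^ CARD('d)
            * exp (- (Re (1 / a $ k) / (4 * t) * (norm y)\<^sup>2)))"
        by (simp only: diag_kernel_component norm_mult gauss_kernel_norm[OF a t] s power_mult_distrib DIM_cart DIM_real mult_1_right)
      also have "\<dots> \<le> exp (\<beta> * t) * (sqrt (1 / (4 * pi * norm (a $ k))) ^ CARD('d) * (1 / sqrt t) ^ CARD('d)
            * exp (- (c / t * (norm y)\<^sup>2)))"
        using t by (intro mult_mono e1 e2 order_refl mult_nonneg_nonneg) auto
      finally show "norm (diag_kernel a b t y $ k) \<le> sqrt (1 / (4 * pi * norm (a $ k))) ^ CARD('d)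
          * (exp (\<beta> * t) * (1 / sqrt t) ^ CARD('d) * exp (- (c / t * (norm y)\<^sup>2)))"
        by (simp only: mult_ac)
    qed
    also have "\<dots> = m * exp (\<beta> * t) * (1 / sqrt t) ^ CARD('d) * exp (- (c / t * (norm y)\<^sup>2))"
      by (simp only: m_def sum_distrib_right mult.assoc)
    finally show ?thesis .
  qed
  show ?thesis by (rule that[OF m\<beta> c0 bound])
qed

text \<open>With R z = \<zeta>, the vector R \<xi> - \<zeta> equals R (\<xi> - z), and the Gaussian
  does not see the isometry R. What remains is the scalar convolution centred at z; its value at x -
  z is rotated back in the same way.\<close>

lemma diag_kernel_convolution:
  fixes a b :: "complex^'n" and x \<zeta> :: "real^'d"
  assumes a: "\<And>k. Re (a $ k) > 0" and s: "s > 0" and t: "t > 0"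
    and R: "orthogonal_transformation R"
  shows "integrable lborel (\<lambda>\<xi>. diag_kernel a b s (x - \<xi>) * diag_kernel a b t (R \<xi> - \<zeta>))"
    and "(LINT \<xi>|lborel. diag_kernel a b s (x - \<xi>) * diag_kernel a b t (R \<xi> - \<zeta>))
      = diag_kernel a b (s + t) (R x - \<zeta>)"
proof -
  obtain z where z: "R z = \<zeta>"
    using orthogonal_transformation_surj[OF R] by (metis surj_def)
  have R_diff: "R u - \<zeta> = R (u - z)" for u
    using linear_diff[OF orthogonal_transformation_linear[OF R]] z by simp
  have rot: "gauss_kernel (a $ k) r (R u - \<zeta>) = gauss_kernel (a $ k) r (u - z)" for k r u
    unfolding R_diff by (rule gauss_kernel_cong_norm) (rule orthogonal_transformation_norm[OF R])
  let ?f = "\<lambda>k \<xi>. gauss_kernel (a $ k) s (x - \<xi>) * gauss_kernel (a $ k) t (\<xi> - z)"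
  have [measurable]: "gauss_kernel (a $ k) r \<in> borel_measurable (borel :: (real^'d) measure)" for k r
    by (intro borel_measurable_continuous_onI continuous_gauss_kernel)
  have int: "integrable lborel (?f k)" for k
  proof -
    \<comment> \<open>The maximum of the modulus of the first kernel, attained at the origin: the
      product is dominated by a constant times an integrable kernel.\<close>
    define L where "L = sqrt (1 / (4 * pi * s * norm (a $ k))) ^ CARD('d)"
    have L: "norm (gauss_kernel (a $ k) s u) \<le> L" for u :: "real^'d"
    proof -
      have "Re (1 / a $ k) / (4 * s) * (norm u)\<^sup>2 \<ge> 0"
        using Re_inverse_scaled_pos[OF a s, of k] by (intro mult_nonneg_nonneg) simp_all
      then show ?thesis
        unfolding gauss_kernel_norm[OF a s] L_def using s by (simp add: mult_left_le)
    qed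
    have "integrable lborel (\<lambda>\<xi>::real^'d. gauss_kernel (a $ k) t (\<xi> - z))"
    proof -
      have "integrable (distr lborel borel ((+) (- z))) (gauss_kernel (a $ k) t :: real^'d \<Rightarrow> complex)"
        unfolding lborel_distr_plus by (rule gauss_kernel_integrable[OF a t])
      then show ?thesis
        by (subst (asm) integrable_distr_eq) simp_all
    qed
    from integrable_mult_right[OF this, of "of_real L"] show ?thesis
    proof (rule Bochner_Integration.integrable_bound)
      show "AE \<xi> in lborel. norm (?f k \<xi>) \<le> norm (of_real L * gauss_kernel (a $ k) t (\<xi> - z))"
        using L order_trans[OF L abs_ge_self]
        by (auto simp: norm_mult intro!: mult_right_mono always_eventually)
    qed measurable
  qed
  have prod_component: "(diag_kernel a b s (x - \<xi>) * diag_kernel a b t (R \<xi> - \<zeta>)) $ k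
      = exp (- (of_real (s + t) * b $ k)) * ?f k \<xi>" for k \<xi>
  proof -
    have "exp (- (of_real (s + t) * b $ k)) = exp (- (of_real s * b $ k)) * exp (- (of_real t * b $ k))"
      by (simp add: distrib_right flip: exp_add)
    then show ?thesis
      by (simp only: vector_mult_component diag_kernel_component rot mult_ac)
  qed
  have int': "integrable lborel (\<lambda>\<xi>. (diag_kernel a b s (x - \<xi>) * diag_kernel a b t (R \<xi> - \<zeta>)) $ k)" for k
    unfolding prod_component by (intro integrable_mult_right int)
  then show "integrable lborel (\<lambda>\<xi>. diag_kernel a b s (x - \<xi>) * diag_kernel a b t (R \<xi> - \<zeta>))"
    by (rule integrable_vec)
  have "(LINT \<xi>|lborel. ?f k \<xi>) = gauss_kernel (a $ k) (s + t) (x - z)" for k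
  proof -
    have "(LINT \<xi>|lborel. ?f k \<xi>) = (LINT \<xi>|lborel. ?f k (z + \<xi>))"
      by (rule integral_lborel_shift[symmetric]) measurable
    also have "\<dots> = gauss_kernel (a $ k) (s + t) (x - z)"
      using gauss_kernel_convolution[OF a s t, of k "x - z"] by (simp add: diff_diff_eq)
    finally show ?thesis .
  qed
  then show "(LINT \<xi>|lborel. diag_kernel a b s (x - \<xi>) * diag_kernel a b t (R \<xi> - \<zeta>))
      = diag_kernel a b (s + t) (R x - \<zeta>)"
    unfolding vec_eq_iff integral_vec_component[OF int'] prod_component
    by (simp add: diag_kernel_component rot)
qed

subsection \<open>The semigroup on the weighted space\<close>

context radial_weight
begin

lemma norm_scaleR_weight: "norm (\<theta> x *\<^sub>R u) = \<theta> x * norm u"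
  using pos[of x] by simp

end

text \<open>On a compact set \<theta> has a positive minimum, so |v| <= 1 + |v|^p makes a measurable
  v of finite weighted norm locally integrable. Conversely, local integrability gives measurability,
  v being the limit of its restrictions to growing balls.\<close>

lemma Lp_space_iff:
  fixes \<theta> :: "real^'d \<Rightarrow> real" and v :: "real^'d \<Rightarrow> complex^'n"
  assumes "radial_weight \<theta> \<eta> C p"
  shows "v \<in> Lp_space p \<theta> \<longleftrightarrow>
    v \<in> borel_measurable lebesgue \<and> integrable lebesgue (\<lambda>x. (\<theta> x * norm (v x)) powr p)"
proof
  interpret radial_weight \<theta> \<eta> C p by fact
  show "v \<in> borel_measurable lebesgue \<and> integrable lebesgue (\<lambda>x. (\<theta> x * norm (v x)) powr p)"
    if v: "v \<in> Lp_space p \<theta>"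
  proof
    have "set_integrable lebesgue (cball 0 (real m)) v" for m
      using v by (simp add: Lp_space_def locally_integrable_def)
    then have meas: "(\<lambda>x. indicator (cball 0 (real m)) x *\<^sub>R v x) \<in> borel_measurable lebesgue" for m
      unfolding set_integrable_def by (rule borel_measurable_integrable)
    have lim: "(\<lambda>m. indicator (cball 0 (real m)) x *\<^sub>R v x) \<longlonglongrightarrow> v x" for x
    proof (rule tendsto_eventually)
      obtain m where "norm x \<le> real m" using real_arch_simple by blast
      then show "\<forall>\<^sub>F m in sequentially. indicator (cball 0 (real m)) x *\<^sub>R v x = v x"
        by (intro eventually_sequentiallyI[of m]) (auto simp: indicator_def)
    qed
    show "v \<in> borel_measurable lebesgue"
      by (rule borel_measurable_LIMSEQ_metric[OF meas lim])
    show "integrable lebesgue (\<lambda>x. (\<theta> x * norm (v x)) powr p)"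
      using v by (simp add: Lp_space_def norm_scaleR_weight del: norm_scaleR)
  qed
  show "v \<in> Lp_space p \<theta>"
    if "v \<in> borel_measurable lebesgue \<and> integrable lebesgue (\<lambda>x. (\<theta> x * norm (v x)) powr p)"
  proof -
    from that have [measurable]: "v \<in> borel_measurable lebesgue"
      and int: "integrable lebesgue (\<lambda>x. (\<theta> x * norm (v x)) powr p)" by auto
    have "set_integrable lebesgue K v" if K: "compact K" for K
    proof (cases "K = {}")
      case False
      have K_sets [measurable]: "K \<in> sets lebesgue"
        using K by (simp add: borel_compact)
      obtain x0 where x0: "\<And>x. x \<in> K \<Longrightarrow> \<theta> x0 \<le> \<theta> x"
        using continuous_attains_inf[OF K False continuous_on_subset[OF continuous subset_UNIV]] by blast
      have fin: "emeasure lebesgue K < \<infinity>"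
        using emeasure_compact_finite[OF K] K by (simp add: emeasure_completion borel_compact)
      have "integrable lebesgue (\<lambda>x. indicator K x + 1 / \<theta> x0 powr p * (\<theta> x * norm (v x)) powr p)"
        using fin int by (intro Bochner_Integration.integrable_add integrable_mult_right integrable_real_indicator) auto
      then show ?thesis
        unfolding set_integrable_def
      proof (rule Bochner_Integration.integrable_bound)
        show "AE x in lebesgue. norm (indicator K x *\<^sub>R v x)
            \<le> norm (indicator K x + 1 / \<theta> x0 powr p * (\<theta> x * norm (v x)) powr p)"
        proof (intro always_eventually allI)
          fix x
          have "norm (v x) \<le> 1 + 1 / \<theta> x0 powr p * (\<theta> x * norm (v x)) powr p" if "x \<in> K"
          proof -
            have "norm (v x) \<le> 1 + norm (v x) powr p"
              using p powr_mono[of 1 p "norm (v x)"] by (smt (verit) powr_ge_zero powr_one norm_ge_zero)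
            also have "norm (v x) powr p = 1 / \<theta> x0 powr p * (\<theta> x0 * norm (v x)) powr p"
              using pos[of x0] by (simp add: powr_mult)
            also have "\<dots> \<le> 1 / \<theta> x0 powr p * (\<theta> x * norm (v x)) powr p"
              using pos[of x0] p x0[OF that] by (intro mult_left_mono powr_mono2 mult_right_mono) auto
            finally show ?thesis by simp
          qed
          then show "norm (indicator K x *\<^sub>R v x)
              \<le> norm (indicator K x + 1 / \<theta> x0 powr p * (\<theta> x * norm (v x)) powr p)"
            by (auto simp: indicator_def)
        qed
      qed measurable
    qed (simp add: set_integrable_def)
    then show ?thesis
      using int by (simp add: Lp_space_def locally_integrable_def norm_scaleR_weight del: norm_scaleR)
  qed
qed

lemma Lp_space_borel_representative:
  fixes \<theta> :: "real^'d \<Rightarrow> real" and v :: "real^'d \<Rightarrow> complex^'n"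
  assumes "radial_weight \<theta> \<eta> C p" and v: "v \<in> Lp_space p \<theta>"
  obtains v' where "v' \<in> borel_measurable borel" "AE x in lborel. v x = v' x"
    "integrable lborel (\<lambda>x. (\<theta> x * norm (v' x)) powr p)"
proof -
  interpret radial_weight \<theta> \<eta> C p by fact
  have [measurable]: "v \<in> borel_measurable lebesgue"
    and int: "integrable lebesgue (\<lambda>x. (\<theta> x * norm (v x)) powr p)"
    using v by (auto simp: Lp_space_iff[OF assms(1)])
  obtain v' where v' [measurable]: "v' \<in> borel_measurable borel" and eq: "AE x in lborel. v x = v' x"
    by (rule lebesgue_measurable_ex_borel[of v]) measurable
  have meas: "(\<lambda>x. (\<theta> x * norm (v' x)) powr p) \<in> borel_measurable lebesgue"
    by (rule measurable_completion) measurable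
  have "AE x in lebesgue. (\<theta> x * norm (v x)) powr p = (\<theta> x * norm (v' x)) powr p"
    using AE_completion[OF eq] by eventually_elim simp
  then have "integrable lebesgue (\<lambda>x. (\<theta> x * norm (v' x)) powr p)"
    by (rule integrable_cong_AE[THEN iffD1, OF borel_measurable_integrable[OF int] meas _ int])
  then have "integrable lborel (\<lambda>x. (\<theta> x * norm (v' x)) powr p)"
    by (subst (asm) integrable_completion) measurable
  with v' eq show ?thesis by (rule that)
qed

lemma Lp_norm_eq:
  fixes \<theta> :: "real^'d \<Rightarrow> real" and v :: "real^'d \<Rightarrow> complex^'n"
  assumes "radial_weight \<theta> \<eta> C p" and v: "v \<in> borel_measurable lebesgue"
    and v' [measurable]: "v' \<in> borel_measurable borel" and eq: "AE x in lborel. v x = v' x"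
  shows "Lp_norm p \<theta> v = (LINT x|lborel. (\<theta> x * norm (v' x)) powr p) powr (1 / p)"
proof -
  interpret radial_weight \<theta> \<eta> C p by fact
  note [measurable] = v
  have [measurable]: "(\<lambda>x. (\<theta> x * norm (v' x)) powr p) \<in> borel_measurable lebesgue" "\<theta> \<in> borel_measurable lebesgue"
    by (rule measurable_completion, measurable)+
  have "(LINT x|lebesgue. (\<theta> x * norm (v x)) powr p) = (LINT x|lebesgue. (\<theta> x * norm (v' x)) powr p)"
    by (intro integral_cong_AE) (use AE_completion[OF eq] in \<open>auto elim!: eventually_mono\<close>)
  also have "\<dots> = (LINT x|lborel. (\<theta> x * norm (v' x)) powr p)"
    by (rule integral_completion) measurable
  finally show ?thesis
    by (simp add: Lp_norm_def norm_scaleR_weight del: norm_scaleR)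
qed

text \<open>Transfers the results on \<open>T\<close>, defined by Borel integrals, to operators
  given by Lebesgue integrals on arbitrary elements of the space. The second conclusion confirms
  that these integrals converge almost everywhere.\<close>

lemma diffusion_kernel_C0_semigroup:
  fixes \<theta> :: "real^'d \<Rightarrow> real" and act :: "'c::euclidean_space \<Rightarrow> complex^'n \<Rightarrow> complex^'n"
    and P :: "real \<Rightarrow> (real^'d \<Rightarrow> complex^'n) \<Rightarrow> (real^'d \<Rightarrow> complex^'n)"
  assumes "diffusion_kernel \<theta> \<eta> C p act \<kappa> e R M \<beta> c"
    and scale: "\<And>k z u. act k (z *s u) = z *s act k u"
    and P_0: "\<And>v. P 0 v = v"
    and P: "\<And>t v x. t > 0 \<Longrightarrow> P t v x = (LINT \<xi>|lebesgue. act (\<kappa> t (R t x - \<xi>)) (v \<xi>))"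
  shows "C0_semigroup_on_Lp p \<theta> P"
    and "\<And>t v. t > 0 \<Longrightarrow> v \<in> Lp_space p \<theta> \<Longrightarrow>
      AE x in lebesgue. integrable lebesgue (\<lambda>\<xi>. act (\<kappa> t (R t x - \<xi>)) (v \<xi>))"
proof -
  interpret diffusion_kernel \<theta> \<eta> C p act \<kappa> e R M \<beta> c by fact
  have w: "radial_weight \<theta> \<eta> C p" by unfold_locales
  let ?X = "Lp_space p \<theta> :: (real^'d \<Rightarrow> complex^'n) set"
  let ?N = "\<lambda>v :: real^'d \<Rightarrow> complex^'n. LINT x|lborel. (\<theta> x * norm (v x)) powr p"
  have rep: "\<exists>v'. v' \<in> borel_measurable borel \<and> (AE x in lborel. v x = v' x)
      \<and> integrable lborel (\<lambda>x. (\<theta> x * norm (v' x)) powr p)" if "v \<in> ?X" for v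
    by (rule Lp_space_borel_representative[OF w that]) blast
  have kernel_lebesgue: "(\<lambda>\<xi>. \<kappa> t (R t x - \<xi>)) \<in> borel_measurable lebesgue" if "t > 0" for t x
  proof (rule measurable_completion)
    note [measurable] = kernel_measurable[OF that]
    show "(\<lambda>\<xi>. \<kappa> t (R t x - \<xi>)) \<in> borel_measurable lborel" by measurable
  qed
  \<comment> \<open>The equality holds at every point, not only almost everywhere: changing v on a
    null set leaves each integral over \<xi> unchanged.\<close>
  have P_eq_T: "P t v = T t v'"
    if t: "t > 0" and v: "v \<in> borel_measurable lebesgue"
      and v' [measurable]: "v' \<in> borel_measurable borel" and eq: "AE x in lborel. v x = v' x" for t v v'
  proof
    fix x
    note [measurable] = kernel_measurable[OF t]
    have v'_lebesgue: "v' \<in> borel_measurable lebesgue"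
      by (rule measurable_completion) measurable
    have "(LINT \<xi>|lebesgue. act (\<kappa> t (R t x - \<xi>)) (v \<xi>)) = (LINT \<xi>|lebesgue. act (\<kappa> t (R t x - \<xi>)) (v' \<xi>))"
    proof (rule integral_cong_AE)
      show "AE \<xi> in lebesgue. act (\<kappa> t (R t x - \<xi>)) (v \<xi>) = act (\<kappa> t (R t x - \<xi>)) (v' \<xi>)"
        using AE_completion[OF eq] by eventually_elim simp
    qed (intro act_measurable kernel_lebesgue t v v'_lebesgue)+
    also have "\<dots> = T t v' x"
      unfolding T_def by (rule integral_completion) measurable
    finally show "P t v x = T t v' x"
      by (simp add: P[OF t])
  qed
  have T_lebesgue: "T t v' \<in> borel_measurable lebesgue" if "t > 0" "v' \<in> borel_measurable borel" for t v'
    using measurable_completion[of "T t v'" lborel borel] T_measurable[OF that] by simp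
  have T_in: "T t v' \<in> ?X"
    if t: "t > 0" and v' [measurable]: "v' \<in> borel_measurable borel"
      and int: "integrable lborel (\<lambda>x. (\<theta> x * norm (v' x)) powr p)" for t v'
  proof -
    note [measurable] = T_measurable[OF t v']
    have "integrable lebesgue (\<lambda>x. (\<theta> x * norm (T t v' x)) powr p)"
      using T_bounded(1)[OF t v' int] by (subst integrable_completion) measurable
    then show ?thesis
      using T_lebesgue[OF t v'] by (simp add: Lp_space_iff[OF w])
  qed
  have borel_rep: "\<exists>v'. v' \<in> borel_measurable borel \<and> (AE x in lborel. v x = v' x)
      \<and> integrable lborel (\<lambda>x. (\<theta> x * norm (v' x)) powr p) \<and> (\<forall>t>0. P t v = T t v')
      \<and> v \<in> borel_measurable lebesgue" if v_in: "v \<in> ?X" for v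
  proof -
    obtain v' where v': "v' \<in> borel_measurable borel" "AE x in lborel. v x = v' x"
        "integrable lborel (\<lambda>x. (\<theta> x * norm (v' x)) powr p)"
      using rep[OF v_in] by blast
    moreover have v: "v \<in> borel_measurable lebesgue"
      using v_in by (simp add: Lp_space_iff[OF w])
    moreover have "\<forall>t>0. P t v = T t v'"
      by (intro allI impI P_eq_T v v')
    ultimately show ?thesis by blast
  qed
  have kernel_int: "AE x in lebesgue. integrable lebesgue (\<lambda>\<xi>. act (\<kappa> t (R t x - \<xi>)) (v \<xi>))"
    if t: "t > 0" and v: "v \<in> ?X" for t v
  proof -
    obtain v' where v' [measurable]: "v' \<in> borel_measurable borel" and eq: "AE x in lborel. v x = v' x"
      and int: "integrable lborel (\<lambda>x. (\<theta> x * norm (v' x)) powr p)" and v_lebesgue: "v \<in> borel_measurable lebesgue"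
      using borel_rep[OF v] by blast
    note [measurable] = kernel_measurable[OF t]
    have v'_lebesgue: "v' \<in> borel_measurable lebesgue"
      by (rule measurable_completion) measurable
    show ?thesis
    proof (rule AE_completion, use kernel_integrable_AE[OF t v' int] in eventually_elim)
      fix x
      assume "integrable lborel (\<lambda>\<xi>. act (\<kappa> t (R t x - \<xi>)) (v' \<xi>))"
      then have *: "integrable lebesgue (\<lambda>\<xi>. act (\<kappa> t (R t x - \<xi>)) (v' \<xi>))"
        by (subst integrable_completion) measurable
      show "integrable lebesgue (\<lambda>\<xi>. act (\<kappa> t (R t x - \<xi>)) (v \<xi>))"
      proof (rule integrable_cong_AE[THEN iffD1, OF _ _ _ *])
        show "AE \<xi> in lebesgue. act (\<kappa> t (R t x - \<xi>)) (v' \<xi>) = act (\<kappa> t (R t x - \<xi>)) (v \<xi>)"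
          using AE_completion[OF eq] by eventually_elim simp
      qed (intro act_measurable kernel_lebesgue t v_lebesgue v'_lebesgue)+
    qed
  qed
  show "\<And>t v. t > 0 \<Longrightarrow> v \<in> Lp_space p \<theta> \<Longrightarrow>
      AE x in lebesgue. integrable lebesgue (\<lambda>\<xi>. act (\<kappa> t (R t x - \<xi>)) (v \<xi>))"
    by (rule kernel_int)
  have P_in: "P t v \<in> ?X" if "t \<ge> 0" and v: "v \<in> ?X" for t v
  proof (cases "t = 0")
    case False
    then have t: "t > 0" using that by simp
    obtain v' where v': "v' \<in> borel_measurable borel"
        "integrable lborel (\<lambda>x. (\<theta> x * norm (v' x)) powr p)" "P t v = T t v'"
      using borel_rep[OF v] t by blast
    show ?thesis
      unfolding v'(3) by (rule T_in[OF t v'(1,2)])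
  qed (use that P_0 in simp)
  have P_cong: "AE x in lebesgue. P t u x = P t v x"
    if "t \<ge> 0" and u: "u \<in> ?X" and v: "v \<in> ?X" and eq: "AE x in lebesgue. u x = v x" for t u v
  proof (cases "t = 0")
    case False
    then have t: "t > 0" using that by simp
    obtain u' where u': "u' \<in> borel_measurable borel" "AE x in lborel. u x = u' x" "P t u = T t u'"
      using borel_rep[OF u] t by blast
    have "AE x in lborel. u x = v x"
      using eq by (simp only: AE_completion_iff)
    then have "AE x in lborel. v x = u' x"
      using u'(2) by eventually_elim simp
    then have "P t v = T t u'"
      using v by (intro P_eq_T t u'(1)) (simp_all add: Lp_space_iff[OF w])
    then show ?thesis by (simp add: u'(3))
  qed (use eq P_0 in simp)
  have P_linear: "AE x in lebesgue. P t (\<lambda>y. z *s u y + z' *s v y) x = z *s P t u x + z' *s P t v x"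
    if "t \<ge> 0" "u \<in> ?X" "v \<in> ?X" for t u v z z'
  proof (cases "t = 0")
    case False
    then have t: "t > 0" using that by simp
    have *: "P t f x = (LINT \<xi>|lebesgue. act (\<kappa> t (R t x - \<xi>)) (f \<xi>))" for f x
      by (rule P[OF t])
    have bl: "bounded_linear ((*s) y :: complex^'n \<Rightarrow> complex^'n)" for y
      by (simp add: linear_conv_bounded_linear[symmetric] linear_iff vec_eq_iff algebra_simps)
    show ?thesis
      using kernel_int[OF t that(2)] kernel_int[OF t that(3)]
    proof eventually_elim
      case (elim x)
      note int = integrable_bounded_linear[OF bl elim(1), of z] integrable_bounded_linear[OF bl elim(2), of z']
      show ?case
        unfolding *
        by (simp only: act.add_right scale Bochner_Integration.integral_add[OF int]
            integral_bounded_linear[OF bl elim(1)] integral_bounded_linear[OF bl elim(2)])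
    qed
  qed (simp add: P_0)
  have Lp_norm_T: "Lp_norm p \<theta> (T t v') = ?N (T t v') powr (1 / p)"
    if "t > 0" "v' \<in> borel_measurable borel" for t v'
    using Lp_norm_eq[OF w T_lebesgue[OF that] T_measurable[OF that]] by simp
  have P_bounded: "\<exists>K. \<forall>v\<in>?X. Lp_norm p \<theta> (P t v) \<le> K * Lp_norm p \<theta> v" if "t \<ge> 0" for t
  proof (cases "t = 0")
    case False
    then have t: "t > 0" using that by simp
    have "Lp_norm p \<theta> (P t v) \<le> (C * mass t) * Lp_norm p \<theta> v" if v: "v \<in> ?X" for v
    proof -
      obtain v' where v': "v' \<in> borel_measurable borel" "AE x in lborel. v x = v' x"
          "integrable lborel (\<lambda>x. (\<theta> x * norm (v' x)) powr p)" "P t v = T t v'" "v \<in> borel_measurable lebesgue"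
        using borel_rep[OF v] t by blast
      have "Lp_norm p \<theta> (P t v) = ?N (T t v') powr (1 / p)"
        by (simp add: v'(4) Lp_norm_T[OF t v'(1)])
      also have "\<dots> \<le> (C powr p * mass t powr p * ?N v') powr (1 / p)"
        using T_bounded(2)[OF t v'(1,3)] p by (intro powr_mono2) (auto intro: integral_nonneg_AE)
      also have "\<dots> = C * mass t * ?N v' powr (1 / p)"
        using p C mass_nonneg[OF t]
        by (simp add: powr_mult powr_powr integral_nonneg_AE)
      also have "?N v' powr (1 / p) = Lp_norm p \<theta> v"
        by (rule Lp_norm_eq[OF w v'(5,1,2), symmetric])
      finally show ?thesis .
    qed
    then show ?thesis by blast
  qed (auto simp: P_0 intro!: exI[of _ 1])
  have P_semigroup: "AE x in lebesgue. P (s + t) v x = P s (P t v) x"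
    if "s \<ge> 0" "t \<ge> 0" and v: "v \<in> ?X" for s t v
  proof (cases "s = 0 \<or> t = 0")
    case False
    then have st: "s > 0" "t > 0" "s + t > 0" using that by auto
    obtain v' where v': "v' \<in> borel_measurable borel"
        "integrable lborel (\<lambda>x. (\<theta> x * norm (v' x)) powr p)" "\<forall>t>0. P t v = T t v'"
      using borel_rep[OF v] by blast
    have "P s (P t v) = T s (T t v')"
      using v'(3) st by (intro P_eq_T T_measurable v'(1)) (auto intro: T_lebesgue v'(1))
    then show ?thesis
      using AE_completion[OF T_semigroup[OF st(1,2) v'(1,2)]] v'(3) st by simp
  qed (auto simp: P_0)
  have P_continuous: "((\<lambda>t. Lp_norm p \<theta> (\<lambda>x. P t v x - v x)) \<longlongrightarrow> 0) (at_right 0)" if v: "v \<in> ?X" for v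
  proof -
    obtain v' where v' [measurable]: "v' \<in> borel_measurable borel" and eq: "AE x in lborel. v x = v' x"
      and int: "integrable lborel (\<lambda>x. (\<theta> x * norm (v' x)) powr p)" and P_T: "\<forall>t>0. P t v = T t v'"
      and v_lebesgue: "v \<in> borel_measurable lebesgue"
      using borel_rep[OF v] by blast
    have "((\<lambda>t. ?N (\<lambda>x. T t v' x - v' x) powr (1 / p)) \<longlongrightarrow> 0) (at_right 0)"
      using p by (intro tendsto_zero_powrI[OF T_strongly_continuous[OF v' int] tendsto_const])
        (auto intro!: always_eventually integral_nonneg_AE)
    moreover have "\<forall>\<^sub>F t in at_right 0. ?N (\<lambda>x. T t v' x - v' x) powr (1 / p) = Lp_norm p \<theta> (\<lambda>x. P t v x - v x)"
      unfolding eventually_at_filter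
    proof (intro always_eventually allI impI)
      fix t :: real assume "t \<in> {0<..}"
      then have t: "t > 0" by simp
      note [measurable] = T_measurable[OF t v']
      show "?N (\<lambda>x. T t v' x - v' x) powr (1 / p) = Lp_norm p \<theta> (\<lambda>x. P t v x - v x)"
      proof (rule Lp_norm_eq[OF w, symmetric])
        show "(\<lambda>x. P t v x - v x) \<in> borel_measurable lebesgue"
          using P_T t T_lebesgue[OF t v'] v_lebesgue by (intro borel_measurable_diff) simp_all
        show "AE x in lborel. P t v x - v x = T t v' x - v' x"
          using eq by eventually_elim (use P_T t in simp)
      qed measurable
    qed
    ultimately show ?thesis by (rule Lim_transform_eventually)
  qed
  show "C0_semigroup_on_Lp p \<theta> P"
    unfolding C0_semigroup_on_Lp_def
    by (intro conjI allI ballI impI P_in P_cong P_linear P_bounded P_semigroup P_continuous) (simp_all add: P_0)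
qed

text \<open>The integrability clause stands beside the semigroup property because a divergent
  Bochner integral would silently have the value 0; it certifies that the defining integrals exist
  for almost every x.\<close>

theorem theorem5p3:
  fixes A B :: "complex^'n^'n"
    and S :: "real^'d^'d"
    and \<theta> :: "real^'d \<Rightarrow> real"
    and p \<eta> :: real
  assumes "CARD('d) \<ge> 2"
    and "simultaneously_diagonalizable A B"
    and "\<And>\<mu>. mat_eigenvalue A \<mu> \<Longrightarrow> Re \<mu> > 0"
    and "skew_symmetric S"
    and "1 \<le> p"
    and "\<eta> \<ge> 0"
    and "weight_function \<eta> \<theta>"
    and "radial \<theta>"
    and "((\<lambda>\<psi>. SUP x. \<bar>(\<theta> (x + \<psi>) - \<theta> x) / \<theta> x\<bar>) \<longlongrightarrow> 0) (at 0)"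
  shows "(\<forall>t>0. \<forall>v\<in>Lp_space p \<theta>. AE x in lebesgue.
            integrable lebesgue (\<lambda>\<xi>. heat_kernel A B S x \<xi> t *v v \<xi>))
       \<and> C0_semigroup_on_Lp p \<theta> (heat_op A B S)"
proof -
  obtain Y :: "complex^'n^'n" and a0 b0 where Y: "invertible Y"
    and "A = Y ** diag_mat a0 ** matrix_inv Y" "B = Y ** diag_mat b0 ** matrix_inv Y"
    using assms(2) unfolding simultaneously_diagonalizable_def by blast
  then obtain a b where A: "A = diag_in Y a" and B: "B = diag_in Y b"
    by (metis diag_in_def vec_lambda_beta ext)
  have a: "Re (a $ k) > 0" for k
    using assms(3) mat_eigenvalue_diag_in[OF Y, of a k] by (simp add: A)
  let ?R = "\<lambda>t. (*v) (mat_exp (t *\<^sub>R S))"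
  let ?\<kappa> = "diag_kernel a b :: real \<Rightarrow> real^'d \<Rightarrow> complex^'n"
  obtain C where C: "C > 0" "\<And>x y. \<theta> (x + y) \<le> C * \<theta> x * exp (\<eta> * norm y)"
    using assms(7) unfolding weight_function_def by blast
  obtain m \<beta> c where m: "m \<ge> 0" "\<beta> \<ge> 0" "c > 0"
    and bound: "\<And>t y. t > 0 \<Longrightarrow> norm (?\<kappa> t y)
      \<le> m * exp (\<beta> * t) * (1 / sqrt t) ^ CARD('d) * exp (- (c / t * (norm y)\<^sup>2))"
    using diag_kernel_bound[OF a] by blast
  interpret act: bounded_bilinear "diag_act Y" by (rule bounded_bilinear_diag_act)
  \<comment> \<open>The bound of the bilinear action, which accounts for the change of basis by Y.
    The locale constant M becomes m times K.\<close>
  obtain K where K: "K \<ge> 0" "\<And>l u. norm (diag_act Y l u) \<le> norm l * norm u * K"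
    using act.nonneg_bounded by blast
  have R: "orthogonal_transformation (?R t)" for t
    by (rule mat_exp_orthogonal[OF assms(4)])
  have R_add: "?R t (?R s x) = ?R (s + t) x" for s t x
    by (simp add: matrix_vector_mul_assoc add.commute flip: mat_exp_add)
  have kernel: "diffusion_kernel \<theta> \<eta> C p (diag_act Y) ?\<kappa> 1 ?R (m * K) \<beta> c"
  proof
    show "continuous_on UNIV \<theta>" "\<theta> x > 0" for x
      using assms(7) by (auto simp: weight_function_def)
    show "\<theta> x = \<theta> y" if "norm x = norm y" for x y
      using assms(8) that by (auto simp: radial_def)
    show "norm (diag_act Y (?\<kappa> t y) u)
        \<le> m * K * exp (\<beta> * t) * (1 / sqrt t) ^ DIM(real^'d) * exp (- (c / t * (norm y)\<^sup>2)) * norm u" if "t > 0" for t y u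
    proof -
      have "norm (diag_act Y (?\<kappa> t y) u) \<le> norm (?\<kappa> t y) * (norm u * K)"
        using K(2) by (simp add: mult.assoc)
      also have "\<dots> \<le> (m * exp (\<beta> * t) * (1 / sqrt t) ^ CARD('d) * exp (- (c / t * (norm y)\<^sup>2))) * (norm u * K)"
        using K(1) by (intro mult_right_mono bound that) simp
      finally show ?thesis by (simp add: mult_ac)
    qed
    show "(LINT \<xi>|lborel. diag_act Y (?\<kappa> s (?R s x - \<xi>)) (diag_act Y (?\<kappa> t (?R t \<xi> - \<zeta>)) u))
        = diag_act Y (?\<kappa> (s + t) (?R (s + t) x - \<zeta>)) u" if "s > 0" "t > 0" for s t x \<zeta> u
    proof -
      note conv = diag_kernel_convolution[OF a that R, of b "?R s x" t \<zeta>]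
      show ?thesis
        using integral_bounded_linear[OF act.bounded_linear_left[of u] conv(1)]
        by (simp add: diag_act_mult[OF Y] conv(2) R_add)
    qed
    show "integrable lborel (?\<kappa> t)" if "t > 0" for t
      by (rule diag_kernel_integrable[OF a that])
    show "((\<lambda>t. LINT y|lborel. ?\<kappa> t y) \<longlongrightarrow> 1) (at_right 0)"
      by (rule diag_kernel_tendsto[OF a])
    show "((\<lambda>t. ?R t x) \<longlongrightarrow> x) (at_right 0)" for x
      by (rule mat_exp_tendsto)
  qed (use assms(5,6) C m K R diag_act_one[OF Y] bounded_bilinear_diag_act in auto)
  have heat: "heat_kernel A B S x \<xi> t *v u = diag_act Y (?\<kappa> t (?R t x - \<xi>)) u" if "t > 0" for x \<xi> t u
    unfolding A B by (rule heat_kernel_diag[OF Y a that])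
  have "C0_semigroup_on_Lp p \<theta> (heat_op A B S)"
    by (rule diffusion_kernel_C0_semigroup(1)[OF kernel diag_act_scale]) (simp_all add: heat_op_def heat)
  moreover have "AE x in lebesgue. integrable lebesgue (\<lambda>\<xi>. heat_kernel A B S x \<xi> t *v v \<xi>)"
    if "t > 0" "v \<in> Lp_space p \<theta>" for t v
    using diffusion_kernel_C0_semigroup(2)[OF kernel diag_act_scale _ _ that, of "heat_op A B S"]
    by (simp add: heat_op_def heat that(1))
  ultimately show ?thesis by blast
qed

end
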